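(* Let $D(\lambda)=\begin{pmatrix}2i&\lambda^{-1}+\lambda\bar b\\\lambda^{-1}b+\lambda&-2i\end{pmatrix}$ with $b\in\mathbb C$, $|1+b|<2$, $b\neq-1$ (the degree one potential with $a=1$, $c=2$; then $\det D(1)>0$). Put $\ell=\sqrt{\det D(1)}=\sqrt{3-2\,\mathrm{Re}\,b-|b|^2}\in(0,2)$. Let $v_1,v_2$ be eigenvectors of $D(1)$ for the eigenvalues $i\ell$, $-i\ell$ with $(v_1,v_2)\in\mathrm{SU}_{1,1}$, and let $S\in\Lambda\mathrm{SU}_{1,1\sigma}$ be defined by $S^{-1}=\mathrm{diag}(\lambda^{1/2},\lambda^{-1/2})\,(v_1,v_2)\,\mathrm{diag}(\lambda^{-1/2},\lambda^{1/2})$. Then, for a suitable normalization of $v_1,v_2$, the minimal surface $f$ generated by $(D,S)$ satisfies $f(z+t)=\rho_t.f(z)$ with $\rho_t=\Big(\big(\mathrm{Re}(\alpha(1-e^{2i\ell t})),\ \mathrm{Im}(\alpha(1-e^{2i\ell t})),\ 2\ell t\,\mathfrak c-\tfrac{|\alpha|^2}{2}\sin(2\ell t)\big),\ e^{2i\ell t}\Big)$, i.e. $f$ is a helicoidal minimal surface with respect to the vertical axis through $(\mathrm{Re}\,\alpha,\mathrm{Im}\,\alpha,0)$ with pitch $\mathfrak c$, where $\alpha=\dfrac{i(2+\ell)(-6+\bar b+b(3+2\,\mathrm{Re}\,b)+4\ell)}{\ell^2(1+b)\sqrt{4-\ell^2}}$ and $\mathfrak c=\dfrac{-2\big(3\,\mathrm{Re}\,b-(\mathrm{Re}\,b)^2-|b|^2\mathrm{Re}\,b-|b|^2\big)}{\ell^4}$.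 Moreover $f$ is a rotational surface (pitch $0$) if and only if $3\,\mathrm{Re}\,b-(\mathrm{Re}\,b)^2-|b|^2\mathrm{Re}\,b-|b|^2=0$. Conversely, the degree one potential of any helicoidal minimal surface (not translation invariant) satisfies $\det D(1)>0$.
   Context: $\mathrm{Nil}_3$: $\mathbb R^3$ with group law $(a_1,a_2,a_3)\cdot(x_1,x_2,x_3)=(a_1+x_1,a_2+x_2,a_3+x_3+\tfrac12(a_1x_2-a_2x_1))$; $\mathrm{Iso}_\circ(\mathrm{Nil}_3)\cong\mathrm{Nil}_3\rtimes\mathrm U_1$ with $(p,e^{i\theta}).x=p\cdot(\cos\theta x_1-\sin\theta x_2,\sin\theta x_1+\cos\theta x_2,x_3)$. A helicoidal motion with pitch $\mathfrak c$ along the axis through $\alpha=(a_1,a_2,0)\equiv a_1+ia_2$ is $t\mapsto\big((\mathrm{Re}(\alpha(1-e^{it})),\mathrm{Im}(\alpha(1-e^{it})),\mathfrak ct-\tfrac{|\alpha|^2}2\sin t),e^{it}\big)$. $\mathrm{SU}_{1,1}$ preserves the Hermitian form $|x|^2-|y|^2$. Loop groups: $\sigma_3=\mathrm{diag}(1,-1)$; $\Lambda\mathrm{SL}_2\mathbb C_\sigma$: loops $g:\mathbb S^1\to\mathrm{SL}_2\mathbb C$ with $g(-\lambda)=\sigma_3g(\lambda)\sigma_3$; $\Lambda^+\mathrm{SL}_2\mathbb C_\sigma$: those holomorphic on $|\lambda|<1$; $\Lambda\mathrm{SU}_{1,1\sigma}$: those with $\sigma_3({}^t\overline{g(1/\bar\lambda)})^{-1}\sigma_3=g(\lambda)$.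 A degree one potential is $D(\lambda)=\begin{pmatrix}ic&\lambda^{-1}a+\lambda\bar b\\\lambda^{-1}b+\lambda\bar a&-ic\end{pmatrix}$, $c\in\mathbb R$, $a,b\in\mathbb C$; $\det D(1)=c^2-|a+\bar b|^2$. The surface generated by $(D,S)$: $C=\exp(zD(\lambda))$, Iwasawa decomposition $C=\hat FV_+$ near the real axis ($\hat F\in\Lambda\mathrm{SU}_{1,1\sigma}$, $V_+\in\Lambda^+\mathrm{SL}_2\mathbb C_\sigma$ with positive diagonal at $\lambda=0$), $F=S\hat F$, then the Sym formula $f_{\mathbb L_3}=-i\lambda(\partial_\lambda F)F^{-1}-\tfrac i2F\sigma_3F^{-1}$, $\hat f=(f_{\mathbb L_3})^o-\tfrac i2\lambda(\partial_\lambda f_{\mathbb L_3})^d$; at $\lambda=1$, $\hat f=x_1\mathcal E_1+x_2\mathcal E_2+x_3\mathcal E_3$ with $\mathcal E_1=\tfrac12\begin{pmatrix}0&i\\-i&0\end{pmatrix}$, $\mathcal E_2=\tfrac12\begin{pmatrix}0&-1\\-1&0\end{pmatrix}$, $\mathcal E_3=\tfrac12\begin{pmatrix}-i&0\\0&i\end{pmatrix}$, and the surface is $z\mapsto(x_1,x_2,x_3)$. *)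

theory Defs
  imports "HOL-Analysis.Analysis"
begin

section \<open>2x2 complex matrices\<close>

type_synonym cmat = "complex^2^2"

definition mat2 :: "complex \<Rightarrow> complex \<Rightarrow> complex \<Rightarrow> complex \<Rightarrow> cmat" where
  "mat2 p q r s = (\<chi> i j. if i = 1 then (if j = 1 then p else q) else (if j = 1 then r else s))"

definition cscaleM :: "complex \<Rightarrow> cmat \<Rightarrow> cmat" where
  "cscaleM c A = (\<chi> i j. c * A$i$j)"

text \<open>conjugate transpose\<close>
definition ctrans :: "cmat \<Rightarrow> cmat" where
  "ctrans A = (\<chi> i j. cnj (A$j$i))"

definition sigma3 :: cmat where "sigma3 = mat2 1 0 0 (-1)"

definition offdiag :: "cmat \<Rightarrow> cmat" where "offdiag A = mat2 0 (A$1$2) (A$2$1) 0"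
definition diagpart :: "cmat \<Rightarrow> cmat" where "diagpart A = mat2 (A$1$1) 0 0 (A$2$2)"

text \<open>matrix exponential\<close>
definition mpow :: "cmat \<Rightarrow> nat \<Rightarrow> cmat" where "mpow A n = (((**) A) ^^ n) (mat 1)"
definition mexp :: "cmat \<Rightarrow> cmat" where "mexp A = (\<Sum>n. (1 / fact n) *\<^sub>R mpow A n)"

text \<open>SU(1,1): preserves the Hermitian form |x|^2-|y|^2\<close>
definition SU11 :: "cmat \<Rightarrow> bool" where
  "SU11 P \<longleftrightarrow> det P = 1 \<and> ctrans P ** sigma3 ** P = sigma3"

section \<open>Loop groups (loops are functions on the unit circle)\<close>

definition circle :: "complex set" where "circle = sphere 0 1"

text \<open>twisted SL2C loops on the unit circle\<close>
definition loop_SL2 :: "(complex \<Rightarrow> cmat) \<Rightarrow> bool" where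
  "loop_SL2 g \<longleftrightarrow> continuous_on circle g \<and>
     (\<forall>w\<in>circle. det (g w) = 1 \<and> g (-w) = sigma3 ** g w ** sigma3)"

definition loop_SU11 :: "(complex \<Rightarrow> cmat) \<Rightarrow> bool" where
  "loop_SU11 g \<longleftrightarrow> loop_SL2 g \<and>
     (\<forall>w\<in>circle. sigma3 ** matrix_inv (ctrans (g (1 / cnj w))) ** sigma3 = g w)"

text \<open>Lambda^+ SL2C_sigma: loops extending holomorphically to the open unit disc
  (represented by the extension to the closed disc)\<close>
definition loop_plus :: "(complex \<Rightarrow> cmat) \<Rightarrow> bool" where
  "loop_plus g \<longleftrightarrow> continuous_on (cball 0 1) g \<and>
     (\<forall>i j. (\<lambda>w. g w $ i $ j) holomorphic_on ball 0 1) \<and>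
     (\<forall>w\<in>cball 0 1. det (g w) = 1 \<and> g (-w) = sigma3 ** g w ** sigma3)"

text \<open>Iwasawa decomposition C = Fhat V+, V+ with positive diagonal at lambda = 0\<close>
definition iwasawa :: "(complex \<Rightarrow> cmat) \<Rightarrow> (complex \<Rightarrow> cmat) \<Rightarrow> (complex \<Rightarrow> cmat) \<Rightarrow> bool" where
  "iwasawa C Fh Vp \<longleftrightarrow> loop_SU11 Fh \<and> loop_plus Vp \<and>
     Vp 0 $ 1 $ 1 \<in> \<real> \<and> Re (Vp 0 $ 1 $ 1) > 0 \<and> Vp 0 $ 2 $ 2 \<in> \<real> \<and> Re (Vp 0 $ 2 $ 2) > 0 \<and>
     (\<forall>w\<in>circle. C w = Fh w ** Vp w)"

section \<open>Degree one potential and the generated surface\<close>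

definition deg1_pot :: "complex \<Rightarrow> complex \<Rightarrow> real \<Rightarrow> complex \<Rightarrow> cmat" where
  "deg1_pot a b c w = mat2 (\<i> * of_real c) (a / w + w * cnj b) (b / w + w * cnj a) (- \<i> * of_real c)"

text \<open>lambda d/dlambda of a loop at a point lambda of the unit circle, computed along the
  circle: if lambda = e^{i theta} then lambda d/dlambda = -i d/dtheta\<close>
definition lam_dlam :: "(complex \<Rightarrow> cmat) \<Rightarrow> complex \<Rightarrow> cmat" where
  "lam_dlam G w = cscaleM (-\<i>) (vector_derivative (\<lambda>s. G (cis s)) (at (Arg w)))"

text \<open>Sym formula\<close>
definition fL3 :: "(complex \<Rightarrow> cmat) \<Rightarrow> complex \<Rightarrow> cmat" where
  "fL3 F w = cscaleM (-\<i>) (lam_dlam F w) ** matrix_inv (F w)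
            - cscaleM (\<i>/2) (F w ** sigma3 ** matrix_inv (F w))"

definition hatf :: "(complex \<Rightarrow> cmat) \<Rightarrow> complex \<Rightarrow> cmat" where
  "hatf F w = offdiag (fL3 F w) - cscaleM (\<i>/2) (diagpart (lam_dlam (fL3 F) w))"

definition E1 :: cmat where "E1 = cscaleM (1/2) (mat2 0 \<i> (-\<i>) 0)"
definition E2 :: cmat where "E2 = cscaleM (1/2) (mat2 0 (-1) (-1) 0)"
definition E3 :: cmat where "E3 = cscaleM (1/2) (mat2 (-\<i>) 0 0 \<i>)"

text \<open>surface_point D S z x: the surface generated by (D,S) is defined at z (the Iwasawa
  decomposition of exp(z D) exists) and its value there is x\<close>
definition surface_point ::
  "(complex \<Rightarrow> cmat) \<Rightarrow> (complex \<Rightarrow> cmat) \<Rightarrow> complex \<Rightarrow> real \<times> real \<times> real \<Rightarrow> bool" where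
  "surface_point D S z x \<longleftrightarrow> (\<exists>Fh Vp. iwasawa (\<lambda>w. mexp (cscaleM z (D w))) Fh Vp \<and>
      hatf (\<lambda>w. S w ** Fh w) 1
        = fst x *\<^sub>R E1 + fst (snd x) *\<^sub>R E2 + snd (snd x) *\<^sub>R E3)"

section \<open>Nil_3 and its isometries\<close>

definition nil_mult :: "real \<times> real \<times> real \<Rightarrow> real \<times> real \<times> real \<Rightarrow> real \<times> real \<times> real" where
  "nil_mult a x = (case a of (a1, a2, a3) \<Rightarrow> case x of (x1, x2, x3) \<Rightarrow>
      (a1 + x1, a2 + x2, a3 + x3 + (a1 * x2 - a2 * x1) / 2))"

text \<open>action of (p, e^{i theta}) in Nil_3 \<rtimes> U_1\<close>
definition iso_act :: "(real \<times> real \<times> real) \<times> complex \<Rightarrow> real \<times> real \<times> real \<Rightarrow> real \<times> real \<times> real" where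
  "iso_act g x = (case g of (p, u) \<Rightarrow> case x of (x1, x2, x3) \<Rightarrow>
      nil_mult p (Re u * x1 - Im u * x2, Im u * x1 + Re u * x2, x3))"

text \<open>helicoidal motion with pitch cc along the vertical axis through alpha, at parameter s\<close>
definition helical :: "complex \<Rightarrow> real \<Rightarrow> real \<Rightarrow> (real \<times> real \<times> real) \<times> complex" where
  "helical \<alpha> cc s = ((Re (\<alpha> * (1 - cis s)), Im (\<alpha> * (1 - cis s)), cc * s - (cmod \<alpha>)^2 / 2 * sin s), cis s)"

text \<open>f(z+t) = rho_t . f(z) for real t, wherever the surface is defined\<close>
definition invariant_under :: "(complex \<Rightarrow> cmat) \<Rightarrow> (complex \<Rightarrow> cmat) \<Rightarrow> (real \<Rightarrow> (real \<times> real \<times> real) \<times> complex) \<Rightarrow> bool" where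
  "invariant_under D S \<rho> \<longleftrightarrow> (\<forall>z (t::real) p q. surface_point D S z p \<longrightarrow> surface_point D S (z + of_real t) q
       \<longrightarrow> q = iso_act (\<rho> t) p)"

text \<open>twice differentiable along the circle\<close>
definition C2_loop :: "(complex \<Rightarrow> cmat) \<Rightarrow> bool" where
  "C2_loop S \<longleftrightarrow> (\<exists>S1 S2. \<forall>\<theta>. ((\<lambda>s. S (cis s)) has_vector_derivative S1 \<theta>) (at \<theta>) \<and>
                               (S1 has_vector_derivative S2 \<theta>) (at \<theta>))"

end

theory Submission
  imports Defs "HOL-Complex_Analysis.Conformal_Mappings"
begin

text \<open>
  For real \<open>t\<close> the loop \<open>exp (t D)\<close> is unitary, so uniqueness of the Iwasawa decomposition (Liouville
  after reflection across the circle) gives that the frame at \<open>z + t\<close> is \<open>exp (t D)\<close> times the frame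
  at \<open>z\<close>. Reflection also makes every frame real analytic on the circle, so that the Sym formula at
  \<open>\<lambda> = 1\<close> is a polynomial in the 2-jet of the frame.

  If \<open>S\<close> diagonalizes \<open>D\<close> at \<open>\<lambda> = 1\<close>, then \<open>S exp (t D) = M S\<close> with \<open>M\<close> diagonal at \<open>\<lambda> = 1\<close>, and \<open>M\<close>
  is the exponential of a traceless matrix with eigenvalues \<open>\<plusminus>\<i> t sqrt (det D)\<close>: the diagonal of its
  2-jet gives the rotation and the pitch, the off-diagonal part gives the axis. The pitch is
  unique because the height along the real axis is bounded exactly when it vanishes.

  Conversely, the increment over a real step \<open>s\<close> of the horizontal coordinate along the real axis is
  the off-diagonal entry \<open>\<phi> t\<close> of \<open>exp (t A) \<Delta> exp (- t A)\<close>, where \<open>A\<close> is conjugate to \<open>D(1)\<close> and \<open>\<Delta>\<close>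
  depends on \<open>s\<close> only. For a helicoidal surface \<open>\<phi> t = exp (\<i> \<omega> t) \<phi> 0\<close>. If \<open>det D(1) = - \<kappa>\<^sup>2 \<le> 0\<close>, then
  \<open>\<phi> t + \<phi> (- t) - 2 \<phi> 0\<close> is a constant times the square of \<open>sinh (\<kappa> t) / \<kappa>\<close> (of \<open>t\<close> if \<open>\<kappa> = 0\<close>), which
  vanishes at \<open>t = 0\<close> only; periodicity forces \<open>\<phi> = 0\<close> for every \<open>s\<close>, which contradicts \<open>a \<noteq> 0\<close> to
  first order in \<open>s\<close>.
\<close>

section \<open>Entrywise calculus of 2x2 complex matrices\<close>

lemma mat2_nth [simp]:
  "mat2 p q r s $ 1 $ 1 = p" "mat2 p q r s $ 1 $ 2 = q"
  "mat2 p q r s $ 2 $ 1 = r" "mat2 p q r s $ 2 $ 2 = s"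
  by (simp_all add: mat2_def)

lemma cmat_eq_iff:
  "(A::cmat) = B \<longleftrightarrow> A$1$1 = B$1$1 \<and> A$1$2 = B$1$2 \<and> A$2$1 = B$2$1 \<and> A$2$2 = B$2$2"
  by (simp add: vec_eq_iff forall_2)

lemma mat2_eta: "mat2 (A$1$1) (A$1$2) (A$2$1) (A$2$2) = A"
  by (simp add: cmat_eq_iff)

lemma cmat_mult_nth:
  "((A::cmat) ** B) $ i $ j = A$i$1 * B$1$j + A$i$2 * B$2$j"
  by (simp add: matrix_matrix_mult_def sum_2)

lemma mat2_mult:
  "mat2 a b c d ** mat2 p q r s = mat2 (a*p+b*r) (a*q+b * s) (c*p+d*r) (c*q+d * s)"
  by (simp add: cmat_eq_iff cmat_mult_nth)

lemma mat_1_mat2: "mat 1 = mat2 1 0 0 1"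
  by (simp add: cmat_eq_iff mat_def)

lemma mat2_add: "mat2 a b c d + mat2 p q r s = mat2 (a+p) (b+q) (c+r) (d+s)"
  and mat2_diff: "mat2 a b c d - mat2 p q r s = mat2 (a-p) (b-q) (c-r) (d-s)"
  and mat2_scaleR: "x *\<^sub>R mat2 a b c d = mat2 (of_real x*a) (of_real x*b) (of_real x*c) (of_real x*d)"
  and mat2_cscaleM: "cscaleM z (mat2 a b c d) = mat2 (z*a) (z*b) (z*c) (z*d)"
  and mat2_zero: "0 = mat2 0 0 0 0"
  and ctrans_mat2: "ctrans (mat2 a b c d) = mat2 (cnj a) (cnj c) (cnj b) (cnj d)"
  by (simp_all add: cmat_eq_iff cscaleM_def ctrans_def) (simp_all add: scaleR_conv_of_real)

lemma mat2_eq_iff: "mat2 a b c d = mat2 p q r s \<longleftrightarrow> a = p \<and> b = q \<and> c = r \<and> d = s"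
  by (simp add: cmat_eq_iff)

lemma det_mat2: "det (mat2 a b c d) = a*d - b*c"
  by (simp add: det_2)

lemma matrix_inv_mat2:
  assumes "a*d - b*c = 1"
  shows "matrix_inv (mat2 a b c d) = mat2 d (-b) (-c) a"
proof -
  let ?A = "mat2 a b c d" and ?B = "mat2 d (-b) (-c) a"
  have "d*a - b*c = 1" "d*a - c*b = 1" "a*d - c*b = 1"
    using assms by (simp_all only: mult.commute)
  then have *: "?A ** ?B = mat 1" "?B ** ?A = mat 1"
    using assms by (simp_all add: mat2_mult mat_1_mat2 mat2_eq_iff)
  \<comment> \<open>\<open>matrix_inv\<close> is a choice among two-sided inverses, so the adjugate
    serves first to show that the choice succeeds and then, by cancellation, to identify its
    value.\<close>
  then have "?A ** matrix_inv ?A = mat 1"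
    unfolding matrix_inv_def by (rule someI2[where a = ?B, OF conjI]) simp
  have "matrix_inv ?A = (?B ** ?A) ** matrix_inv ?A"
    unfolding *(2) by simp
  also have "\<dots> = ?B"
    using \<open>?A ** matrix_inv ?A = mat 1\<close> by (simp only: matrix_mul_assoc[symmetric] matrix_mul_rid)
  finally show ?thesis .
qed

lemma matrix_inv_det1:
  assumes "det (A::cmat) = 1"
  shows "matrix_inv A = mat2 (A$2$2) (- (A$1$2)) (- (A$2$1)) (A$1$1)"
  using matrix_inv_mat2[of "A$1$1" "A$2$2" "A$1$2" "A$2$1"] assms
  by (simp add: mat2_eta det_2)

lemma sigma3_conj: "sigma3 ** mat2 a b c d ** sigma3 = mat2 a (-b) (-c) d"
  by (simp add: sigma3_def mat2_mult)

lemma sigma3_conj': "sigma3 ** A ** sigma3 = mat2 (A$1$1) (- (A$1$2)) (- (A$2$1)) (A$2$2)"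
  using sigma3_conj[of "A$1$1" "A$1$2" "A$2$1" "A$2$2"] by (simp add: mat2_eta)

text \<open>With determinant one the inverse is the adjugate, so the reality condition of the loop
  group merely compares entries with conjugates of entries.\<close>

lemma su11_conj_iff:
  assumes "det (A::cmat) = 1"
  shows "sigma3 ** matrix_inv (ctrans A) ** sigma3 = A
         \<longleftrightarrow> A$2$2 = cnj (A$1$1) \<and> A$2$1 = cnj (A$1$2)"
proof -
  have "det (ctrans A) = cnj (det A)"
    by (simp add: ctrans_def det_2)
  then have "det (ctrans A) = 1"
    using assms by simp
  then show ?thesis
    by (auto simp: matrix_inv_det1 sigma3_conj cmat_eq_iff ctrans_def)
qed

section \<open>Loops on the unit circle\<close>

lemma circle_cis: "circle = range cis"
proof
  show "circle \<subseteq> range cis"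
  proof
    fix w assume "w \<in> circle"
    then have "w \<noteq> 0" "sgn w = w"
      by (auto simp: circle_def sgn_div_norm)
    then show "w \<in> range cis"
      using cis_Arg[of w] by (metis rangeI)
  qed
qed (auto simp: circle_def)

lemma inverse_cnj_circle: "w \<in> circle \<Longrightarrow> 1 / cnj w = w"
  by (auto simp: circle_cis cis_cnj simp flip: inverse_eq_divide)

text \<open>The involution \<open>w \<mapsto> 1 / cnj w\<close> fixes the circle, so the reality
  condition is pointwise and a loop is encoded by its first row \<open>(p, q)\<close>. All later
  computations with frames use this form.\<close>

lemma loop_SU11_iff:
  "loop_SU11 g \<longleftrightarrow> continuous_on circle g \<and>
     (\<forall>w\<in>circle. g (-w) = sigma3 ** g w ** sigma3 \<and>
        (\<exists>p q. g w = mat2 p q (cnj q) (cnj p) \<and> p * cnj p - q * cnj q = 1))"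
proof -
  have "det (g w) = 1 \<and> sigma3 ** matrix_inv (ctrans (g (1 / cnj w))) ** sigma3 = g w
       \<longleftrightarrow> (\<exists>p q. g w = mat2 p q (cnj q) (cnj p) \<and> p * cnj p - q * cnj q = 1)" (is "?L \<longleftrightarrow> ?R")
    if "w \<in> circle" for w
  proof
    assume ?L
    then have "g w = mat2 (g w$1$1) (g w$1$2) (cnj (g w$1$2)) (cnj (g w$1$1))"
      using su11_conj_iff[of "g w"] inverse_cnj_circle[OF that] by (simp add: cmat_eq_iff)
    with \<open>?L\<close> show ?R
      by (metis det_mat2)
  next
    assume ?R
    then obtain p q where "g w = mat2 p q (cnj q) (cnj p)" "p * cnj p - q * cnj q = 1"
      by blast
    then show ?L
      using su11_conj_iff[of "g w"] inverse_cnj_circle[OF that] by (simp add: det_mat2)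
  qed
  then show ?thesis
    unfolding loop_SU11_def loop_SL2_def by blast
qed

lemma tendsto_mat2:
  assumes "(f1 \<longlongrightarrow> a) X" "(f2 \<longlongrightarrow> b) X" "(f3 \<longlongrightarrow> c) X" "(f4 \<longlongrightarrow> d) X"
  shows "((\<lambda>x. mat2 (f1 x) (f2 x) (f3 x) (f4 x)) \<longlongrightarrow> mat2 a b c d) X"
proof -
  have "\<forall>i j. ((\<lambda>x. mat2 (f1 x) (f2 x) (f3 x) (f4 x) $ i $ j) \<longlongrightarrow> mat2 a b c d $ i $ j) X"
    using assms by (simp add: forall_2)
  then show ?thesis
    by (intro vec_tendstoI) blast
qed

lemma continuous_on_mat2:
  assumes "continuous_on S f1" "continuous_on S f2" "continuous_on S f3" "continuous_on S f4"
  shows "continuous_on S (\<lambda>x. mat2 (f1 x) (f2 x) (f3 x) (f4 x))"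
  using assms by (auto simp: continuous_on_def intro!: tendsto_mat2)

lemma sums_mat2:
  assumes "f1 sums a" "f2 sums b" "f3 sums c" "f4 sums d"
  shows "(\<lambda>n. mat2 (f1 n) (f2 n) (f3 n) (f4 n)) sums mat2 a b c d"
proof -
  have "sum (\<lambda>n. mat2 (f1 n) (f2 n) (f3 n) (f4 n)) {..<N}
      = mat2 (sum f1 {..<N}) (sum f2 {..<N}) (sum f3 {..<N}) (sum f4 {..<N})" for N
    by (induction N) (simp_all add: mat2_zero mat2_add)
  then show ?thesis
    using assms by (simp add: sums_def tendsto_mat2)
qed

subsection \<open>The exponential of a traceless matrix\<close>

text \<open>Entire functions with \<open>ch (x\<^sup>2) = cosh x\<close> and \<open>x * sh (x\<^sup>2) = sinh x\<close>.\<close>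

definition ch :: "complex \<Rightarrow> complex" where "ch z = (\<Sum>n. z ^ n / fact (2 * n))"
definition sh :: "complex \<Rightarrow> complex" where "sh z = (\<Sum>n. z ^ n / fact (2 * n + 1))"

lemma summable_power_div_fact:
  fixes z :: complex
  assumes "\<And>n. n \<le> k n"
  shows "summable (\<lambda>n. z ^ n / fact (k n))"
proof (rule summable_comparison_test)
  show "summable (\<lambda>n. norm z ^ n /\<^sub>R fact n)"
    using summable_exp_generic[of "norm z"] by simp
  have "norm z ^ n / fact (k n) \<le> norm z ^ n / fact n" for n
    using assms[of n] by (intro divide_left_mono fact_mono) (auto)
  moreover have "norm (fact m :: complex) = fact m" for m
    by (metis norm_of_nat of_nat_fact)
  ultimately show "\<exists>N. \<forall>n\<ge>N. norm (z ^ n / fact (k n)) \<le> norm z ^ n /\<^sub>R fact n"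
    by (simp add: norm_mult norm_inverse norm_power divide_inverse mult.commute)
qed

lemma ch_sums: "(\<lambda>n. z ^ n / fact (2 * n)) sums ch z"
  unfolding ch_def by (intro summable_sums summable_power_div_fact) simp

lemma sh_sums: "(\<lambda>n. z ^ n / fact (2 * n + 1)) sums sh z"
  unfolding sh_def by (intro summable_sums summable_power_div_fact) simp

text \<open>The two subseries are extended by zero to all indices; the extensions add up to
  \<open>f\<close>.\<close>

lemma sums_even_odd:
  fixes f :: "nat \<Rightarrow> 'a::real_normed_vector"
  assumes "(\<lambda>n. f (2 * n)) sums a" "(\<lambda>n. f (2 * n + 1)) sums b"
  shows "f sums (a + b)"
proof -
  have "(if even n then f n else 0) = 0" if "n \<notin> range ((*) 2)" for n
    using that by (auto elim!: evenE)
  then have e: "(\<lambda>n. if even n then f n else 0) sums a"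
    using sums_mono_reindex[of "\<lambda>n. 2 * n" "\<lambda>n. if even n then f n else 0" a] assms(1)
    by (simp add: strict_mono_def)
  have "(if odd n then f n else 0) = 0" if "n \<notin> range (\<lambda>n. 2 * n + 1)" for n
    using that by (auto elim!: oddE)
  then have o: "(\<lambda>n. if odd n then f n else 0) sums b"
    using sums_mono_reindex[of "\<lambda>n. 2 * n + 1" "\<lambda>n. if odd n then f n else 0" b] assms(2)
    by (simp add: strict_mono_def)
  have "(\<lambda>n. (if even n then f n else 0) + (if odd n then f n else 0)) = f"
    by auto
  with sums_add[OF e o] show ?thesis
    by simp
qed

lemma ch_square: "ch (x\<^sup>2) = cosh x"
proof -
  have *: "x ^ (2 * n) /\<^sub>R fact (2 * n) = (x\<^sup>2) ^ n / fact (2 * n)" for n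
    by (simp only: power_mult) (simp add: scaleR_conv_of_real field_simps)
  have "(\<lambda>n. if even n then x ^ n /\<^sub>R fact n else 0) sums (ch (x\<^sup>2) + 0)"
    by (intro sums_even_odd) (use ch_sums[of "x\<^sup>2"] in \<open>simp_all add: *\<close>)
  then show ?thesis
    using cosh_converges[of x] sums_unique2 by fastforce
qed

lemma sh_square: "x * sh (x\<^sup>2) = sinh x"
proof -
  have *: "x ^ (2 * n + 1) /\<^sub>R fact (2 * n + 1) = x * ((x\<^sup>2) ^ n / fact (2 * n + 1))" for n
    by (simp only: power_add power_mult) (simp add: scaleR_conv_of_real field_simps del: fact_Suc)
  have "(\<lambda>n. if even n then 0 else x ^ n /\<^sub>R fact n) sums (0 + x * sh (x\<^sup>2))"
  proof (rule sums_even_odd)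
    show "(\<lambda>n. if even (2*n+1) then 0 else x ^ (2*n+1) /\<^sub>R fact (2*n+1)) sums (x * sh (x\<^sup>2))"
      unfolding * using sums_mult[OF sh_sums[of "x\<^sup>2"], of x] by simp
  qed simp
  then show ?thesis
    using sinh_converges[of x] sums_unique2 by fastforce
qed

lemma ch_0 [simp]: "ch 0 = 1"
  using ch_square[of 0] by simp

lemma sh_0 [simp]: "sh 0 = 1"
proof -
  have "(\<lambda>n. 0 ^ n / fact (2 * n + 1) :: complex) = (\<lambda>n. if n = 0 then 1 else 0)"
    by (auto simp: power_0_left)
  then have "(\<lambda>n. 0 ^ n / fact (2 * n + 1) :: complex) sums 1"
    using sums_single[of 0 "\<lambda>n. 1::complex"] by simp
  then show ?thesis
    using sh_sums[of 0] sums_unique2 by blast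
qed

lemma entire_power_series:
  assumes "\<And>z::complex. (\<lambda>n. a n * z ^ n) sums f z"
  shows "f holomorphic_on A"
proof -
  have "f holomorphic_on ball 0 (norm z + 1)" for z :: complex
    by (rule power_series_holomorphic[where a = a]) (simp add: assms)
  then have "f field_differentiable at z" for z
    by (rule holomorphic_on_imp_differentiable_at[where s = "ball 0 (norm z + 1)"]) auto
  then show ?thesis
    by (simp add: holomorphic_on_def field_differentiable_at_within)
qed

lemma holomorphic_ch: "ch holomorphic_on A"
  by (rule entire_power_series[where a = "\<lambda>n. 1 / fact (2 * n)"]) (use ch_sums in simp)

lemma holomorphic_sh: "sh holomorphic_on A"
  by (rule entire_power_series[where a = "\<lambda>n. 1 / fact (2 * n + 1)"])
     (use sh_sums in \<open>simp del: fact_Suc\<close>)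

lemma cnj_ch: "cnj (ch z) = ch (cnj z)" and cnj_sh: "cnj (sh z) = sh (cnj z)"
proof -
  have "(\<lambda>n. cnj (z ^ n / fact (2 * n))) sums cnj (ch z)"
       "(\<lambda>n. cnj (z ^ n / fact (2 * n + 1))) sums cnj (sh z)"
    unfolding sums_cnj by (fact ch_sums sh_sums)+
  then show "cnj (ch z) = ch (cnj z)" "cnj (sh z) = sh (cnj z)"
    using ch_sums[of "cnj z"] sh_sums[of "cnj z"] by (auto simp del: fact_Suc dest: sums_unique2)
qed

text \<open>With \<open>\<mu> = x\<^sup>2\<close> this is the hyperbolic identity at
  \<open>z * x\<close>. Stating it in \<open>\<mu>\<close> avoids a choice of root, which could not
  be made holomorphically in the loop parameter.\<close>

lemma ch_sh_pythagoras: "(ch (z\<^sup>2 * \<mu>))\<^sup>2 - \<mu> * (z * sh (z\<^sup>2 * \<mu>))\<^sup>2 = 1"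
proof -
  define x where "x = csqrt \<mu>"
  have \<mu>: "\<mu> = x\<^sup>2" by (simp add: x_def)
  have "(cosh (z*x))\<^sup>2 - (sinh (z*x))\<^sup>2 = 1"
    by (rule hyperbolic_pythagoras)
  then show ?thesis
    unfolding \<mu> power_mult_distrib[symmetric] ch_square sh_square[symmetric]
    by (simp add: power_mult_distrib algebra_simps)
qed

lemma ch_sh_add:
  fixes z w \<mu> :: complex
  shows "ch ((z+w)\<^sup>2 * \<mu>) = ch (z\<^sup>2*\<mu>) * ch (w\<^sup>2*\<mu>) + \<mu> * (z * sh (z\<^sup>2*\<mu>)) * (w * sh (w\<^sup>2*\<mu>))"
    and "(z+w) * sh ((z+w)\<^sup>2 * \<mu>) = z * sh (z\<^sup>2*\<mu>) * ch (w\<^sup>2*\<mu>) + ch (z\<^sup>2*\<mu>) * (w * sh (w\<^sup>2*\<mu>))"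
proof -
  define x where "x = csqrt \<mu>"
  have \<mu>: "\<mu> = x\<^sup>2" by (simp add: x_def)
  have *: "cosh ((z+w)*x) = cosh (z*x) * cosh (w*x) + sinh (z*x) * sinh (w*x)"
    "sinh ((z+w)*x) = sinh (z*x) * cosh (w*x) + cosh (z*x) * sinh (w*x)"
    by (simp_all add: distrib_right cosh_add sinh_add)
  show "ch ((z+w)\<^sup>2 * \<mu>) = ch (z\<^sup>2*\<mu>) * ch (w\<^sup>2*\<mu>) + \<mu> * (z * sh (z\<^sup>2*\<mu>)) * (w * sh (w\<^sup>2*\<mu>))"
    using *(1) unfolding \<mu> power_mult_distrib[symmetric] ch_square sh_square[symmetric]
    by (simp add: power2_eq_square algebra_simps)
  show "(z+w) * sh ((z+w)\<^sup>2 * \<mu>) = z * sh (z\<^sup>2*\<mu>) * ch (w\<^sup>2*\<mu>) + ch (z\<^sup>2*\<mu>) * (w * sh (w\<^sup>2*\<mu>))"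
  \<comment> \<open>The addition theorem for \<open>sinh\<close> gives the claim multiplied by
    \<open>x\<close>; for \<open>x = 0\<close> both sides are \<open>z + w\<close>.\<close>
  proof (cases "x = 0")
    case False
    have "x * ((z+w) * sh (((z+w)*x)\<^sup>2))
      = x * (z * sh ((z*x)\<^sup>2) * cosh (w*x) + cosh (z*x) * (w * sh ((w*x)\<^sup>2)))"
      using *(2) unfolding sh_square[symmetric] distrib_left mult.assoc mult.left_commute[of x]
      by (simp only: mult_ac)
    with False show ?thesis
      unfolding \<mu> power_mult_distrib[symmetric] ch_square by simp
  qed (simp add: \<mu>)
qed

lemma mpow_Suc: "mpow A (Suc n) = A ** mpow A n"
  by (simp add: mpow_def)

text \<open>By Cayley-Hamilton the square of a traceless matrix is \<open>\<mu>\<close> times the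
  identity, so the even and odd parts of the exponential series are the series of \<open>ch\<close>
  and \<open>sh\<close>.\<close>

lemma mexp_traceless:
  assumes "\<mu> = a\<^sup>2 + b * c"
  shows "mexp (mat2 a b c (-a)) = mat2 (ch \<mu> + a * sh \<mu>) (b * sh \<mu>) (c * sh \<mu>) (ch \<mu> - a * sh \<mu>)"
proof -
  let ?A = "mat2 a b c (-a)"
  have e: "mpow ?A (2 * n) = mat2 (\<mu> ^ n) 0 0 (\<mu> ^ n)" for n
    by (induction n)
       (simp_all add: mpow_Suc mat2_mult mpow_def[of _ 0] mat_1_mat2 mat2_eq_iff assms power2_eq_square algebra_simps)
  have o: "mpow ?A (2 * n + 1) = mat2 (a * \<mu> ^ n) (b * \<mu> ^ n) (c * \<mu> ^ n) (- (a * \<mu> ^ n))" for n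
    by (simp add: mpow_Suc e mat2_mult)
  have "(\<lambda>n. (1 / fact n) *\<^sub>R mpow ?A n) sums
       (mat2 (ch \<mu>) 0 0 (ch \<mu>) + mat2 (a * sh \<mu>) (b * sh \<mu>) (c * sh \<mu>) (- (a * sh \<mu>)))"
  proof (rule sums_even_odd)
    show "(\<lambda>n. (1 / fact (2*n)) *\<^sub>R mpow ?A (2*n)) sums mat2 (ch \<mu>) 0 0 (ch \<mu>)"
      unfolding e mat2_scaleR using ch_sums[of \<mu>] by (intro sums_mat2) simp_all
    have "(\<lambda>n. of_real (1 / fact (2*n+1)) * (x * \<mu> ^ n)) sums (x * sh \<mu>)" for x
      using sums_mult[OF sh_sums[of \<mu>], of x] by (simp add: mult.commute mult.left_commute del: fact_Suc)
    from this[of a] this[of b] this[of c] this[of "-a"]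
    show "(\<lambda>n. (1 / fact (2*n+1)) *\<^sub>R mpow ?A (2*n+1)) sums
        mat2 (a * sh \<mu>) (b * sh \<mu>) (c * sh \<mu>) (- (a * sh \<mu>))"
      unfolding o mat2_scaleR by (intro sums_mat2) (simp_all del: fact_Suc)
  qed
  then show ?thesis
    unfolding mexp_def by (simp add: sums_iff mat2_add)
qed

subsection \<open>Reflection across the unit circle and uniqueness of the Iwasawa decomposition\<close>

text \<open>Schwarz reflection in the coordinate \<open>w = exp (\<i> \<theta>)\<close>, where the unit circle becomes the real
  axis and the punctured disc the upper half plane.\<close>

lemma circle_reflection:
  assumes cont: "continuous_on (cball 0 1 - {0}) u" "continuous_on (cball 0 1 - {0}) v"
    and hol: "u holomorphic_on ball 0 1 - {0}" "v holomorphic_on ball 0 1 - {0}"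
    and refl: "\<And>w. w \<in> circle \<Longrightarrow> v w = cnj (u w)"
  obtains h where "h holomorphic_on UNIV"
    "\<And>\<theta>. Im \<theta> \<ge> 0 \<Longrightarrow> h \<theta> = u (exp (\<i> * \<theta>))"
    "\<And>\<theta>. Im \<theta> \<le> 0 \<Longrightarrow> h \<theta> = cnj (v (exp (\<i> * cnj \<theta>)))"
proof -
  define f where "f \<theta> = u (exp (\<i> * \<theta>))" for \<theta>
  define g where "g \<theta> = cnj (v (exp (\<i> * cnj \<theta>)))" for \<theta>
  define h where "h \<theta> = (if Im \<theta> \<ge> 0 then f \<theta> else g \<theta>)" for \<theta>
  have agree: "f \<theta> = g \<theta>" if "Im \<theta> = 0" for \<theta>
  proof -
    have "cnj \<theta> = \<theta>" and "exp (\<i> * \<theta>) \<in> circle"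
      using that by (simp_all add: complex_eq_iff circle_def)
    then show ?thesis
      using refl by (simp add: f_def g_def)
  qed
  have "continuous_on {\<theta>. Im \<theta> \<ge> 0} f"
    unfolding f_def
    by (rule continuous_on_compose2[OF cont(1)]) (auto intro!: continuous_intros)
  moreover have "continuous_on {\<theta>. Im \<theta> \<le> 0} g"
    unfolding g_def
    by (intro continuous_on_cnj continuous_on_compose2[OF cont(2)]) (auto intro!: continuous_intros)
  moreover have "closed {\<theta>. Im \<theta> \<ge> 0}" "closed {\<theta>. Im \<theta> \<le> 0}"
    by (simp_all add: closed_halfspace_Im_ge closed_halfspace_Im_le)
  ultimately have "continuous_on ({\<theta>. Im \<theta> \<ge> 0} \<union> {\<theta>. Im \<theta> \<le> 0}) h"
    unfolding h_def by (intro continuous_on_cases) (use agree in auto)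
  moreover have "{\<theta>. Im \<theta> \<ge> 0} \<union> {\<theta>. Im \<theta> \<le> 0} = UNIV"
    by auto
  ultimately have conth: "continuous_on UNIV h"
    by simp
  have "f holomorphic_on {\<theta>. Im \<theta> > 0}"
    unfolding f_def
    by (rule holomorphic_on_compose_gen[OF _ hol(1), unfolded o_def]) (auto intro!: holomorphic_intros)
  then have hf: "h holomorphic_on (UNIV \<inter> {\<theta>. 0 < \<i> \<bullet> \<theta>})"
    by (rule holomorphic_transform[THEN holomorphic_on_subset]) (auto simp: h_def inner_complex_def)
  have "(\<lambda>\<theta>. v (exp (\<i> * \<theta>))) holomorphic_on {\<theta>. Im \<theta> > 0}"
    by (rule holomorphic_on_compose_gen[OF _ hol(2), unfolded o_def]) (auto intro!: holomorphic_intros)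
  moreover have "cnj ` {\<theta>. Im \<theta> < 0} = {\<theta>. Im \<theta> > 0}"
    by (auto simp: image_iff intro!: exI[of _ "cnj _"])
  ultimately have "g holomorphic_on {\<theta>. Im \<theta> < 0}"
    using holomorphic_on_compose_cnj_cnj[of "\<lambda>\<theta>. v (exp (\<i> * \<theta>))" "{\<theta>. Im \<theta> < 0}"]
    by (simp add: g_def[abs_def] o_def open_halfspace_Im_lt)
  then have hg: "h holomorphic_on (UNIV \<inter> {\<theta>. \<i> \<bullet> \<theta> < 0})"
    by (rule holomorphic_transform[THEN holomorphic_on_subset]) (auto simp: h_def inner_complex_def)
  have "h holomorphic_on UNIV"
    by (rule holomorphic_on_paste_across_line[OF _ _ hg hf conth]) auto
  moreover have "h \<theta> = f \<theta>" if "Im \<theta> \<ge> 0" for \<theta>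
    using that by (simp add: h_def)
  moreover have "h \<theta> = g \<theta>" if "Im \<theta> \<le> 0" for \<theta>
    using that agree by (auto simp: h_def)
  ultimately show thesis
    using that unfolding f_def g_def by blast
qed

text \<open>The reflected function is entire in the angle and takes values in compact images of the
  closed disc, so Liouville makes it constant. The centre of the disc, which corresponds to no
  angle, is reached by continuity.\<close>

lemma reflected_disc_functions_constant:
  assumes cont: "continuous_on (cball 0 1) u" "continuous_on (cball 0 1) v"
    and hol: "u holomorphic_on ball 0 1" "v holomorphic_on ball 0 1"
    and refl: "\<And>w. w \<in> circle \<Longrightarrow> v w = cnj (u w)"
    and w: "w \<in> cball 0 1"
  shows "u w = u 0"
proof -
  obtain h where h: "h holomorphic_on UNIV"
    "\<And>\<theta>. Im \<theta> \<ge> 0 \<Longrightarrow> h \<theta> = u (exp (\<i> * \<theta>))"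
    "\<And>\<theta>. Im \<theta> \<le> 0 \<Longrightarrow> h \<theta> = cnj (v (exp (\<i> * cnj \<theta>)))"
    by (rule circle_reflection[of u v])
       (use cont hol refl in \<open>auto intro: continuous_on_subset holomorphic_on_subset\<close>)
  have "bounded (u ` cball 0 1 \<union> cnj ` v ` cball 0 1)"
    by (intro compact_imp_bounded compact_Un compact_continuous_image cont continuous_intros compact_cball)
  moreover have "range h \<subseteq> u ` cball 0 1 \<union> cnj ` v ` cball 0 1"
  proof (clarify)
    fix \<theta> assume "h \<theta> \<notin> cnj ` v ` cball 0 1"
    then show "h \<theta> \<in> u ` cball 0 1"
      using h(2,3)[of \<theta>] by (cases "Im \<theta> \<ge> 0") (auto simp: image_iff)
  qed
  ultimately have "bounded (range h)"
    by (rule bounded_subset)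
  then obtain c where c: "\<And>\<theta>. h \<theta> = c"
    using Liouville_theorem[OF h(1)] by (auto simp: constant_on_def)
  have const: "u w = c" if "w \<in> cball 0 1" "w \<noteq> 0" for w
  proof -
    \<comment> \<open>A complex angle over \<open>w\<close>; its imaginary part is
      \<open>- ln (norm w)\<close>, which is nonnegative on the disc.\<close>
    have "exp (\<i> * (- \<i> * Ln w)) = w" "Im (- \<i> * Ln w) \<ge> 0"
      using that by (simp_all add: mult.assoc[symmetric])
    with h(2)[of "- \<i> * Ln w"] c show ?thesis
      by simp
  qed
  have "(u \<longlongrightarrow> u 0) (at 0)"
    using continuous_on_interior[OF cont(1), of 0] by (simp add: isCont_def)
  moreover have "(u \<longlongrightarrow> c) (at 0)"
  proof (rule tendsto_eventually)
    show "\<forall>\<^sub>F w in at 0. u w = c"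
      unfolding eventually_at by (intro exI[of _ 1]) (auto intro!: const)
  qed
  ultimately have "u 0 = c"
    using tendsto_unique[of "at (0::complex)"] by auto
  with const w show ?thesis
    by (cases "w = 0") auto
qed

lemma loop_plus_entry:
  assumes "loop_plus V"
  shows "continuous_on (cball 0 1) (\<lambda>w. V w $ i $ j)" "(\<lambda>w. V w $ i $ j) holomorphic_on ball 0 1"
  using assms by (auto simp: loop_plus_def intro!: continuous_intros)

text \<open>The quotient \<open>W\<close> of the plus factors is holomorphic on the disc and agrees
  on the circle with the quotient of the unitary factors. Its SU(1,1) symmetry pairs the entries by
  reflection, so \<open>W\<close> is constant; the twisting and the positivity at \<open>0\<close>
  then leave only the identity.\<close>

lemma iwasawa_unique:
  assumes "iwasawa C F V" "iwasawa C F' V'" "w \<in> circle"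
  shows "F' w = F w"
proof -
  have V: "loop_plus V" "loop_plus V'" and F: "loop_SU11 F" "loop_SU11 F'"
    and C: "\<And>w. w \<in> circle \<Longrightarrow> F w ** V w = F' w ** V' w"
    using assms(1,2) by (auto simp: iwasawa_def)
  note V_intros = loop_plus_entry[OF V(1)] loop_plus_entry[OF V(2)]
  \<comment> \<open>The second factor is the adjugate of \<open>V'\<close>, which is its inverse;
    the entries of \<open>W\<close> are thus polynomials in holomorphic functions.\<close>
  define W where "W w = V w ** mat2 (V' w$2$2) (- (V' w$1$2)) (- (V' w$2$1)) (V' w$1$1)" for w
  have W_nth: "W w $ i $ j = V w $ i $ 1 * (if j = 1 then V' w$2$2 else - (V' w$1$2))
       + V w $ i $ 2 * (if j = 1 then - (V' w$2$1) else V' w$1$1)" for w i j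
    unfolding W_def cmat_mult_nth by (simp add: mat2_def)
  have W_cont: "continuous_on (cball 0 1) (\<lambda>w. W w $ i $ j)" for i j
    unfolding W_nth by (cases "j = 1") (simp_all add: V_intros continuous_on_add continuous_on_diff continuous_on_mult continuous_on_minus)
  have W_hol: "(\<lambda>w. W w $ i $ j) holomorphic_on ball 0 1" for i j
    unfolding W_nth by (cases "j = 1") (simp_all add: V_intros holomorphic_on_add holomorphic_on_diff holomorphic_on_mult holomorphic_on_minus)
  have FW: "F' w = F w ** W w \<and> W w $ 2 $ 2 = cnj (W w $ 1 $ 1) \<and> W w $ 2 $ 1 = cnj (W w $ 1 $ 2)
     \<and> W w $ 1 $ 1 * cnj (W w $ 1 $ 1) - W w $ 1 $ 2 * cnj (W w $ 1 $ 2) = 1"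
    if w: "w \<in> circle" for w
  proof -
    have "w \<in> cball 0 1" using w by (simp add: circle_def)
    then have "det (V' w) = 1"
      using V(2) by (auto simp: loop_plus_def)
    then have "V' w ** mat2 (V' w$2$2) (- (V' w$1$2)) (- (V' w$2$1)) (V' w$1$1) = mat 1"
      by (simp add: cmat_eq_iff cmat_mult_nth mat_def det_2 mult.commute)
    then have 1: "F' w = F w ** W w"
      unfolding W_def matrix_mul_assoc C[OF w] by (simp flip: matrix_mul_assoc)
    obtain p q where F1: "F w = mat2 p q (cnj q) (cnj p)" and n: "p * cnj p - q * cnj q = 1"
      using F(1) w unfolding loop_SU11_iff by blast
    obtain p' q' where F2: "F' w = mat2 p' q' (cnj q') (cnj p')" and n': "p' * cnj p' - q' * cnj q' = 1"
      using F(2) w unfolding loop_SU11_iff by blast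
    have "mat2 (cnj p) (-q) (- cnj q) p ** F w = mat 1"
      using n by (simp add: F1 mat2_mult mat_1_mat2 mat2_eq_iff mult.commute)
    then have "W w = mat2 (cnj p) (-q) (- cnj q) p ** F' w"
      unfolding 1 matrix_mul_assoc by simp
    then have W: "W w = mat2 (cnj p * p' - q * cnj q') (cnj p * q' - q * cnj p') (cnj (cnj p * q' - q * cnj p')) (cnj (cnj p * p' - q * cnj q'))"
      by (simp add: F2 mat2_mult mat2_eq_iff)
    have "(cnj p * p' - q * cnj q') * cnj (cnj p * p' - q * cnj q') - (cnj p * q' - q * cnj p') * cnj (cnj p * q' - q * cnj p')
      = (p * cnj p - q * cnj q) * (p' * cnj p' - q' * cnj q')"
      by (simp add: algebra_simps)
    then show ?thesis
      using 1 n n' unfolding W by simp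
  qed
  have w': "w \<in> cball 0 1" using assms(3) by (simp add: circle_def)
  \<comment> \<open>On the circle the entry (2,2) is the conjugate of (1,1), and (2,1) that of
    (1,2); these are the reflected pairs.\<close>
  have W11: "W w $ 1 $ 1 = W 0 $ 1 $ 1"
    by (rule reflected_disc_functions_constant[OF W_cont W_cont W_hol W_hol _ w', of 2 2]) (use FW in auto)
  have W12: "W w $ 1 $ 2 = W 0 $ 1 $ 2"
    by (rule reflected_disc_functions_constant[OF W_cont W_cont W_hol W_hol _ w', of 2 1]) (use FW in auto)
  \<comment> \<open>At \<open>w = 0\<close> the twisting condition relates \<open>V 0\<close> to
    itself and kills the off-diagonal entries.\<close>
  have off: "V 0 $ 1 $ 2 = 0" "V' 0 $ 1 $ 2 = 0"
  proof -
    have "V 0 = sigma3 ** V 0 ** sigma3" "V' 0 = sigma3 ** V' 0 ** sigma3"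
      using V by (auto simp: loop_plus_def dest: bspec[of _ _ 0])
    then have "V 0 $ 1 $ 2 = - (V 0 $ 1 $ 2)" "V' 0 $ 1 $ 2 = - (V' 0 $ 1 $ 2)"
      unfolding sigma3_conj' by (simp_all add: cmat_eq_iff)
    then show "V 0 $ 1 $ 2 = 0" "V' 0 $ 1 $ 2 = 0"
      by simp_all
  qed
  have W12_0: "W w $ 1 $ 2 = 0"
    unfolding W12 by (simp add: W_nth off)
  obtain r s where "V 0 $ 1 $ 1 = of_real r" "r > 0" "V' 0 $ 2 $ 2 = of_real s" "s > 0"
    using assms(1,2) unfolding iwasawa_def by (metis Reals_cases Re_complex_of_real)
  \<comment> \<open>The diagonal entry of \<open>W\<close> is a product of two positive numbers and
    has modulus one.\<close>
  then have rs: "W w $ 1 $ 1 = of_real (r * s)" "r * s > 0"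
    unfolding W11 by (simp_all add: W_nth off)
  then have "complex_of_real ((r * s)\<^sup>2) = of_real 1"
    using FW[OF assms(3)] W12_0 by (simp add: power2_eq_square)
  then have "(r * s)\<^sup>2 = 1"
    unfolding of_real_eq_iff .
  with rs(2) have "r * s = 1"
    by (simp add: power2_eq_1_iff)
  then have "W w = mat 1"
    using FW[OF assms(3)] rs(1) W12_0 by (simp add: cmat_eq_iff mat_def)
  with FW[OF assms(3)] show ?thesis
    by simp
qed

text \<open>A unitary factor is a priori only continuous on the circle. There it equals
  \<open>C\<close> times the inverse of \<open>V\<close>, which is holomorphic on the punctured
  disc, and its SU(1,1) symmetry is the boundary condition for reflection. Hence its first row is
  entire in the angle, which justifies the derivatives in the Sym formula.\<close>

lemma iwasawa_smooth:
  assumes I: "iwasawa C F V"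
    and C: "\<And>i j. (\<lambda>w. C w $ i $ j) holomorphic_on - {0}"
  obtains h k where "h holomorphic_on UNIV" "k holomorphic_on UNIV"
    "\<And>s::real. F (cis s) = mat2 (h s) (k s) (cnj (k s)) (cnj (h s))"
    "\<And>s::real. h s * cnj (h s) - k s * cnj (k s) = 1"
proof -
  have V: "loop_plus V" and F: "loop_SU11 F" and CF: "\<And>w. w \<in> circle \<Longrightarrow> C w = F w ** V w"
    using I by (auto simp: iwasawa_def)
  note V_intros = loop_plus_entry[OF V]
  define G where "G w = C w ** mat2 (V w$2$2) (- (V w$1$2)) (- (V w$2$1)) (V w$1$1)" for w
  have G_nth: "G w $ i $ j = C w $ i $ 1 * (if j = 1 then V w$2$2 else - (V w$1$2))
       + C w $ i $ 2 * (if j = 1 then - (V w$2$1) else V w$1$1)" for w i j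
    unfolding G_def cmat_mult_nth by (simp add: mat2_def)
  have G_cont: "continuous_on (cball 0 1 - {0}) (\<lambda>w. G w $ i $ j)" for i j
  proof -
    have "continuous_on (cball 0 1 - {0}) (\<lambda>w. C w $ i $ j)" for i j
      by (rule continuous_on_subset[OF holomorphic_on_imp_continuous_on[OF C]]) auto
    moreover have "continuous_on (cball 0 1 - {0}) (\<lambda>w. V w $ i $ j)" for i j
      by (rule continuous_on_subset[OF V_intros(1)]) auto
    ultimately show ?thesis
      unfolding G_nth by (cases "j = 1") (simp_all add: continuous_on_add continuous_on_diff continuous_on_mult continuous_on_minus)
  qed
  have G_hol: "(\<lambda>w. G w $ i $ j) holomorphic_on ball 0 1 - {0}" for i j
  proof -
    have "(\<lambda>w. C w $ i $ j) holomorphic_on ball 0 1 - {0}" for i j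
      by (rule holomorphic_on_subset[OF C]) auto
    moreover have "(\<lambda>w. V w $ i $ j) holomorphic_on ball 0 1 - {0}" for i j
      by (rule holomorphic_on_subset[OF V_intros(2)]) auto
    ultimately show ?thesis
      unfolding G_nth by (cases "j = 1") (simp_all add: holomorphic_on_add holomorphic_on_diff holomorphic_on_mult holomorphic_on_minus)
  qed
  have GF: "G w = F w" if w: "w \<in> circle" for w
  proof -
    have "w \<in> cball 0 1" using w by (simp add: circle_def)
    then have "det (V w) = 1"
      using V by (auto simp: loop_plus_def)
    then have "V w ** mat2 (V w$2$2) (- (V w$1$2)) (- (V w$2$1)) (V w$1$1) = mat 1"
      by (simp add: cmat_eq_iff cmat_mult_nth mat_def det_2 mult.commute)
    then show ?thesis
      unfolding G_def CF[OF w] by (simp flip: matrix_mul_assoc)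
  qed
  have refl: "G w $ 2 $ 2 = cnj (G w $ 1 $ 1) \<and> G w $ 2 $ 1 = cnj (G w $ 1 $ 2)
     \<and> G w $ 1 $ 1 * cnj (G w $ 1 $ 1) - G w $ 1 $ 2 * cnj (G w $ 1 $ 2) = 1" if "w \<in> circle" for w
    using F that unfolding loop_SU11_iff GF[OF that] by force
  obtain h where h: "h holomorphic_on UNIV" "\<And>\<theta>. Im \<theta> \<ge> 0 \<Longrightarrow> h \<theta> = G (exp (\<i> * \<theta>)) $ 1 $ 1"
    using circle_reflection[OF G_cont G_cont G_hol G_hol, of 2 2 1 1] refl by metis
  obtain k where k: "k holomorphic_on UNIV" "\<And>\<theta>. Im \<theta> \<ge> 0 \<Longrightarrow> k \<theta> = G (exp (\<i> * \<theta>)) $ 1 $ 2"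
    using circle_reflection[OF G_cont G_cont G_hol G_hol, of 2 1 1 2] refl by metis
  have hk: "h (of_real s) = G (cis s) $ 1 $ 1" "k (of_real s) = G (cis s) $ 1 $ 2" for s
    using h(2)[of "of_real s"] k(2)[of "of_real s"] by (simp_all add: cis_conv_exp)
  show thesis
  proof (rule that[OF h(1) k(1)])
    fix s :: real
    have "cis s \<in> circle" by (simp add: circle_cis)
    from refl[OF this] show "h s * cnj (h s) - k s * cnj (k s) = 1"
      and "F (cis s) = mat2 (h s) (k s) (cnj (k s)) (cnj (h s))"
      unfolding hk GF[OF \<open>cis s \<in> circle\<close>, symmetric] by (simp_all add: cmat_eq_iff)
  qed
qed

subsection \<open>The exponential of a degree one potential\<close>

text \<open>\<open>- det (D \<lambda>)\<close> for the degree one potential \<open>D\<close>.\<close>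

definition pot_mu :: "complex \<Rightarrow> complex \<Rightarrow> real \<Rightarrow> complex \<Rightarrow> complex" where
  "pot_mu a b c w = (a / w + w * cnj b) * (b / w + w * cnj a) - (of_real c)\<^sup>2"

abbreviation pot_exp :: "complex \<Rightarrow> complex \<Rightarrow> real \<Rightarrow> complex \<Rightarrow> complex \<Rightarrow> cmat" where
  "pot_exp a b c z w \<equiv> mexp (cscaleM z (deg1_pot a b c w))"

lemma pot_exp_eq:
  fixes a b z w :: complex and c :: real
  defines "X \<equiv> ch (z\<^sup>2 * pot_mu a b c w)" and "Y \<equiv> z * sh (z\<^sup>2 * pot_mu a b c w)"
  shows "pot_exp a b c z w = mat2 (X + \<i> * c * Y) ((a / w + w * cnj b) * Y)
            ((b / w + w * cnj a) * Y) (X - \<i> * c * Y)"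
proof -
  let ?\<beta> = "a / w + w * cnj b" and ?\<gamma> = "b / w + w * cnj a"
  have *: "z\<^sup>2 * pot_mu a b c w = (z * (\<i> * c))\<^sup>2 + (z * ?\<beta>) * (z * ?\<gamma>)"
    by (simp add: pot_mu_def power_mult_distrib right_diff_distrib power2_eq_square mult_ac)
  have "cscaleM z (deg1_pot a b c w) = mat2 (z * (\<i> * c)) (z * ?\<beta>) (z * ?\<gamma>) (- (z * (\<i> * c)))"
    by (simp add: deg1_pot_def mat2_cscaleM)
  then show ?thesis
    by (simp only: mexp_traceless[OF *] X_def Y_def) (simp add: mat2_eq_iff mult_ac)
qed

lemma pot_mu_norm:
  fixes a b z w :: complex and c :: real
  defines "X \<equiv> ch (z\<^sup>2 * pot_mu a b c w)" and "Y \<equiv> z * sh (z\<^sup>2 * pot_mu a b c w)"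
  shows "(X + \<i> * c * Y) * (X - \<i> * c * Y)
          - ((a / w + w * cnj b) * Y) * ((b / w + w * cnj a) * Y) = 1"
proof -
  have "(X + \<i> * c * Y) * (X - \<i> * c * Y) - (\<beta> * Y) * (\<gamma> * Y) = X\<^sup>2 - (\<beta> * \<gamma> - (of_real c)\<^sup>2) * Y\<^sup>2" for \<beta> \<gamma>
    by (simp add: power2_eq_square algebra_simps)
  from this[of "a / w + w * cnj b" "b / w + w * cnj a"] show ?thesis
    unfolding pot_mu_def[symmetric] using ch_sh_pythagoras[of z "pot_mu a b c w"] by (simp add: X_def Y_def)
qed

lemma holomorphic_pot_mu [holomorphic_intros]: "0 \<notin> A \<Longrightarrow> pot_mu a b c holomorphic_on A"
  unfolding pot_mu_def by (intro holomorphic_intros) auto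

lemma holomorphic_pot_exp: "(\<lambda>w. pot_exp a b c z w $ i $ j) holomorphic_on - {0}"
proof -
  have *: "(\<lambda>w. z\<^sup>2 * pot_mu a b c w) holomorphic_on - {0}"
    by (intro holomorphic_intros) auto
  have 1: "(\<lambda>w. ch (z\<^sup>2 * pot_mu a b c w)) holomorphic_on - {0}"
    by (rule holomorphic_on_compose_gen[OF * holomorphic_ch, unfolded o_def]) (rule subset_UNIV)
  have 2: "(\<lambda>w. sh (z\<^sup>2 * pot_mu a b c w)) holomorphic_on - {0}"
    by (rule holomorphic_on_compose_gen[OF * holomorphic_sh, unfolded o_def]) (rule subset_UNIV)
  have "i = 1 \<or> i = 2" "j = 1 \<or> j = 2"
    using exhaust_2 by auto
  then show ?thesis
    unfolding pot_exp_eq by (elim disjE) (simp_all, (intro holomorphic_intros 1 2; simp)+)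
qed

text \<open>Both factors are exponentials of multiples of one and the same matrix, so the law
  reduces to the addition formulas for \<open>ch\<close> and \<open>sh\<close>.\<close>

lemma pot_exp_add: "pot_exp a b c (z + z') w = pot_exp a b c z w ** pot_exp a b c z' w"
proof -
  let ?m = "pot_mu a b c w"
  define X where "X = (\<lambda>z. ch (z\<^sup>2 * ?m))"
  define Y where "Y = (\<lambda>z. z * sh (z\<^sup>2 * ?m))"
  have XY: "X (z + z') = X z * X z' + ?m * Y z * Y z'" "Y (z + z') = Y z * X z' + X z * Y z'"
    unfolding X_def Y_def by (fact ch_sh_add)+
  show ?thesis
    unfolding pot_exp_eq X_def[symmetric, THEN fun_cong] Y_def[symmetric, THEN fun_cong] XY mat2_mult mat2_eq_iff
    by (intro conjI) (simp_all add: pot_mu_def power2_eq_square ring_distribs mult_ac)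
qed

text \<open>On the circle the two off-diagonal entries of the potential are conjugate to each
  other.\<close>

lemma pot_mu_circle_real: "cnj (pot_mu a b c (cis s)) = pot_mu a b c (cis s)"
  by (simp add: pot_mu_def cis_cnj divide_inverse mult_ac add_ac)

lemma pot_mu_minus: "pot_mu a b c (- w) = pot_mu a b c w"
proof -
  have "a / - w + - w * cnj b = - (a / w + w * cnj b)" "b / - w + - w * cnj a = - (b / w + w * cnj a)"
    by simp_all
  then show ?thesis
    unfolding pot_mu_def by (simp only: minus_mult_minus)
qed

lemma continuous_on_cmat:
  fixes f :: "'a::topological_space \<Rightarrow> cmat"
  assumes "\<And>i j. continuous_on S (\<lambda>x. f x $ i $ j)"
  shows "continuous_on S f"
  using continuous_on_mat2[OF assms assms assms assms, of 1 1 1 2 2 1 2 2] by (simp add: mat2_eta)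

text \<open>On the circle the potential lies in su(1,1); for real \<open>t\<close> the coefficients
  \<open>X\<close> and \<open>Y\<close> are real, so the exponential has the SU(1,1) form.\<close>

lemma pot_exp_real_entries:
  fixes a b :: complex and c t s :: real
  defines "X \<equiv> ch ((of_real t)\<^sup>2 * pot_mu a b c (cis s))" and "Y \<equiv> t * sh ((of_real t)\<^sup>2 * pot_mu a b c (cis s))"
  defines "P \<equiv> X + \<i> * c * Y" and "Q \<equiv> (a * cis (-s) + cis s * cnj b) * Y"
  shows "pot_exp a b c (of_real t) (cis s) = mat2 P Q (cnj Q) (cnj P)" "P * cnj P - Q * cnj Q = 1"
    "cnj X = X" "cnj Y = Y"
proof -
  have real: "cnj X = X" "cnj Y = Y"
    by (simp_all add: X_def Y_def cnj_ch cnj_sh pot_mu_circle_real)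
  have *: "a / cis s + cis s * cnj b = a * cis (-s) + cis s * cnj b"
    "b / cis s + cis s * cnj a = cnj (a * cis (-s) + cis s * cnj b)"
    by (simp_all add: divide_inverse cis_cnj mult.commute add.commute)
  show 1: "pot_exp a b c (of_real t) (cis s) = mat2 P Q (cnj Q) (cnj P)"
    unfolding pot_exp_eq * P_def Q_def complex_cnj_mult complex_cnj_add real
    by (simp add: X_def Y_def mat2_eq_iff)
  show "P * cnj P - Q * cnj Q = 1"
    using pot_mu_norm[of "of_real t" a b c "cis s"]
    unfolding * P_def Q_def complex_cnj_mult complex_cnj_add real
    by (simp add: X_def Y_def)
  show "cnj X = X" "cnj Y = Y" by fact+
qed

lemma loop_SU11_pot_exp: "loop_SU11 (pot_exp a b c (of_real t))"
  unfolding loop_SU11_iff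
proof (intro conjI ballI)
  have "circle \<subseteq> - {0}" by (auto simp: circle_def)
  then show "continuous_on circle (pot_exp a b c (of_real t))"
    by (intro continuous_on_cmat holomorphic_on_imp_continuous_on[OF holomorphic_on_subset[OF holomorphic_pot_exp]])
  fix w assume "w \<in> circle"
  show "pot_exp a b c (of_real t) (- w) = sigma3 ** pot_exp a b c (of_real t) w ** sigma3"
    by (simp add: pot_exp_eq pot_mu_minus sigma3_conj mat2_eq_iff) (simp add: field_simps)
  obtain s where "w = cis s" using \<open>w \<in> circle\<close> by (auto simp: circle_cis)
  then show "\<exists>p q. pot_exp a b c (of_real t) w = mat2 p q (cnj q) (cnj p) \<and> p * cnj p - q * cnj q = 1"
    using pot_exp_real_entries(1,2) by blast
qed

lemma loop_SU11_mult:
  assumes "loop_SU11 F" "loop_SU11 G"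
  shows "loop_SU11 (\<lambda>w. F w ** G w)"
  unfolding loop_SU11_iff
proof (intro conjI ballI)
  have "continuous_on circle (\<lambda>w. F w $ i $ j)" "continuous_on circle (\<lambda>w. G w $ i $ j)" for i j
    using assms by (auto simp: loop_SU11_iff intro!: continuous_intros)
  then show "continuous_on circle (\<lambda>w. F w ** G w)"
    by (intro continuous_on_cmat) (simp add: cmat_mult_nth continuous_on_add continuous_on_mult)
  fix w assume w: "w \<in> circle"
  have "F (-w) = sigma3 ** F w ** sigma3" "G (-w) = sigma3 ** G w ** sigma3"
    using assms w by (auto simp: loop_SU11_iff)
  then show "F (- w) ** G (- w) = sigma3 ** (F w ** G w) ** sigma3"
    by (simp add: sigma3_conj' mat2_mult cmat_mult_nth)
  obtain p q where F: "F w = mat2 p q (cnj q) (cnj p)" and n: "p * cnj p - q * cnj q = 1"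
    using assms(1) w unfolding loop_SU11_iff by blast
  obtain p' q' where G: "G w = mat2 p' q' (cnj q') (cnj p')" and n': "p' * cnj p' - q' * cnj q' = 1"
    using assms(2) w unfolding loop_SU11_iff by blast
  have "(p * p' + q * cnj q') * cnj (p * p' + q * cnj q') - (p * q' + q * cnj p') * cnj (p * q' + q * cnj p')
     = (p * cnj p - q * cnj q) * (p' * cnj p' - q' * cnj q')"
    by (simp add: algebra_simps)
  then show "\<exists>p q. F w ** G w = mat2 p q (cnj q) (cnj p) \<and> p * cnj p - q * cnj q = 1"
    by (intro exI[of _ "p * p' + q * cnj q'"] exI[of _ "p * q' + q * cnj p'"])
       (simp add: F G mat2_mult mat2_eq_iff n n' add.commute)
qed

text \<open>Left multiplication by the unitary loop \<open>exp (t D)\<close> keeps the plus factor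
  \<open>V\<close>, so it turns a decomposition at \<open>z\<close> into one at
  \<open>z + t\<close>.\<close>

lemma iwasawa_translate:
  assumes I: "iwasawa (pot_exp a b c z) F V"
    and I': "iwasawa (pot_exp a b c (z + of_real t)) F' V'" and w: "w \<in> circle"
  shows "F' w = pot_exp a b c (of_real t) w ** F w"
proof -
  have "iwasawa (pot_exp a b c (z + of_real t)) (\<lambda>w. pot_exp a b c (of_real t) w ** F w) V"
    using I loop_SU11_mult[OF loop_SU11_pot_exp, of F] unfolding iwasawa_def
    by (simp add: add.commute[of z] pot_exp_add matrix_mul_assoc)
  from iwasawa_unique[OF this I' w] show ?thesis .
qed

text \<open>On the real axis the exponential is already unitary. This supplies surface points with
  an explicit frame at every real parameter, on which the converse and the uniqueness of the pitch
  rely.\<close>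

lemma iwasawa_real_axis:
  "iwasawa (pot_exp a b c (of_real t)) (pot_exp a b c (of_real t)) (\<lambda>_. mat 1)"
proof -
  have "loop_plus (\<lambda>_. mat 1)"
    unfolding loop_plus_def by (simp add: sigma3_def mat2_mult mat_1_mat2 det_mat2)
  then show ?thesis
    by (simp add: iwasawa_def loop_SU11_pot_exp) (simp add: mat_def)
qed

subsection \<open>Two-jets at \<open>0\<close>\<close>

text \<open>The entries are plain derivatives, not Taylor coefficients. The first derivative is
  asked for near \<open>0\<close>, the second only at \<open>0\<close>: exactly what
  \<open>hatf\<close> at \<open>\<lambda> = 1\<close> consumes.\<close>

definition jet2 :: "(real \<Rightarrow> complex) \<Rightarrow> complex \<Rightarrow> complex \<Rightarrow> complex \<Rightarrow> bool" where
  "jet2 f f0 f1 f2 \<longleftrightarrow> f 0 = f0 \<and> (\<exists>f'. f' 0 = f1 \<and>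
     (\<forall>\<^sub>F s in nhds 0. (f has_vector_derivative f' s) (at s)) \<and> (f' has_vector_derivative f2) (at 0))"

lemma jet2_const: "jet2 (\<lambda>_. k) k 0 0"
  unfolding jet2_def by (intro conjI exI[of _ "\<lambda>_. 0"]) auto

lemma jet2_of_real: "jet2 of_real 0 1 0"
  unfolding jet2_def
  by (intro conjI exI[of _ "\<lambda>_. 1"]) (auto intro!: always_eventually has_vector_derivative_of_real derivative_eq_intros)

lemma jet2_add:
  assumes "jet2 f f0 f1 f2" "jet2 g g0 g1 g2"
  shows "jet2 (\<lambda>s. f s + g s) (f0 + g0) (f1 + g1) (f2 + g2)"
proof -
  obtain f' g' where *: "f 0 = f0" "g 0 = g0" "f' 0 = f1" "g' 0 = g1"
    "(f' has_vector_derivative f2) (at 0)" "(g' has_vector_derivative g2) (at 0)"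
    and ev: "\<forall>\<^sub>F s in nhds 0. (f has_vector_derivative f' s) (at s)"
    "\<forall>\<^sub>F s in nhds 0. (g has_vector_derivative g' s) (at s)"
    using assms unfolding jet2_def by blast
  show ?thesis
    unfolding jet2_def
  proof (intro conjI exI[of _ "\<lambda>s. f' s + g' s"])
    show "\<forall>\<^sub>F s in nhds 0. ((\<lambda>s. f s + g s) has_vector_derivative f' s + g' s) (at s)"
      using ev by eventually_elim (rule has_vector_derivative_add)
  qed (use * in \<open>auto intro: has_vector_derivative_add\<close>)
qed

lemma jet2_mult:
  assumes "jet2 f f0 f1 f2" "jet2 g g0 g1 g2"
  shows "jet2 (\<lambda>s. f s * g s) (f0 * g0) (f0 * g1 + f1 * g0) (f0 * g2 + 2 * (f1 * g1) + f2 * g0)"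
proof -
  obtain f' g' where *: "f 0 = f0" "g 0 = g0" "f' 0 = f1" "g' 0 = g1"
    and d: "(f' has_vector_derivative f2) (at 0)" "(g' has_vector_derivative g2) (at 0)"
    and ev: "\<forall>\<^sub>F s in nhds 0. (f has_vector_derivative f' s) (at s)"
    "\<forall>\<^sub>F s in nhds 0. (g has_vector_derivative g' s) (at s)"
    using assms unfolding jet2_def by blast
  from ev have d0: "(f has_vector_derivative f1) (at 0)" "(g has_vector_derivative g1) (at 0)"
    by (auto dest: eventually_nhds_x_imp_x simp: *)
  show ?thesis
    unfolding jet2_def
  proof (intro conjI exI[of _ "\<lambda>s. f s * g' s + f' s * g s"])
    show "\<forall>\<^sub>F s in nhds 0. ((\<lambda>s. f s * g s) has_vector_derivative f s * g' s + f' s * g s) (at s)"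
      using ev by eventually_elim (rule has_vector_derivative_mult)
    have "((\<lambda>s. f s * g' s + f' s * g s) has_vector_derivative
         (f 0 * g2 + f1 * g' 0) + (f' 0 * g1 + f2 * g 0)) (at 0)"
      by (intro has_vector_derivative_add has_vector_derivative_mult d d0)
    then show "((\<lambda>s. f s * g' s + f' s * g s) has_vector_derivative f0 * g2 + 2 * (f1 * g1) + f2 * g0) (at 0)"
      by (simp add: * algebra_simps)
  qed (simp_all add: *)
qed

lemma jet2_cmult: "jet2 f f0 f1 f2 \<Longrightarrow> jet2 (\<lambda>s. k * f s) (k * f0) (k * f1) (k * f2)"
  using jet2_mult[OF jet2_const[of k], of f f0 f1 f2] by simp

lemma jet2_minus: "jet2 f f0 f1 f2 \<Longrightarrow> jet2 (\<lambda>s. - f s) (- f0) (- f1) (- f2)"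
  using jet2_cmult[of f f0 f1 f2 "-1"] by simp

lemma jet2_diff:
  assumes "jet2 f f0 f1 f2" "jet2 g g0 g1 g2"
  shows "jet2 (\<lambda>s. f s - g s) (f0 - g0) (f1 - g1) (f2 - g2)"
  using jet2_add[OF assms(1) jet2_minus[OF assms(2)]] by simp

lemma jet2_cnj:
  assumes "jet2 f f0 f1 f2"
  shows "jet2 (\<lambda>s. cnj (f s)) (cnj f0) (cnj f1) (cnj f2)"
proof -
  obtain f' where *: "f 0 = f0" "f' 0 = f1" "(f' has_vector_derivative f2) (at 0)"
    and ev: "\<forall>\<^sub>F s in nhds 0. (f has_vector_derivative f' s) (at s)"
    using assms unfolding jet2_def by blast
  show ?thesis
    unfolding jet2_def
  proof (intro conjI exI[of _ "\<lambda>s. cnj (f' s)"])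
    show "\<forall>\<^sub>F s in nhds 0. ((\<lambda>s. cnj (f s)) has_vector_derivative cnj (f' s)) (at s)"
      using ev by eventually_elim (rule has_vector_derivative_cnj)
  qed (use * in \<open>auto intro: has_vector_derivative_cnj\<close>)
qed

lemma has_vector_derivative_eventually_eq:
  assumes "(f has_vector_derivative D) (at x)" and eq: "\<forall>\<^sub>F y in nhds x. f y = g y"
  shows "(g has_vector_derivative D) (at x)"
proof -
  have "(f has_vector_derivative D) (at x) = (g has_vector_derivative D) (at x)"
    by (rule has_vector_derivative_cong_ev) (use eq eventually_nhds_x_imp_x[OF eq] in simp_all)
  with assms(1) show ?thesis by simp
qed

text \<open>Equality near \<open>0\<close> is also equality near each point close to
  \<open>0\<close>, so the first derivatives agree on a neighbourhood and can be differentiated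
  again.\<close>

lemma jet2_cong:
  assumes "jet2 f f0 f1 f2" and eq: "\<forall>\<^sub>F s in nhds 0. f s = g s"
  shows "jet2 g f0 f1 f2"
proof -
  obtain f' where *: "f 0 = f0" "f' 0 = f1" "(f' has_vector_derivative f2) (at 0)"
    and ev: "\<forall>\<^sub>F s in nhds 0. (f has_vector_derivative f' s) (at s)"
    using assms unfolding jet2_def by blast
  have "\<forall>\<^sub>F s in nhds 0. \<forall>\<^sub>F x in nhds s. f x = g x"
    using eq by (simp add: eventually_eventually)
  with ev have "\<forall>\<^sub>F s in nhds 0. (g has_vector_derivative f' s) (at s)"
    by eventually_elim (rule has_vector_derivative_eventually_eq)
  moreover have "g 0 = f0"
    using eventually_nhds_x_imp_x[OF eq] * by simp
  ultimately show ?thesis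
    unfolding jet2_def using * by blast
qed

lemma jet2_unique:
  assumes "jet2 f f0 f1 f2" "jet2 f g0 g1 g2"
  shows "f0 = g0" "f1 = g1" "f2 = g2"
proof -
  obtain f' where *: "f 0 = f0" "f' 0 = f1" "(f' has_vector_derivative f2) (at 0)"
    and ev: "\<forall>\<^sub>F s in nhds 0. (f has_vector_derivative f' s) (at s)"
    using assms(1) unfolding jet2_def by blast
  obtain g' where **: "f 0 = g0" "g' 0 = g1" "(g' has_vector_derivative g2) (at 0)"
    and ev': "\<forall>\<^sub>F s in nhds 0. (f has_vector_derivative g' s) (at s)"
    using assms(2) unfolding jet2_def by blast
  have eq: "\<forall>\<^sub>F s in nhds 0. f' s = g' s"
    using ev ev' by eventually_elim (rule vector_derivative_unique_at)
  show "f0 = g0" "f1 = g1"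
    using * ** eventually_nhds_x_imp_x[OF eq] by simp_all
  have "(g' has_vector_derivative f2) (at 0)"
    using *(3) eq by (rule has_vector_derivative_eventually_eq)
  with **(3) show "f2 = g2"
    by (rule vector_derivative_unique_at[rotated])
qed

lemma jet2_holomorphic:
  assumes "jet2 f f0 f1 f2" and hol: "h holomorphic_on A" and A: "open A" "f0 \<in> A"
  shows "jet2 (\<lambda>s. h (f s)) (h f0) (f1 * deriv h f0) (f1 * (f1 * deriv (deriv h) f0) + f2 * deriv h f0)"
proof -
  obtain f' where *: "f 0 = f0" "f' 0 = f1" "(f' has_vector_derivative f2) (at 0)"
    and ev: "\<forall>\<^sub>F s in nhds 0. (f has_vector_derivative f' s) (at s)"
    using assms unfolding jet2_def by blast
  have f0: "(f has_vector_derivative f1) (at 0)"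
    using eventually_nhds_x_imp_x[OF ev] * by simp
  then have "isCont f 0"
    by (rule has_vector_derivative_continuous)
  then have "\<forall>\<^sub>F s in nhds 0. f s \<in> A"
    using A * unfolding continuous_at_open eventually_nhds by metis
  with ev have "\<forall>\<^sub>F s in nhds 0. ((\<lambda>s. h (f s)) has_vector_derivative f' s * deriv h (f s)) (at s)"
  proof eventually_elim
    case (elim s)
    then have "(h has_field_derivative deriv h (f s)) (at (f s))"
      using holomorphic_derivI[OF hol A(1)] by blast
    from field_vector_diff_chain_at[OF elim(1) this] show ?case
      by (simp add: o_def)
  qed
  moreover have "((\<lambda>s. f' s * deriv h (f s)) has_vector_derivative f' 0 * (f1 * deriv (deriv h) f0) + f2 * deriv h (f 0)) (at 0)"
  proof (rule has_vector_derivative_mult[OF *(3)])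
    have "(deriv h has_field_derivative deriv (deriv h) (f 0)) (at (f 0))"
      using holomorphic_derivI[OF holomorphic_deriv[OF hol A(1)] A(1)] A(2) * by blast
    from field_vector_diff_chain_at[OF f0 this]
    show "((\<lambda>s. deriv h (f s)) has_vector_derivative f1 * deriv (deriv h) f0) (at 0)"
      by (simp add: o_def *)
  qed
  ultimately show ?thesis
    unfolding jet2_def using * by (intro conjI exI[of _ "\<lambda>s. f' s * deriv h (f s)"]) simp_all
qed

lemma jet2_cis: "jet2 cis 1 \<i> (-1)"
proof -
  have "jet2 (\<lambda>s. exp (\<i> * of_real s)) (exp (\<i> * 0)) (\<i> * 1 * deriv exp (\<i> * 0))
     (\<i> * 1 * (\<i> * 1 * deriv (deriv exp) (\<i> * 0)) + \<i> * 0 * deriv exp (\<i> * 0))"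
    by (rule jet2_holomorphic[of _ _ _ _ _ UNIV, OF jet2_cmult[OF jet2_of_real]]) (auto intro: holomorphic_intros)
  moreover have "deriv exp = (exp :: complex \<Rightarrow> complex)"
    by (auto intro!: DERIV_imp_deriv derivative_eq_intros)
  ultimately show ?thesis
    by (simp add: cis_conv_exp[abs_def])
qed

subsection \<open>The Sym formula at \<open>\<lambda> = 1\<close>\<close>

text \<open>The 2-jet at \<open>\<lambda> = 1\<close> of the first row of an SU(1,1) loop, with
  derivatives in the angle. Only the loop near \<open>1\<close> is constrained, since the Sym
  formula there sees nothing else.\<close>

definition su11_jet where
  "su11_jet F p0 p1 p2 q0 q1 q2 \<longleftrightarrow> (\<exists>p q. jet2 p p0 p1 p2 \<and> jet2 q q0 q1 q2 \<and>
     (\<forall>\<^sub>F s in nhds 0. F (cis s) = mat2 (p s) (q s) (cnj (q s)) (cnj (p s)) \<and>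
        p s * cnj (p s) - q s * cnj (q s) = 1))"

text \<open>The coordinates \<open>x\<^sub>1 + \<i> x\<^sub>2\<close> and \<open>x\<^sub>3\<close> of the Sym formula in terms of the 2-jets of the first
  row \<open>(p, q)\<close> of the frame.\<close>

definition sym_x :: "complex \<Rightarrow> complex \<Rightarrow> complex \<Rightarrow> complex \<Rightarrow> complex" where
  "sym_x p0 p1 q0 q1 = 2 * (p0 * q0) - 2 * \<i> * (p1 * q0 - q1 * p0)"

definition sym_z :: "complex \<Rightarrow> complex \<Rightarrow> complex \<Rightarrow> complex \<Rightarrow> complex \<Rightarrow> complex \<Rightarrow> complex" where
  "sym_z p0 p1 p2 q0 q1 q2 = \<i> * (p2 * cnj p0 + p1 * cnj p1 - q2 * cnj q0 - q1 * cnj q1)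
     - (p1 * cnj p0 + p0 * cnj p1 + q1 * cnj q0 + q0 * cnj q1) / 2"

text \<open>The determinant relation holds near \<open>s = 0\<close>, so its value and first two
  derivatives can be compared with those of a constant.\<close>

lemma su11_jet_norm:
  assumes "su11_jet F p0 p1 p2 q0 q1 q2"
  shows "p0 * cnj p0 - q0 * cnj q0 = 1"
    "p1 * cnj p0 + p0 * cnj p1 - q1 * cnj q0 - q0 * cnj q1 = 0"
    "p2 * cnj p0 + 2 * (p1 * cnj p1) + p0 * cnj p2 - (q2 * cnj q0 + 2 * (q1 * cnj q1) + q0 * cnj q2) = 0"
proof -
  obtain p q where p: "jet2 p p0 p1 p2" and q: "jet2 q q0 q1 q2"
    and "\<forall>\<^sub>F s in nhds 0. F (cis s) = mat2 (p s) (q s) (cnj (q s)) (cnj (p s)) \<and>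
        p s * cnj (p s) - q s * cnj (q s) = 1"
    using assms unfolding su11_jet_def by blast
  then have "\<forall>\<^sub>F s in nhds 0. p s * cnj (p s) - q s * cnj (q s) = 1"
    by (auto elim: eventually_mono)
  note unique = jet2_unique[OF jet2_cong[OF jet2_diff[OF jet2_mult[OF p jet2_cnj[OF p]] jet2_mult[OF q jet2_cnj[OF q]]] this] jet2_const]
  show "p0 * cnj p0 - q0 * cnj q0 = 1"
    using unique(1) .
  show "p1 * cnj p0 + p0 * cnj p1 - q1 * cnj q0 - q0 * cnj q1 = 0"
    using unique(2) by (simp add: algebra_simps)
  show "p2 * cnj p0 + 2 * (p1 * cnj p1) + p0 * cnj p2 - (q2 * cnj q0 + 2 * (q1 * cnj q1) + q0 * cnj q2) = 0"
    using unique(3) by (simp add: algebra_simps)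
qed

text \<open>The defect from being real is \<open>\<i>\<close> times the second derivative of the
  determinant relation.\<close>

lemma sym_z_real:
  assumes "su11_jet F p0 p1 p2 q0 q1 q2"
  shows "cnj (sym_z p0 p1 p2 q0 q1 q2) = sym_z p0 p1 p2 q0 q1 q2"
proof -
  have "sym_z p0 p1 p2 q0 q1 q2 - cnj (sym_z p0 p1 p2 q0 q1 q2) = \<i> *
     (p2 * cnj p0 + 2 * (p1 * cnj p1) + p0 * cnj p2 - (q2 * cnj q0 + 2 * (q1 * cnj q1) + q0 * cnj q2))"
    by (simp add: sym_z_def algebra_simps)
  then show ?thesis
    using su11_jet_norm(3)[OF assms] by simp
qed

lemma su11_jet_mult:
  assumes M: "su11_jet M m0 m1 m2 n0 n1 n2" and F: "su11_jet F p0 p1 p2 q0 q1 q2"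
    and G: "\<And>w. w \<in> circle \<Longrightarrow> G w = M w ** F w"
  shows "su11_jet G (m0 * p0 + n0 * cnj q0)
     (m0 * p1 + m1 * p0 + (n0 * cnj q1 + n1 * cnj q0))
     (m0 * p2 + 2 * (m1 * p1) + m2 * p0 + (n0 * cnj q2 + 2 * (n1 * cnj q1) + n2 * cnj q0))
     (m0 * q0 + n0 * cnj p0)
     (m0 * q1 + m1 * q0 + (n0 * cnj p1 + n1 * cnj p0))
     (m0 * q2 + 2 * (m1 * q1) + m2 * q0 + (n0 * cnj p2 + 2 * (n1 * cnj p1) + n2 * cnj p0))"
proof -
  obtain p q where p: "jet2 p p0 p1 p2" and q: "jet2 q q0 q1 q2"
    and 1: "\<forall>\<^sub>F s in nhds 0. F (cis s) = mat2 (p s) (q s) (cnj (q s)) (cnj (p s)) \<and>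
        p s * cnj (p s) - q s * cnj (q s) = 1"
    using F unfolding su11_jet_def by blast
  obtain m n where m: "jet2 m m0 m1 m2" and n: "jet2 n n0 n1 n2"
    and 2: "\<forall>\<^sub>F s in nhds 0. M (cis s) = mat2 (m s) (n s) (cnj (n s)) (cnj (m s)) \<and>
        m s * cnj (m s) - n s * cnj (n s) = 1"
    using M unfolding su11_jet_def by blast
  show ?thesis
    unfolding su11_jet_def
  proof (intro exI conjI)
    show "\<forall>\<^sub>F s in nhds 0. G (cis s) = mat2 (m s * p s + n s * cnj (q s)) (m s * q s + n s * cnj (p s))
         (cnj (m s * q s + n s * cnj (p s))) (cnj (m s * p s + n s * cnj (q s))) \<and>
        (m s * p s + n s * cnj (q s)) * cnj (m s * p s + n s * cnj (q s))
        - (m s * q s + n s * cnj (p s)) * cnj (m s * q s + n s * cnj (p s)) = 1"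
      using 1 2
    proof eventually_elim
      case (elim s)
      have "(m s * p s + n s * cnj (q s)) * cnj (m s * p s + n s * cnj (q s))
        - (m s * q s + n s * cnj (p s)) * cnj (m s * q s + n s * cnj (p s))
        = (m s * cnj (m s) - n s * cnj (n s)) * (p s * cnj (p s) - q s * cnj (q s))"
        by (simp add: algebra_simps)
      moreover have "cis s \<in> circle" by (simp add: circle_cis)
      ultimately show ?case
        using elim by (simp add: G mat2_mult mat2_eq_iff add.commute)
    qed
  qed (intro jet2_add jet2_mult jet2_cnj m n p q)+
qed

text \<open>Left multiplication by a loop that is diagonal at \<open>\<lambda> = 1\<close> acts on the Sym formula by an
  isometry of Nil\<open>\<^sub>3\<close>.\<close>

lemma sym_transform:
  assumes M: "su11_jet M m0 m1 m2 0 n1 n2" and F: "su11_jet F p0 p1 p2 q0 q1 q2"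
    and G: "\<And>w. w \<in> circle \<Longrightarrow> G w = M w ** F w"
  obtains P0 P1 P2 Q0 Q1 Q2 where "su11_jet G P0 P1 P2 Q0 Q1 Q2"
    "sym_x P0 P1 Q0 Q1 = m0\<^sup>2 * sym_x p0 p1 q0 q1 + 2 * \<i> * (m0 * n1)"
    "sym_z P0 P1 P2 Q0 Q1 Q2 = sym_z p0 p1 p2 q0 q1 q2
      - of_real (Re (cnj n1 * m0 * sym_x p0 p1 q0 q1)) + \<i> * (m2 * cnj m0 + m1 * cnj m1 - n1 * cnj n1)"
proof (rule that)
  let ?P0 = "m0 * p0" and ?P1 = "m0 * p1 + m1 * p0 + n1 * cnj q0"
    and ?P2 = "m0 * p2 + 2 * (m1 * p1) + m2 * p0 + (2 * (n1 * cnj q1) + n2 * cnj q0)"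
  let ?Q0 = "m0 * q0" and ?Q1 = "m0 * q1 + m1 * q0 + n1 * cnj p0"
    and ?Q2 = "m0 * q2 + 2 * (m1 * q1) + m2 * q0 + (2 * (n1 * cnj p1) + n2 * cnj p0)"
  show "su11_jet G ?P0 ?P1 ?P2 ?Q0 ?Q1 ?Q2"
    using su11_jet_mult[OF M F G] by simp
  note relM = su11_jet_norm[OF M] and relF = su11_jet_norm[OF F]
  have "sym_x ?P0 ?P1 ?Q0 ?Q1 - (m0\<^sup>2 * sym_x p0 p1 q0 q1 + 2 * \<i> * (m0 * n1))
      = 2 * \<i> * (m0 * n1) * (p0 * cnj p0 - q0 * cnj q0 - 1)"
    by (simp add: sym_x_def power2_eq_square algebra_simps)
  then show "sym_x ?P0 ?P1 ?Q0 ?Q1 = m0\<^sup>2 * sym_x p0 p1 q0 q1 + 2 * \<i> * (m0 * n1)"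
    using relF(1) by simp
  have Re2: "complex_of_real (Re z) = (z + cnj z) / 2" for z
    by (simp add: complex_eq_iff)
  \<comment> \<open>The difference of the two sides is written as a combination of the determinant
    relations of \<open>M\<close> and \<open>F\<close> and of their first derivatives, all of which
    vanish.\<close>
  have "sym_z ?P0 ?P1 ?P2 ?Q0 ?Q1 ?Q2 - (sym_z p0 p1 p2 q0 q1 q2
      - of_real (Re (cnj n1 * m0 * sym_x p0 p1 q0 q1)) + \<i> * (m2 * cnj m0 + m1 * cnj m1 - n1 * cnj n1))
    = (m0 * cnj m0 - 1) * (\<i> * (p2 * cnj p0 + p1 * cnj p1 - q2 * cnj q0 - q1 * cnj q1)
         - (p1 * cnj p0 + p0 * cnj p1 + q1 * cnj q0 + q0 * cnj q1) / 2)
      + (p0 * cnj p0 - q0 * cnj q0 - 1) * (\<i> * (m2 * cnj m0 + m1 * cnj m1 - n1 * cnj n1))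
      + (p1 * cnj p0 + p0 * cnj p1 - q1 * cnj q0 - q0 * cnj q1) * (\<i> * (m1 * cnj m0))
      + (m1 * cnj m0 + m0 * cnj m1) * (\<i> * (p1 * cnj p0 - q1 * cnj q0) - (p0 * cnj p0 + q0 * cnj q0) / 2)"
    unfolding sym_z_def sym_x_def Re2 by (simp add: field_simps)
  then show "sym_z ?P0 ?P1 ?P2 ?Q0 ?Q1 ?Q2 = sym_z p0 p1 p2 q0 q1 q2
      - of_real (Re (cnj n1 * m0 * sym_x p0 p1 q0 q1)) + \<i> * (m2 * cnj m0 + m1 * cnj m1 - n1 * cnj n1)"
    using relM(1,2) relF(1,2) by simp
qed

lemma has_vector_derivative_mat2:
  assumes "(f1 has_vector_derivative a) F" "(f2 has_vector_derivative b) F"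
    "(f3 has_vector_derivative c) F" "(f4 has_vector_derivative d) F"
  shows "((\<lambda>x. mat2 (f1 x) (f2 x) (f3 x) (f4 x)) has_vector_derivative mat2 a b c d) F"
proof -
  have lin: "bounded_linear (\<lambda>z. mat2 z 0 0 0)" "bounded_linear (\<lambda>z. mat2 0 z 0 0)"
    "bounded_linear (\<lambda>z. mat2 0 0 z 0)" "bounded_linear (\<lambda>z. mat2 0 0 0 z)"
    unfolding linear_conv_bounded_linear[symmetric]
    by (rule linearI; simp add: mat2_add mat2_scaleR mat2_eq_iff scaleR_conv_of_real[where 'a = complex])+
  have *: "mat2 p q r u = mat2 p 0 0 0 + mat2 0 q 0 0 + mat2 0 0 r 0 + mat2 0 0 0 u" for p q r u
    by (simp add: mat2_add)
  show ?thesis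
    by (subst (1 2) *, intro has_vector_derivative_add)
       (intro bounded_linear.has_vector_derivative[OF lin(1) assms(1)]
         bounded_linear.has_vector_derivative[OF lin(2) assms(2)]
         bounded_linear.has_vector_derivative[OF lin(3) assms(3)]
         bounded_linear.has_vector_derivative[OF lin(4) assms(4)])+
qed

text \<open>\<open>lam_dlam\<close> differentiates at the principal argument; the bounds on
  \<open>s\<close> make it equal to \<open>s\<close>.\<close>

lemma lam_dlam_cis:
  assumes "((\<lambda>s. G (cis s)) has_vector_derivative D) (at s)" "-pi < s" "s \<le> pi"
  shows "lam_dlam G (cis s) = cscaleM (-\<i>) D"
  using assms by (simp add: lam_dlam_def Arg_cis vector_derivative_at)

lemma hatf_eq:
  assumes "su11_jet F p0 p1 p2 q0 q1 q2"
  shows "hatf F 1 = mat2 (- (\<i>/2) * sym_z p0 p1 p2 q0 q1 q2) (\<i>/2 * sym_x p0 p1 q0 q1)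
     (cnj (\<i>/2 * sym_x p0 p1 q0 q1)) (cnj (- (\<i>/2) * sym_z p0 p1 p2 q0 q1 q2))"
proof -
  obtain p q where p: "jet2 p p0 p1 p2" and q: "jet2 q q0 q1 q2"
    and F: "\<forall>\<^sub>F s in nhds 0. F (cis s) = mat2 (p s) (q s) (cnj (q s)) (cnj (p s)) \<and>
        p s * cnj (p s) - q s * cnj (q s) = 1"
    using assms unfolding su11_jet_def by blast
  obtain p' where p': "p 0 = p0" "p' 0 = p1" "(p' has_vector_derivative p2) (at 0)"
    and evp: "\<forall>\<^sub>F s in nhds 0. (p has_vector_derivative p' s) (at s)"
    using p unfolding jet2_def by blast
  obtain q' where q': "q 0 = q0" "q' 0 = q1" "(q' has_vector_derivative q2) (at 0)"
    and evq: "\<forall>\<^sub>F s in nhds 0. (q has_vector_derivative q' s) (at s)"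
    using q unfolding jet2_def by blast
  \<comment> \<open>Along the circle \<open>fL3\<close> is
    \<open>- F' F^-1 - (i/2) F sigma3 F^-1\<close> with \<open>F'\<close> the angular derivative;
    \<open>A\<close> and \<open>B\<close> are the entries of its first row.\<close>
  define A where "A s = - (p' s * cnj (p s) - q' s * cnj (q s)) - (\<i>/2) * (p s * cnj (p s) + q s * cnj (q s))" for s
  define B where "B s = p' s * q s - q' s * p s + \<i> * (p s * q s)" for s
  \<comment> \<open>\<open>hatf\<close> differentiates \<open>fL3\<close> once more, so its form is
    needed for all \<open>s\<close> near \<open>0\<close>; the bound keeps the principal argument of
    \<open>cis s\<close> equal to \<open>s\<close>.\<close>
  have small: "\<forall>\<^sub>F s in nhds 0. \<bar>s\<bar> < pi"
    using eventually_nhds_in_open[of "{-pi<..<pi}" "0::real"] by (auto elim: eventually_mono)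
  have "\<forall>\<^sub>F s in nhds 0. \<forall>\<^sub>F s in nhds s. F (cis s) = mat2 (p s) (q s) (cnj (q s)) (cnj (p s))"
    using F by (subst eventually_eventually) (auto elim: eventually_mono)
  with small F evp evq
  have fL3: "\<forall>\<^sub>F s in nhds 0. fL3 F (cis s) = mat2 (A s) (B s) (cnj (B s)) (cnj (A s))"
  proof eventually_elim
    case (elim s)
    have "((\<lambda>s. mat2 (p s) (q s) (cnj (q s)) (cnj (p s))) has_vector_derivative
         mat2 (p' s) (q' s) (cnj (q' s)) (cnj (p' s))) (at s)"
      using elim by (intro has_vector_derivative_mat2 has_vector_derivative_cnj)
    then have "((\<lambda>s. F (cis s)) has_vector_derivative mat2 (p' s) (q' s) (cnj (q' s)) (cnj (p' s))) (at s)"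
      by (rule has_vector_derivative_eventually_eq) (use elim(5) in \<open>simp add: eq_commute\<close>)
    then have "lam_dlam F (cis s) = cscaleM (-\<i>) (mat2 (p' s) (q' s) (cnj (q' s)) (cnj (p' s)))"
      by (rule lam_dlam_cis) (use elim(1) in auto)
    moreover have "F (cis s) = mat2 (p s) (q s) (cnj (q s)) (cnj (p s))"
      and "matrix_inv (F (cis s)) = mat2 (cnj (p s)) (- q s) (- cnj (q s)) (p s)"
      using elim(2) by (simp_all add: matrix_inv_mat2)
    ultimately show ?case
      by (simp add: fL3_def mat2_cscaleM sigma3_def mat2_mult mat2_diff mat2_eq_iff A_def B_def algebra_simps)
  qed
  have "(p has_vector_derivative p1) (at 0)" "(q has_vector_derivative q1) (at 0)"
    using eventually_nhds_x_imp_x[OF evp] eventually_nhds_x_imp_x[OF evq] p' q' by simp_all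
  note d = this p'(3) q'(3)
  have dA: "(A has_vector_derivative \<i> * sym_z p0 p1 p2 q0 q1 q2) (at 0)"
  proof -
    have "(A has_vector_derivative - ((p' 0 * cnj p1 + p2 * cnj (p 0)) - (q' 0 * cnj q1 + q2 * cnj (q 0)))
       - (\<i>/2) * ((p 0 * cnj p1 + p1 * cnj (p 0)) + (q 0 * cnj q1 + q1 * cnj (q 0)))) (at 0)"
      unfolding A_def[abs_def]
      by (intro has_vector_derivative_diff has_vector_derivative_minus has_vector_derivative_add has_vector_derivative_mult
          has_vector_derivative_mult_right has_vector_derivative_cnj d)
    moreover have "- ((p' 0 * cnj p1 + p2 * cnj (p 0)) - (q' 0 * cnj q1 + q2 * cnj (q 0)))
       - (\<i>/2) * ((p 0 * cnj p1 + p1 * cnj (p 0)) + (q 0 * cnj q1 + q1 * cnj (q 0)))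
       = \<i> * sym_z p0 p1 p2 q0 q1 q2"
      by (simp add: p' q' sym_z_def field_simps)
    ultimately show ?thesis by simp
  qed
  obtain B' where dB: "(B has_vector_derivative B') (at 0)"
  proof
    show "(B has_vector_derivative (p' 0 * q1 + p2 * q 0) - (q' 0 * p1 + q2 * p 0) + \<i> * (p 0 * q1 + p1 * q 0)) (at 0)"
      unfolding B_def[abs_def]
      by (intro has_vector_derivative_diff has_vector_derivative_add has_vector_derivative_mult
            has_vector_derivative_mult_right d)
  qed
  let ?A' = "\<i> * sym_z p0 p1 p2 q0 q1 q2"
  have "((\<lambda>s. fL3 F (cis s)) has_vector_derivative mat2 ?A' B' (cnj B') (cnj ?A')) (at 0)"
    by (rule has_vector_derivative_eventually_eq[OF has_vector_derivative_mat2[OF dA dB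
          has_vector_derivative_cnj[OF dB] has_vector_derivative_cnj[OF dA]]])
       (use fL3 in \<open>simp add: eq_commute\<close>)
  then have "lam_dlam (fL3 F) (cis 0) = cscaleM (-\<i>) (mat2 ?A' B' (cnj B') (cnj ?A'))"
    by (rule lam_dlam_cis) auto
  moreover have "fL3 F 1 = mat2 (A 0) (B 0) (cnj (B 0)) (cnj (A 0))"
    using eventually_nhds_x_imp_x[OF fL3] by simp
  moreover have "B 0 = \<i>/2 * sym_x p0 p1 q0 q1"
    by (simp add: B_def p' q' sym_x_def algebra_simps)
  ultimately show ?thesis
    by (simp add: hatf_def offdiag_def diagpart_def mat2_cscaleM mat2_diff)
qed

text \<open>In the basis \<open>E1\<close>, \<open>E2\<close>, \<open>E3\<close> the upper
  off-diagonal entry is \<open>\<i>/2\<close> times \<open>x1 + \<i> x2\<close> and the upper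
  diagonal entry is \<open>- \<i>/2\<close> times \<open>x3\<close>.\<close>

lemma hatf_eq_iff:
  assumes "su11_jet F p0 p1 p2 q0 q1 q2"
  shows "hatf F 1 = fst x *\<^sub>R E1 + fst (snd x) *\<^sub>R E2 + snd (snd x) *\<^sub>R E3 \<longleftrightarrow>
    sym_x p0 p1 q0 q1 = Complex (fst x) (fst (snd x)) \<and> sym_z p0 p1 p2 q0 q1 q2 = of_real (snd (snd x))"
proof -
  have "fst x *\<^sub>R E1 + fst (snd x) *\<^sub>R E2 + snd (snd x) *\<^sub>R E3
     = mat2 (- (\<i>/2) * of_real (snd (snd x))) (\<i>/2 * Complex (fst x) (fst (snd x)))
        (cnj (\<i>/2 * Complex (fst x) (fst (snd x)))) (cnj (- (\<i>/2) * of_real (snd (snd x))))"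
    by (simp add: E1_def E2_def E3_def mat2_cscaleM mat2_scaleR mat2_add mat2_eq_iff)
       (simp add: complex_eq_iff)
  then show ?thesis
    by (auto simp: hatf_eq[OF assms] mat2_eq_iff)
qed

lemma hatf_exists:
  assumes "su11_jet F p0 p1 p2 q0 q1 q2"
  obtains x where "hatf F 1 = fst x *\<^sub>R E1 + fst (snd x) *\<^sub>R E2 + snd (snd x) *\<^sub>R E3"
proof -
  have "sym_z p0 p1 p2 q0 q1 q2 = of_real (Re (sym_z p0 p1 p2 q0 q1 q2))"
    using sym_z_real[OF assms] by (metis Reals_cnj_iff of_real_Re)
  then show thesis
    by (intro that[of "(Re (sym_x p0 p1 q0 q1), Im (sym_x p0 p1 q0 q1), Re (sym_z p0 p1 p2 q0 q1 q2))"])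
       (subst hatf_eq_iff[OF assms], simp)
qed

section \<open>Existence of 2-jets for the frames and for \<open>S\<close>\<close>

lemma iwasawa_su11_jet:
  assumes "iwasawa (pot_exp a b c z) F V"
  obtains p0 p1 p2 q0 q1 q2 where "su11_jet F p0 p1 p2 q0 q1 q2"
proof -
  obtain h k where hk: "h holomorphic_on UNIV" "k holomorphic_on UNIV"
    "\<And>s::real. F (cis s) = mat2 (h s) (k s) (cnj (k s)) (cnj (h s))"
    "\<And>s::real. h s * cnj (h s) - k s * cnj (k s) = 1"
    using iwasawa_smooth[OF assms holomorphic_pot_exp] by blast
  have "jet2 (\<lambda>s. f (of_real s)) (f 0) (1 * deriv f 0) (1 * (1 * deriv (deriv f) 0) + 0 * deriv f 0)"
    if "f holomorphic_on UNIV" for f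
    by (rule jet2_holomorphic[OF jet2_of_real that]) auto
  from this[OF hk(1)] this[OF hk(2)] show thesis
    by (intro that) (unfold su11_jet_def, intro exI conjI, assumption, assumption, simp add: hk)
qed

lemma C2_loop_su11_jet:
  assumes "loop_SU11 S" "C2_loop S"
  obtains p0 p1 p2 q0 q1 q2 where "su11_jet S p0 p1 p2 q0 q1 q2"
proof -
  obtain S1 S2 where S: "\<And>\<theta>. ((\<lambda>s. S (cis s)) has_vector_derivative S1 \<theta>) (at \<theta>)"
    "\<And>\<theta>. (S1 has_vector_derivative S2 \<theta>) (at \<theta>)"
    using assms(2) unfolding C2_loop_def by blast
  have lin: "bounded_linear (\<lambda>A::cmat. A $ i $ j)" for i j
    using bounded_linear_compose[OF bounded_linear_vec_nth bounded_linear_vec_nth] .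
  have jet: "jet2 (\<lambda>s. S (cis s) $ i $ j) (S 1 $ i $ j) (S1 0 $ i $ j) (S2 0 $ i $ j)" for i j
    unfolding jet2_def
    by (intro conjI exI[of _ "\<lambda>s. S1 s $ i $ j"] always_eventually allI)
       (auto intro: bounded_linear.has_vector_derivative[OF lin] S)
  have "S (cis s) = mat2 (S (cis s) $ 1 $ 1) (S (cis s) $ 1 $ 2) (cnj (S (cis s) $ 1 $ 2)) (cnj (S (cis s) $ 1 $ 1))
     \<and> S (cis s) $ 1 $ 1 * cnj (S (cis s) $ 1 $ 1) - S (cis s) $ 1 $ 2 * cnj (S (cis s) $ 1 $ 2) = 1" for s
  proof -
    have "cis s \<in> circle" by (simp add: circle_cis)
    then show ?thesis
      using assms(1) unfolding loop_SU11_iff by force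
  qed
  then show thesis
    by (intro that) (unfold su11_jet_def, intro exI conjI, rule jet[of 1 1], rule jet[of 1 2], simp)
qed

subsection \<open>Helicoidal surfaces have positive determinant\<close>

lemma jet2_pot_beta:
  "jet2 (\<lambda>s. a * cis (-s) + cis s * cnj b) (a + cnj b) (\<i> * (cnj b - a)) (- a - cnj b)"
proof -
  have "jet2 (\<lambda>s. a * cnj (cis s) + cis s * cnj b) (a * cnj 1 + 1 * cnj b)
    (a * cnj \<i> + (1 * 0 + \<i> * cnj b)) (a * cnj (-1) + (1 * 0 + 2 * (\<i> * 0) + (-1) * cnj b))"
    by (intro jet2_add jet2_cmult jet2_mult jet2_cnj jet2_cis jet2_const)
  then show ?thesis
    by (simp add: cis_cnj algebra_simps)
qed

lemma pot_mu_cis: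
  "pot_mu a b c (cis s) = (a * cis (-s) + cis s * cnj b) * cnj (a * cis (-s) + cis s * cnj b) - (of_real c)\<^sup>2"
  by (simp add: pot_mu_def divide_inverse cis_cnj mult.commute add.commute)

text \<open>The second-order entries stay existential: the horizontal coordinate
  \<open>sym_x\<close>, on which the converse rests, involves first derivatives only.\<close>

lemma pot_exp_su11_jet:
  fixes a b :: complex and c t :: real
  defines "\<beta>0 \<equiv> a + cnj b" and "\<beta>1 \<equiv> \<i> * (cnj b - a)"
  defines "\<mu>0 \<equiv> \<beta>0 * cnj \<beta>0 - (of_real c)\<^sup>2" and "\<mu>1 \<equiv> \<beta>0 * cnj \<beta>1 + \<beta>1 * cnj \<beta>0"
  defines "X0 \<equiv> ch ((of_real t)\<^sup>2 * \<mu>0)" and "X1 \<equiv> (of_real t)\<^sup>2 * \<mu>1 * deriv ch ((of_real t)\<^sup>2 * \<mu>0)"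
  defines "Y0 \<equiv> t * sh ((of_real t)\<^sup>2 * \<mu>0)" and "Y1 \<equiv> t * ((of_real t)\<^sup>2 * \<mu>1 * deriv sh ((of_real t)\<^sup>2 * \<mu>0))"
  shows "\<exists>e2 g2. su11_jet (pot_exp a b c (of_real t)) (X0 + \<i> * c * Y0) (X1 + \<i> * c * Y1) e2
     (\<beta>0 * Y0) (\<beta>0 * Y1 + \<beta>1 * Y0) g2"
proof -
  note \<beta> = jet2_pot_beta[of a b, folded \<beta>0_def \<beta>1_def]
  obtain \<mu>2 where \<mu>: "jet2 (\<lambda>s. pot_mu a b c (cis s)) \<mu>0 \<mu>1 \<mu>2"
    using jet2_diff[OF jet2_mult[OF \<beta> jet2_cnj[OF \<beta>]] jet2_const[of "(of_real c)\<^sup>2"]]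
    unfolding pot_mu_cis \<mu>0_def \<mu>1_def diff_0_right by blast
  note t\<mu> = jet2_cmult[OF \<mu>, of "(of_real t)\<^sup>2"]
  define X where "X s = ch ((of_real t)\<^sup>2 * pot_mu a b c (cis s))" for s
  define Y where "Y s = t * sh ((of_real t)\<^sup>2 * pot_mu a b c (cis s))" for s
  obtain X2 where X: "jet2 X X0 X1 X2"
    using jet2_holomorphic[OF t\<mu> holomorphic_ch open_UNIV] unfolding X_def[abs_def] X0_def X1_def by blast
  obtain Y2 where Y: "jet2 Y Y0 Y1 Y2"
    using jet2_cmult[OF jet2_holomorphic[OF t\<mu> holomorphic_sh open_UNIV], of "of_real t"]
    unfolding Y_def[abs_def] Y0_def Y1_def by blast
  have "su11_jet (pot_exp a b c (of_real t)) (X0 + \<i> * c * Y0) (X1 + \<i> * c * Y1) (X2 + \<i> * c * Y2)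
     (\<beta>0 * Y0) (\<beta>0 * Y1 + \<beta>1 * Y0) (\<beta>0 * Y2 + 2 * (\<beta>1 * Y1) + (- a - cnj b) * Y0)"
    unfolding su11_jet_def
    by (rule exI[of _ "\<lambda>s. X s + \<i> * c * Y s"], rule exI[of _ "\<lambda>s. (a * cis (-s) + cis s * cnj b) * Y s"])
       (intro conjI always_eventually allI jet2_add jet2_cmult jet2_mult X Y \<beta>,
        simp_all only: X_def Y_def pot_exp_real_entries(1,2))
  then show ?thesis by blast
qed

text \<open>The formula is offered for every jet of the frame, so that the jet may later be computed
  from whichever factorization is convenient.\<close>

lemma surface_point_real_axis:
  assumes S: "su11_jet S m0 m1 m2 n0 n1 n2"
  obtains x where "surface_point (deg1_pot a b c) S (of_real t) x"
    "\<And>p0 p1 p2 q0 q1 q2. su11_jet (\<lambda>w. S w ** pot_exp a b c (of_real t) w) p0 p1 p2 q0 q1 q2 \<Longrightarrow>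
       Complex (fst x) (fst (snd x)) = sym_x p0 p1 q0 q1"
proof -
  let ?F = "\<lambda>w. S w ** pot_exp a b c (of_real t) w"
  obtain e0 e1 e2 g0 g1 g2 where E: "su11_jet (pot_exp a b c (of_real t)) e0 e1 e2 g0 g1 g2"
    using iwasawa_su11_jet[OF iwasawa_real_axis] by blast
  obtain x where x: "hatf ?F 1 = fst x *\<^sub>R E1 + fst (snd x) *\<^sub>R E2 + snd (snd x) *\<^sub>R E3"
    using hatf_exists[OF su11_jet_mult[OF S E, of ?F]] by blast
  show thesis
  proof (rule that)
    show "surface_point (deg1_pot a b c) S (of_real t) x"
      unfolding surface_point_def using iwasawa_real_axis x by blast
    show "Complex (fst x) (fst (snd x)) = sym_x p0 p1 q0 q1" if "su11_jet ?F p0 p1 p2 q0 q1 q2" for p0 p1 p2 q0 q1 q2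
      using x hatf_eq_iff[OF that, of x] by simp
  qed
qed

lemma iso_act_helical_horizontal:
  assumes "y = iso_act (helical \<alpha> cc s) x"
  shows "Complex (fst y) (fst (snd y)) = \<alpha> * (1 - cis s) + cis s * Complex (fst x) (fst (snd x))"
  using assms
  by (cases x) (simp add: iso_act_def helical_def nil_mult_def complex_eq_iff algebra_simps)

text \<open>The off-diagonal entry of a conjugate of an element of \<open>su(1,1)\<close> with entries \<open>k\<close>, \<open>d\<close>.\<close>

definition conj_entry :: "complex \<Rightarrow> complex \<Rightarrow> complex \<Rightarrow> complex \<Rightarrow> complex" where
  "conj_entry k d p q = p\<^sup>2 * d - q\<^sup>2 * cnj d - 2 * (p * q * k)"

lemma su11_jet_unique:
  assumes "su11_jet G p0 p1 p2 q0 q1 q2" "su11_jet G P0 P1 P2 Q0 Q1 Q2"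
  shows "p0 = P0" "p1 = P1" "q0 = Q0" "q1 = Q1"
proof -
  obtain p q where p: "jet2 p p0 p1 p2" and q: "jet2 q q0 q1 q2"
    and 1: "\<forall>\<^sub>F s in nhds 0. G (cis s) = mat2 (p s) (q s) (cnj (q s)) (cnj (p s)) \<and> p s * cnj (p s) - q s * cnj (q s) = 1"
    using assms(1) unfolding su11_jet_def by blast
  obtain p' q' where p': "jet2 p' P0 P1 P2" and q': "jet2 q' Q0 Q1 Q2"
    and 2: "\<forall>\<^sub>F s in nhds 0. G (cis s) = mat2 (p' s) (q' s) (cnj (q' s)) (cnj (p' s)) \<and> p' s * cnj (p' s) - q' s * cnj (q' s) = 1"
    using assms(2) unfolding su11_jet_def by blast
  from 1 2 have eqp: "\<forall>\<^sub>F s in nhds 0. p s = p' s"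
    by eventually_elim (simp add: mat2_eq_iff)
  from 1 2 have eqq: "\<forall>\<^sub>F s in nhds 0. q s = q' s"
    by eventually_elim (simp add: mat2_eq_iff)
  show "p0 = P0" "p1 = P1"
    using jet2_unique[OF jet2_cong[OF p eqp] p'] by blast+
  show "q0 = Q0" "q1 = Q1"
    using jet2_unique[OF jet2_cong[OF q eqq] q'] by blast+
qed

text \<open>Replacing \<open>F\<close> by \<open>F E\<close> changes \<open>fL3\<close> by the
  conjugate under \<open>F\<close> of \<open>fL3 E + (i/2) sigma3\<close>. The first two arguments
  of \<open>conj_entry\<close> are the entries of this matrix, simplified by the determinant
  relation of \<open>E\<close>; the factor \<open>\<i>/2\<close> is the one with which
  \<open>sym_x\<close> enters \<open>hatf\<close>.\<close>

lemma sym_x_right_mult: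
  assumes F: "su11_jet F p0 p1 p2 q0 q1 q2" and E: "su11_jet E e0 e1 e2 g0 g1 g2"
    and G: "\<And>w. w \<in> circle \<Longrightarrow> G w = F w ** E w" and GJ: "su11_jet G P0 P1 P2 Q0 Q1 Q2"
  shows "\<i>/2 * (sym_x P0 P1 Q0 Q1 - sym_x p0 p1 q0 q1)
     = conj_entry (- (e1 * cnj e0 - g1 * cnj g0) - \<i> * (g0 * cnj g0)) (e1 * g0 - g1 * e0 + \<i> * (e0 * g0)) p0 q0"
proof -
  note rel = su11_jet_norm[OF E]
  have "sym_x P0 P1 Q0 Q1 = sym_x (p0 * e0 + q0 * cnj g0) (p0 * e1 + p1 * e0 + (q0 * cnj g1 + q1 * cnj g0))
      (p0 * g0 + q0 * cnj e0) (p0 * g1 + p1 * g0 + (q0 * cnj e1 + q1 * cnj e0))"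
    by (simp only: su11_jet_unique[OF GJ su11_jet_mult[OF F E G]])
  moreover have "\<i>/2 * (sym_x (p0 * e0 + q0 * cnj g0) (p0 * e1 + p1 * e0 + (q0 * cnj g1 + q1 * cnj g0))
      (p0 * g0 + q0 * cnj e0) (p0 * g1 + p1 * g0 + (q0 * cnj e1 + q1 * cnj e0)) - sym_x p0 p1 q0 q1)
     - conj_entry (- (e1 * cnj e0 - g1 * cnj g0) - \<i> * (g0 * cnj g0)) (e1 * g0 - g1 * e0 + \<i> * (e0 * g0)) p0 q0
    = (e0 * cnj e0 - g0 * cnj g0 - 1) * (\<i> * (p0 * q0) + (p1 * q0 - q1 * p0))
      + (e1 * cnj e0 + e0 * cnj e1 - g1 * cnj g0 - g0 * cnj g1) * (- (p0 * q0))"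
    unfolding sym_x_def conj_entry_def by (simp add: power2_eq_square field_simps)
  ultimately show ?thesis
    using rel(1,2) by simp
qed

lemma continuous_on_ch_sh:
  "continuous_on A ch" "continuous_on A sh" "continuous_on A (deriv ch)" "continuous_on A (deriv sh)"
  by (intro holomorphic_on_imp_continuous_on holomorphic_ch holomorphic_sh
      holomorphic_on_subset[OF holomorphic_deriv[OF _ open_UNIV]] subset_UNIV)+

text \<open>Up to the factor \<open>sqrt r\<close> this is the real
  \<open>sinh (t * sqrt r)\<close>, and for \<open>r = 0\<close> it is \<open>t\<close>. Here the
  sign of the determinant matters: a negative \<open>r\<close> would give a sine, which has further
  zeros.\<close>

lemma real_sinh_nonzero:
  assumes "r \<ge> 0" "t \<noteq> 0"
  shows "of_real t * sh ((of_real t)\<^sup>2 * of_real r) \<noteq> 0"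
proof (cases "r = 0")
  case False
  with assms have "sinh (t * sqrt r) \<noteq> 0"
    by simp
  moreover have "sinh (complex_of_real y) = of_real (sinh y)" for y
    by (simp add: sinh_field_def exp_of_real[symmetric])
  ultimately have "of_real (t * sqrt r) * sh ((of_real (t * sqrt r))\<^sup>2) \<noteq> 0"
    unfolding sh_square by (metis of_real_eq_0_iff)
  moreover have "(complex_of_real (t * sqrt r))\<^sup>2 = (of_real t)\<^sup>2 * of_real r"
    using assms by (simp add: power_mult_distrib flip: of_real_power)
  ultimately show ?thesis by auto
qed (use assms in simp)

lemma helicoidal_det_positive:
  fixes a b \<alpha> :: complex and c cc \<omega> :: real
  assumes a: "a \<noteq> 0" and S: "su11_jet S m0 m1 m2 n0 n1 n2" and \<omega>: "\<omega> \<noteq> 0"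
    and inv: "invariant_under (deg1_pot a b c) S (\<lambda>t. helical \<alpha> cc (\<omega> * t))"
  shows "(cmod (a + cnj b))\<^sup>2 < c\<^sup>2"
proof (rule ccontr)
  assume neg: "\<not> (cmod (a + cnj b))\<^sup>2 < c\<^sup>2"
  define \<beta>0 \<beta>1 where "\<beta>0 = a + cnj b" and "\<beta>1 = \<i> * (cnj b - a)"
  \<comment> \<open>\<open>r\<close> is \<open>- det D(1)\<close>, nonnegative under the assumption
    to be refuted.\<close>
  define r where "r = (cmod \<beta>0)\<^sup>2 - c\<^sup>2"
  have r: "r \<ge> 0" using neg by (simp add: r_def \<beta>0_def)
  define \<mu> where "\<mu> = complex_of_real r"
  have \<mu>_eq: "\<beta>0 * cnj \<beta>0 - (of_real c)\<^sup>2 = \<mu>"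
    by (simp add: \<mu>_def r_def complex_norm_square[symmetric])
  define \<mu>1 where "\<mu>1 = \<beta>0 * cnj \<beta>1 + \<beta>1 * cnj \<beta>0"
  \<comment> \<open>Values and loop derivatives of the coefficients of \<open>exp (t D)\<close> at
    \<open>\<lambda> = 1\<close>, with the powers of \<open>t\<close> split off so that increments
    can be divided by the step at the end.\<close>
  define C where "C t = ch ((of_real t)\<^sup>2 * \<mu>)" for t :: real
  define H where "H t = sh ((of_real t)\<^sup>2 * \<mu>)" for t :: real
  define C' where "C' t = \<mu>1 * deriv ch ((of_real t)\<^sup>2 * \<mu>)" for t :: real
  define H' where "H' t = (of_real t)\<^sup>2 * \<mu>1 * deriv sh ((of_real t)\<^sup>2 * \<mu>)" for t :: real
  define e0 where "e0 t = C t + \<i> * c * (t * H t)" for t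
  define e1 where "e1 t = (of_real t)\<^sup>2 * C' t + \<i> * c * (t * H' t)" for t :: real
  define g0 where "g0 t = \<beta>0 * (t * H t)" for t
  define g1 where "g1 t = \<beta>0 * (t * H' t) + \<beta>1 * (t * H t)" for t
  have "\<exists>e2 g2. su11_jet (pot_exp a b c (of_real t)) (e0 t) (e1 t) e2 (g0 t) (g1 t) g2" for t
    using pot_exp_su11_jet[of t a b c] unfolding \<beta>0_def[symmetric] \<beta>1_def[symmetric] \<mu>_eq \<mu>1_def[symmetric]
    by (simp add: e0_def e1_def g0_def g1_def C_def H_def C'_def H'_def mult.assoc)
  then have "\<exists>e2. \<forall>t. \<exists>g2. su11_jet (pot_exp a b c (of_real t)) (e0 t) (e1 t) (e2 t) (g0 t) (g1 t) g2"
    by (intro choice allI)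
  then obtain e2 where "\<forall>t. \<exists>g2. su11_jet (pot_exp a b c (of_real t)) (e0 t) (e1 t) (e2 t) (g0 t) (g1 t) g2" ..
  from choice[OF this]
  obtain g2 where E: "\<And>t. su11_jet (pot_exp a b c (of_real t)) (e0 t) (e1 t) (e2 t) (g0 t) (g1 t) (g2 t)"
    by blast

  have "\<exists>x. surface_point (deg1_pot a b c) S (of_real t) x \<and>
    (\<forall>p0 p1 p2 q0 q1 q2. su11_jet (\<lambda>w. S w ** pot_exp a b c (of_real t) w) p0 p1 p2 q0 q1 q2 \<longrightarrow>
       Complex (fst x) (fst (snd x)) = sym_x p0 p1 q0 q1)" for t
    by (rule surface_point_real_axis[OF S, where a = a and b = b and c = c and t = t]) blast
  then have "\<exists>x. \<forall>t. surface_point (deg1_pot a b c) S (of_real t) (x t) \<and>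
    (\<forall>p0 p1 p2 q0 q1 q2. su11_jet (\<lambda>w. S w ** pot_exp a b c (of_real t) w) p0 p1 p2 q0 q1 q2 \<longrightarrow>
       Complex (fst (x t)) (fst (snd (x t))) = sym_x p0 p1 q0 q1)"
    by (intro choice allI)
  then obtain x where x: "\<And>t. surface_point (deg1_pot a b c) S (of_real t) (x t)"
    and xF: "\<And>t p0 p1 p2 q0 q1 q2. su11_jet (\<lambda>w. S w ** pot_exp a b c (of_real t) w) p0 p1 p2 q0 q1 q2 \<Longrightarrow>
       Complex (fst (x t)) (fst (snd (x t))) = sym_x p0 p1 q0 q1"
    by blast
  define X where "X t = Complex (fst (x t)) (fst (snd (x t)))" for t
  have X_rec: "X (s + t) = \<alpha> * (1 - cis (\<omega> * t)) + cis (\<omega> * t) * X s" for s t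
  proof -
    have "x (s + t) = iso_act (helical \<alpha> cc (\<omega> * t)) (x s)"
      using inv x[of s] x[of "s + t"] unfolding invariant_under_def by (metis of_real_add)
    then show ?thesis
      unfolding X_def by (rule iso_act_helical_horizontal)
  qed

  define p where "p t = m0 * e0 t + n0 * cnj (g0 t)" for t
  define q where "q t = m0 * g0 t + n0 * cnj (e0 t)" for t
  define k where "k s = - (e1 s * cnj (e0 s) - g1 s * cnj (g0 s)) - \<i> * (g0 s * cnj (g0 s))" for s
  define d where "d s = e1 s * g0 s - g1 s * e0 s + \<i> * (e0 s * g0 s)" for s
  \<comment> \<open>Splitting the frame at \<open>t + s\<close> with the factor for \<open>s\<close>
    on the right separates the variables: the coefficients depend on \<open>s\<close>, the row on
    \<open>t\<close>.\<close>
  have increment: "\<i>/2 * (X (t + s) - X t) = conj_entry (k s) (d s) (p t) (q t)" for s t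
  proof -
    let ?F = "\<lambda>t w. S w ** pot_exp a b c (of_real t) w"
    have mult: "?F (t + s) w = ?F t w ** pot_exp a b c (of_real s) w" for w
      by (simp add: pot_exp_add matrix_mul_assoc)
    note Ft = su11_jet_mult[OF S E, of "?F t" t, OF refl]
      and Fts = su11_jet_mult[OF S E, of "?F (t + s)" "t + s", OF refl]
    show ?thesis
      using sym_x_right_mult[OF Ft E mult Fts]
      unfolding X_def xF[OF Ft] xF[OF Fts] k_def d_def p_def q_def .
  qed
  \<comment> \<open>Differences of horizontal coordinates lose the axis \<open>\<alpha>\<close> and
    are merely rotated.\<close>
  have rotate: "conj_entry (k s) (d s) (p t) (q t) = cis (\<omega> * t) * conj_entry (k s) (d s) (p 0) (q 0)" for s t
  proof -
    have "X (t + s) - X t = cis (\<omega> * t) * (X (0 + s) - X 0)"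
    proof -
      have "X t = \<alpha> * (1 - cis (\<omega> * t)) + cis (\<omega> * t) * X 0"
        using X_rec[of 0 t] by simp
      then have "X (s + t) - X t = cis (\<omega> * t) * (X s - X 0)"
        unfolding X_rec[of s t] by (simp only: right_diff_distrib) simp
      then show ?thesis by (simp add: add.commute)
    qed
    then show ?thesis
      unfolding increment[symmetric] by simp
  qed

  have real: "cnj (C t) = C t" "cnj (H t) = H t" for t
    by (simp_all add: C_def H_def cnj_ch cnj_sh \<mu>_def)
  have even: "C (-t) = C t" "H (-t) = H t" for t
    by (simp_all add: C_def H_def)
  have at0: "C 0 = 1" "H 0 = 1"
    by (simp_all add: C_def H_def)
  have CH: "(C t)\<^sup>2 - \<mu> * (t * H t)\<^sup>2 = 1" for t
    unfolding C_def H_def by (rule ch_sh_pythagoras)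
  have vanish: "conj_entry (k s) (d s) m0 n0 = 0" for s
  proof -
    \<comment> \<open>\<open>(m', n')\<close> is the row \<open>(m0, n0)\<close> times
      \<open>D(1)\<close>. The row at \<open>t\<close> is thus an even part along
      \<open>(m0, n0)\<close> plus an odd part along \<open>(m', n')\<close>.\<close>
    define m' where "m' = \<i> * c * m0 + n0 * cnj \<beta>0"
    define n' where "n' = m0 * \<beta>0 - \<i> * c * n0"
    let ?G = "conj_entry (k s) (d s)"
    have pq: "p t = m0 * C t + (t * H t) * m'" "q t = n0 * C t + (t * H t) * n'"
      "p (-t) = m0 * C t - (t * H t) * m'" "q (-t) = n0 * C t - (t * H t) * n'" for t
      by (simp_all add: p_def q_def e0_def g0_def m'_def n'_def real even algebra_simps)
    have pq0: "p 0 = m0" "q 0 = n0"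
      using pq(1,2)[of 0] by (simp_all add: at0)
    \<comment> \<open>The parallelogram law for the quadratic form \<open>?G\<close>; the mixed
      terms cancel between \<open>t\<close> and \<open>-t\<close>.\<close>
    have "?G (m * C + y * m') (n * C + y * n') + ?G (m * C - y * m') (n * C - y * n')
        = 2 * C\<^sup>2 * ?G m n + 2 * y\<^sup>2 * ?G m' n'" for m n C y
      by (simp add: conj_entry_def power2_eq_square algebra_simps)
    then have sum: "?G (p t) (q t) + ?G (p (-t)) (q (-t)) = 2 * (C t)\<^sup>2 * ?G m0 n0 + 2 * (t * H t)\<^sup>2 * ?G m' n'" for t
      unfolding pq(3,4) pq(1,2)[of t] .
    \<comment> \<open>The left side of \<open>sum\<close> is rewritten by \<open>rotate\<close>, and
      \<open>CH\<close> eliminates the square of \<open>C t\<close>.\<close>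
    have key: "(cis (\<omega> * t) + cis (- (\<omega> * t)) - 2) * ?G m0 n0 = 2 * (t * H t)\<^sup>2 * (\<mu> * ?G m0 n0 + ?G m' n')" for t
    proof -
      have "(cis (\<omega> * t) + cis (- (\<omega> * t))) * ?G m0 n0 = 2 * (1 + \<mu> * (t * H t)\<^sup>2) * ?G m0 n0 + 2 * (t * H t)\<^sup>2 * ?G m' n'"
        using sum[of t] rotate[of s t] rotate[of s "-t"] CH[of t] by (simp add: pq0 algebra_simps)
      then show ?thesis
        by (simp add: algebra_simps)
    qed
    \<comment> \<open>After a full period the left side of \<open>key\<close> vanishes while
      \<open>t * H t\<close> does not, so the constant on its right side is zero.\<close>
    have "2 * pi / \<omega> \<noteq> 0" using \<omega> by simp
    then have "of_real (2 * pi / \<omega>) * H (2 * pi / \<omega>) \<noteq> 0"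
      unfolding H_def \<mu>_def by (rule real_sinh_nonzero[OF r])
    moreover have "2 * (of_real (2 * pi / \<omega>) * H (2 * pi / \<omega>))\<^sup>2 * (\<mu> * ?G m0 n0 + ?G m' n') = 0"
    proof -
      have "\<omega> * (2 * pi / \<omega>) = 2 * pi" "cis (2 * pi) + cis (- (2 * pi)) - 2 = 0"
        using \<omega> by (simp_all add: complex_eq_iff)
      then show ?thesis
        using key[of "2 * pi / \<omega>"] by (simp only: mult_zero_left)
    qed
    ultimately have "\<mu> * ?G m0 n0 + ?G m' n' = 0"
      by simp
    \<comment> \<open>The right side is now zero for all \<open>t\<close>; at the half period the
      factor on the left is \<open>-4\<close>.\<close>
    then show ?thesis
      using key[of "pi / \<omega>"] \<omega> by (simp add: complex_eq_iff cis.simps)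
  qed

  \<comment> \<open>\<open>D s\<close> and \<open>K s\<close> are \<open>d s\<close> and
    \<open>k s\<close> divided by \<open>s\<close>; they are continuous, so the vanishing for
    \<open>s \<noteq> 0\<close> extends to \<open>s = 0\<close> and yields first-order
    information.\<close>
  define D where "D s = e1 s * (\<beta>0 * H s) - (\<beta>0 * H' s + \<beta>1 * H s) * e0 s + \<i> * (e0 s * (\<beta>0 * H s))" for s
  define K where "K s = - ((of_real s * C' s + \<i> * c * H' s) * cnj (e0 s) - (\<beta>0 * H' s + \<beta>1 * H s) * cnj (g0 s))
       - \<i> * (\<beta>0 * H s * cnj (g0 s))" for s
  have dk: "d s = s * D s" "k s = s * K s" for s
    by (simp_all add: d_def k_def D_def K_def e1_def g1_def g0_def[of s] power2_eq_square algebra_simps)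
  have scaled: "conj_entry (K s) (D s) m0 n0 = 0" if "s \<noteq> 0" for s
  proof -
    have "conj_entry (k s) (d s) m0 n0 = of_real s * conj_entry (K s) (D s) m0 n0"
      by (simp add: conj_entry_def dk algebra_simps)
    then show ?thesis using vanish[of s] that by simp
  qed
  have cont: "continuous_on UNIV C" "continuous_on UNIV H" "continuous_on UNIV C'" "continuous_on UNIV H'"
    unfolding C_def H_def C'_def H'_def
    by (intro continuous_intros continuous_on_compose2[OF continuous_on_ch_sh(1)[of UNIV]]
        continuous_on_compose2[OF continuous_on_ch_sh(2)[of UNIV]] continuous_on_compose2[OF continuous_on_ch_sh(3)[of UNIV]]
        continuous_on_compose2[OF continuous_on_ch_sh(4)[of UNIV]]; simp)+
  have "continuous_on UNIV (\<lambda>s. conj_entry (K s) (D s) m0 n0)"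
    unfolding conj_entry_def K_def D_def e0_def e1_def g0_def
    by (intro continuous_intros cont)
  then have "((\<lambda>s. conj_entry (K s) (D s) m0 n0) \<longlongrightarrow> conj_entry (K 0) (D 0) m0 n0) (at 0)"
    by (simp add: continuous_on_eq_continuous_at isCont_def)
  moreover have "((\<lambda>s. conj_entry (K s) (D s) m0 n0) \<longlongrightarrow> 0) (at 0)"
    by (rule tendsto_eventually) (auto simp: eventually_at scaled intro!: exI[of _ 1])
  ultimately have "conj_entry (K 0) (D 0) m0 n0 = 0"
    using tendsto_unique trivial_limit_at by blast
  \<comment> \<open>To first order only the coefficient \<open>a\<close> of
    \<open>1 / \<lambda>\<close> survives. As \<open>a \<noteq> 0\<close>, it forces equal moduli of
    \<open>m0\<close> and \<open>n0\<close>, against the determinant relation of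
    \<open>S\<close>.\<close>
  moreover have "K 0 = 0" "D 0 = 2 * \<i> * a"
    by (simp_all add: K_def D_def e0_def e1_def g0_def at0 H'_def \<beta>0_def \<beta>1_def algebra_simps)
  ultimately have "2 * \<i> * (m0\<^sup>2 * a + n0\<^sup>2 * cnj a) = 0"
    by (simp add: conj_entry_def algebra_simps)
  then have "m0\<^sup>2 * a = - (n0\<^sup>2 * cnj a)"
    by (simp add: add_eq_0_iff2)
  then have "norm (m0\<^sup>2 * a) = norm (n0\<^sup>2 * cnj a)"
    by simp
  then have "(cmod m0)\<^sup>2 = (cmod n0)\<^sup>2"
    using a by (simp add: norm_mult norm_power)
  then have "m0 * cnj m0 = n0 * cnj n0"
    by (simp only: complex_norm_square[symmetric])
  then show False
    using su11_jet_norm(1)[OF S] by simp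
qed

subsection \<open>Invariance under a helicoidal motion\<close>

lemma deriv_cos_sin: "deriv cos = (\<lambda>z::complex. - sin z)" "deriv sin = (cos :: complex \<Rightarrow> complex)"
  by (auto intro!: ext DERIV_imp_deriv derivative_eq_intros)

lemma deriv_minus_sin: "deriv (\<lambda>z::complex. - sin z) = (\<lambda>z. - cos z)"
  by (auto intro!: ext DERIV_imp_deriv derivative_eq_intros)

lemma ch_sh_trig:
  fixes t L :: complex
  shows "ch (t\<^sup>2 * (- (L\<^sup>2))) = cos (t * L)" "t * sh (t\<^sup>2 * (- (L\<^sup>2))) * L = sin (t * L)"
proof -
  have *: "t\<^sup>2 * (- (L\<^sup>2)) = (\<i> * (t * L))\<^sup>2"
    by (simp add: power_mult_distrib)
  show "ch (t\<^sup>2 * (- (L\<^sup>2))) = cos (t * L)"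
    unfolding * ch_square by (simp add: cosh_conv_cos mult.assoc[symmetric])
  have "\<i> * (t * sh (t\<^sup>2 * (- (L\<^sup>2))) * L) = \<i> * sin (t * L)"
    using sh_square[of "\<i> * (t * L)"] unfolding *
    by (simp add: sinh_conv_sin mult_ac)
  then show "t * sh (t\<^sup>2 * (- (L\<^sup>2))) * L = sin (t * L)"
    by simp
qed

text \<open>The matrix \<open>M\<close> is the exponential of \<open>t\<close> times the traceless matrix with first row \<open>(\<i> e, g)\<close>
  and determinant \<open>Q\<close>, diagonal at \<open>\<lambda> = 1\<close>.\<close>

lemma traceless_exp_jet:
  fixes t l Q1 Q2 :: real and e1 e2 g1 g2 :: complex and e g Q :: "real \<Rightarrow> complex"
  defines "X \<equiv> (\<lambda>s. ch ((of_real t)\<^sup>2 * (- Q s)))" and "Y \<equiv> (\<lambda>s. t * sh ((of_real t)\<^sup>2 * (- Q s)))"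
  assumes l: "l > 0" and e: "jet2 e (of_real l) e1 e2" and g: "jet2 g 0 g1 g2"
    and Q: "jet2 Q ((of_real l)\<^sup>2) (of_real Q1) (of_real Q2)"
    and e_real: "\<And>s. cnj (e s) = e s" and det: "\<And>s. (e s)\<^sup>2 - g s * cnj (g s) = Q s"
    and M: "\<And>s. M (cis s) = mat2 (X s + \<i> * e s * Y s) (g s * Y s) (cnj (g s * Y s)) (cnj (X s + \<i> * e s * Y s))"
  obtains m1 m2 n2 where
    "su11_jet M (cis (t * l)) m1 m2 0 (g1 * sin (t * l) / l) n2"
    "\<i> * (m2 * cnj (cis (t * l)) + m1 * cnj m1 - (g1 * sin (t * l) / l) * cnj (g1 * sin (t * l) / l))
      = of_real (- (t * ((Q2 / 2 - (Q1 / (2 * l))\<^sup>2) / l)) - (cmod g1)\<^sup>2 / l\<^sup>2 * sin (t * l) * cos (t * l))"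
proof -
  \<comment> \<open>The eigenvalues of the traceless matrix are \<open>\<plusminus>\<i> L\<close>.
    Near \<open>s = 0\<close> the value of \<open>Q\<close> is close to the positive number
    \<open>l\<^sup>2\<close>, off the branch cut, so \<open>L\<close> has a 2-jet.\<close>
  define L where "L s = csqrt (Q s)" for s
  have LQ: "L s * L s = Q s" for s
    by (simp add: L_def flip: power2_eq_square)
  have "(of_real l)\<^sup>2 = complex_of_real (l\<^sup>2)" by simp
  then have L0: "csqrt ((of_real l)\<^sup>2) = of_real l"
    using l by (simp add: csqrt_square)
  have "(of_real l)\<^sup>2 \<in> - (\<real>\<^sub>\<le>\<^sub>0 :: complex set)"
    using l by (simp add: complex_nonpos_Reals_iff flip: of_real_power)
  then obtain l1 l2 where L: "jet2 L (of_real l) l1 l2"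
    using jet2_holomorphic[OF Q, of csqrt "- \<real>\<^sub>\<le>\<^sub>0"] L0
    unfolding L_def[abs_def] by (metis holomorphic_on_csqrt open_Compl closed_nonpos_Reals_complex)
  have l_ne: "complex_of_real l \<noteq> 0" using l by simp
  \<comment> \<open>The jet of the root comes from \<open>L * L = Q\<close> by comparison, without
    derivatives of \<open>csqrt\<close>; its second derivative becomes the pitch term.\<close>
  have l12: "2 * l * l1 = of_real Q1" "2 * (l1 * l1) + 2 * l * l2 = of_real Q2"
    using jet2_unique(2,3)[OF jet2_mult[OF L L, unfolded LQ] Q] by (simp_all add: algebra_simps)
  have l1: "l1 = of_real (Q1 / (2 * l))"
    using l12(1) l_ne by (simp add: field_simps)
  have l2: "l2 = of_real ((Q2 / 2 - (Q1 / (2 * l))\<^sup>2) / l)"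
  proof -
    have "2 * l * l2 = of_real (Q2 - 2 * (Q1 / (2 * l))\<^sup>2)"
      using l12(2) unfolding l1 by (simp add: power2_eq_square algebra_simps)
    then show ?thesis
      using l_ne by (simp add: field_simps)
  qed
  define T where "T = complex_of_real (t * l)"
  have tL: "jet2 (\<lambda>s. t * L s) T (t * l1) (t * l2)"
    using jet2_cmult[OF L, of "of_real t"] by (simp add: T_def)
  define c1 where "c1 = - (t * l1 * sin T)"
  define c2 where "c2 = - (t * l1 * (t * l1) * cos T) - t * l2 * sin T"
  define s1 where "s1 = t * l1 * cos T"
  define s2 where "s2 = t * l2 * cos T - t * l1 * (t * l1) * sin T"
  have cosj: "jet2 (\<lambda>s. cos (t * L s)) (cos T) c1 c2"
    using jet2_holomorphic[OF tL holomorphic_on_cos open_UNIV]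
    unfolding deriv_cos_sin deriv_minus_sin by (simp add: c1_def c2_def mult.assoc)
  have sinj: "jet2 (\<lambda>s. sin (t * L s)) (sin T) s1 s2"
    using jet2_holomorphic[OF tL holomorphic_on_sin open_UNIV]
    unfolding deriv_cos_sin by (simp add: s1_def s2_def algebra_simps)
  have X_eq: "X s = cos (t * L s)" and Y_eq: "Y s * L s = sin (t * L s)" for s
    using ch_sh_trig[of "of_real t" "L s"] unfolding X_def Y_def power2_eq_square[of "L s"] LQ by simp_all
  have X: "jet2 X (cos T) c1 c2"
    using cosj unfolding X_eq[symmetric] .
  obtain y0 y1 y2 where Y: "jet2 Y y0 y1 y2"
    using jet2_cmult[OF jet2_holomorphic[OF jet2_cmult[OF jet2_minus[OF Q]] holomorphic_sh open_UNIV UNIV_I], of "of_real t" "(of_real t)\<^sup>2"]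
    unfolding Y_def by blast
  \<comment> \<open>Likewise \<open>Y * L = sin (t * L)\<close> determines the jet of
    \<open>Y\<close> without derivatives of \<open>sh\<close>.\<close>
  have y: "y0 * l = sin T" "y0 * l1 + y1 * l = s1" "y0 * l2 + 2 * (y1 * l1) + y2 * l = s2"
    using jet2_unique[OF jet2_mult[OF Y L, unfolded Y_eq] sinj] .
  \<comment> \<open>Since \<open>g\<close> vanishes at \<open>s = 0\<close>, the determinant
    relation makes \<open>e\<close> agree with \<open>L\<close> to first order, and to second order
    up to the contribution of \<open>g1\<close>.\<close>
  note det_jet = jet2_unique[OF jet2_diff[OF jet2_mult[OF e e] jet2_mult[OF g jet2_cnj[OF g]],
     folded power2_eq_square[of "e _"], unfolded det] Q]
  have "2 * complex_of_real l * e1 = 2 * l * l1"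
    using det_jet(2) l12(1) by (simp add: algebra_simps)
  then have e1: "e1 = l1"
    using l_ne by simp
  have e2: "l * e2 = l * l2 + g1 * cnj g1"
  proof -
    have "2 * (l * e2) = 2 * (l * l2 + g1 * cnj g1)"
      using det_jet(3) unfolding e1 l12(2)[symmetric] by (simp add: algebra_simps)
    then show ?thesis by (simp only: mult_cancel_left) simp
  qed
  have cT: "cos T = of_real (cos (t * l))" "sin T = of_real (sin (t * l))"
    by (simp_all only: T_def cos_of_real sin_of_real)
  have y0: "y0 = sin (t * l) / l"
    using y(1) l_ne unfolding cT by (simp add: nonzero_eq_divide_eq)
  have m0: "cos T + \<i> * (of_real l * y0) = cis (t * l)"
    using l_ne by (simp add: cT y0 complex_eq_iff)
  define m1 where "m1 = c1 + \<i> * s1"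
  define m2 where "m2 = c2 + \<i> * s2 + \<i> * ((g1 * cnj g1) / l * y0)"
  have e2': "e2 = l2 + (g1 * cnj g1) / l"
    using e2 l_ne by (simp add: field_simps)
  have mj: "jet2 (\<lambda>s. X s + \<i> * (e s * Y s)) (cis (t * l)) m1 m2"
  proof -
    have "c1 + \<i> * (of_real l * y1 + e1 * y0) = m1"
      unfolding m1_def e1 y(2)[symmetric] by (simp add: mult.commute)
    moreover have "c2 + \<i> * (of_real l * y2 + 2 * (e1 * y1) + e2 * y0) = m2"
      unfolding m2_def e1 e2' y(3)[symmetric] by (simp add: algebra_simps)
    ultimately show ?thesis
      using jet2_add[OF X jet2_cmult[OF jet2_mult[OF e Y], of \<i>]] m0 by simp
  qed
  have "0 * y1 + g1 * y0 = g1 * sin (t * l) / l"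
    by (simp add: y0)
  then obtain n2 where nj: "jet2 (\<lambda>s. g s * Y s) 0 (g1 * sin (t * l) / l) n2"
    using jet2_mult[OF g Y] by (metis mult_zero_left)
  have Q_real: "cnj (Q s) = Q s" for s
    unfolding det[symmetric] by (simp add: e_real)
  have XY_real: "cnj (X s) = X s" "cnj (Y s) = Y s" for s
    by (simp_all add: X_def Y_def cnj_ch cnj_sh Q_real)
  have norm: "(X s + \<i> * (e s * Y s)) * cnj (X s + \<i> * (e s * Y s)) - (g s * Y s) * cnj (g s * Y s) = 1" for s
  proof -
    have "(X s + \<i> * (e s * Y s)) * cnj (X s + \<i> * (e s * Y s)) - (g s * Y s) * cnj (g s * Y s)
       = (X s)\<^sup>2 - (- ((e s)\<^sup>2 - g s * cnj (g s))) * (Y s)\<^sup>2"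
      by (simp add: XY_real e_real power2_eq_square algebra_simps)
    then show ?thesis
      unfolding det X_def Y_def ch_sh_pythagoras .
  qed
  have jet: "su11_jet M (cis (t * l)) m1 m2 0 (g1 * sin (t * l) / l) n2"
    unfolding su11_jet_def
    by (rule exI, rule exI, rule conjI[OF mj], rule conjI[OF nj])
       (rule always_eventually, rule allI, rule conjI[OF _ norm], simp only: M mult.assoc)
  \<comment> \<open>The second-order determinant relation, whose outer \<open>n\<close> terms vanish
    because \<open>n0 = 0\<close>, trades the first-order terms for the imaginary part of
    \<open>m2 * cnj m0\<close>.\<close>
  have "\<i> * (m2 * cnj (cis (t * l)) + m1 * cnj m1 - (g1 * sin (t * l) / l) * cnj (g1 * sin (t * l) / l))
     = \<i> * (m2 * cnj (cis (t * l)) - cis (t * l) * cnj m2) / 2"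
  proof -
    have "\<i> * (x + y - z) = \<i> * (x - x') / 2" if "x + 2 * y + x' - (u + 2 * z + v) = 0" "u = 0" "v = 0"
      for x x' y z u v :: complex
    proof -
      have "x' = 2 * z - x - 2 * y"
        using that by (simp add: algebra_simps add_eq_0_iff)
      show ?thesis unfolding \<open>x' = _\<close> by (simp add: field_simps)
    qed
    from this[OF su11_jet_norm(3)[OF jet]] show ?thesis
      by simp
  qed
  also have "\<dots> = of_real (- Im (m2 * cnj (cis (t * l))))"
    by (simp add: complex_eq_iff)
  also have "Im (m2 * cnj (cis (t * l))) = t * ((Q2 / 2 - (Q1 / (2 * l))\<^sup>2) / l) + (cmod g1)\<^sup>2 / l\<^sup>2 * sin (t * l) * cos (t * l)"
  proof -
    define \<kappa> where "\<kappa> = (Q2 / 2 - (Q1 / (2 * l))\<^sup>2) / l"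
    define \<nu> where "\<nu> = Q1 / (2 * l)"
    have gg: "g1 * cnj g1 = of_real ((cmod g1)\<^sup>2)"
      by (simp add: complex_norm_square[symmetric])
    define A where "A = - ((t * \<nu>)\<^sup>2 * cos (t * l)) - t * \<kappa> * sin (t * l)"
    define B where "B = t * \<kappa> * cos (t * l) - (t * \<nu>)\<^sup>2 * sin (t * l) + (cmod g1)\<^sup>2 / l\<^sup>2 * sin (t * l)"
    have m2: "m2 = of_real A + \<i> * of_real B"
      unfolding A_def B_def m2_def c2_def s2_def cT gg y0 l1[folded \<nu>_def] l2[folded \<kappa>_def]
      by (simp add: power2_eq_square algebra_simps)
    \<comment> \<open>The terms with \<open>\<nu>\<close> cancel, and the terms with
      \<open>\<kappa>\<close> combine to the part linear in \<open>t\<close>, which is the drift of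
      the helicoidal motion.\<close>
    have "Im (m2 * cnj (cis (t * l))) = B * cos (t * l) - A * sin (t * l)"
      unfolding m2 by simp
    also have "\<dots> = t * \<kappa> * ((sin (t * l))\<^sup>2 + (cos (t * l))\<^sup>2) + (cmod g1)\<^sup>2 / l\<^sup>2 * sin (t * l) * cos (t * l)"
      unfolding A_def B_def
      by (simp add: power2_eq_square algebra_simps
          del: sin_cos_squared_add sin_cos_squared_add2 sin_cos_squared_add3)
    finally show ?thesis
      unfolding sin_cos_squared_add by (simp add: \<kappa>_def)
  qed
  finally have "\<i> * (m2 * cnj (cis (t * l)) + m1 * cnj m1 - (g1 * sin (t * l) / l) * cnj (g1 * sin (t * l) / l))
      = of_real (- (t * ((Q2 / 2 - (Q1 / (2 * l))\<^sup>2) / l)) - (cmod g1)\<^sup>2 / l\<^sup>2 * sin (t * l) * cos (t * l))"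
    by simp
  with jet show thesis by (rule that)
qed

section \<open>Helicoidal motions of Nil_3 in complex notation\<close>

lemma iso_act_helical:
  fixes \<alpha> :: complex and cc s x1 x2 x3 :: real
  defines "p \<equiv> \<alpha> * (1 - cis s)" and "q \<equiv> cis s * Complex x1 x2"
  shows "iso_act (helical \<alpha> cc s) (x1, x2, x3)
    = (Re (q + p), Im (q + p), cc * s - (cmod \<alpha>)\<^sup>2 / 2 * sin s + x3 + Im (cnj p * q) / 2)"
proof -
  \<comment> \<open>The area term of the group law is half the imaginary part of
    \<open>cnj p * q\<close>.\<close>
  have "nil_mult (Re p, Im p, h) (Re q, Im q, x3) = (Re (q + p), Im (q + p), h + x3 + Im (cnj p * q) / 2)" for h
    by (simp add: nil_mult_def)
  moreover have "Re (cis s) * x1 - Im (cis s) * x2 = Re q" "Im (cis s) * x1 + Re (cis s) * x2 = Im q"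
    by (simp_all add: q_def)
  ultimately show ?thesis
    by (simp only: iso_act_def helical_def prod.case p_def)
qed

text \<open>The premises have the shape produced by \<open>sym_transform\<close>. A diagonal entry
  \<open>cis \<eta>\<close> acts by its square, which is why the motion has parameter
  \<open>2 * \<eta>\<close>.\<close>

lemma iso_act_helical_eqI:
  fixes h \<alpha> :: complex and c \<eta> :: real
  assumes "Complex (fst y) (fst (snd y)) = (cis \<eta>)\<^sup>2 * X + 2 * \<i> * (cis \<eta> * (- \<alpha> * sin \<eta>))"
    and "X = Complex (fst x) (fst (snd x))"
    and "complex_of_real (snd (snd y)) = of_real (snd (snd x)) - of_real (Re (cnj (- \<alpha> * sin \<eta>) * cis \<eta> * X))
          + of_real (c * (2 * \<eta>) - (cmod \<alpha>)\<^sup>2 * sin \<eta> * cos \<eta>)"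
  shows "y = iso_act (helical \<alpha> c (2 * \<eta>)) x"
proof -
  have cs: "cos (2 * \<eta>) = 1 - 2 * (sin \<eta> * sin \<eta>)" "sin (2 * \<eta>) = 2 * (sin \<eta> * cos \<eta>)"
    and cs': "cos (\<eta> * 2) = 1 - 2 * (sin \<eta> * sin \<eta>)" "sin (\<eta> * 2) = 2 * (sin \<eta> * cos \<eta>)"
    and cc: "cos \<eta> * cos \<eta> = 1 - sin \<eta> * sin \<eta>"
    using cos_double_sin[of \<eta>] sin_double[of \<eta>] sin_cos_squared_add[of \<eta>] by (simp_all add: power2_eq_square mult.commute[of \<eta> 2])
  obtain x1 x2 x3 where x: "x = (x1, x2, x3)" by (cases x)
  obtain y1 y2 y3 where y: "y = (y1, y2, y3)" by (cases y)
  have y3: "y3 = x3 - Re (cnj (- \<alpha> * sin \<eta>) * cis \<eta> * X) + (c * (2 * \<eta>) - (cmod \<alpha>)\<^sup>2 * sin \<eta> * cos \<eta>)"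
    using assms(3) unfolding x y snd_conv of_real_add[symmetric] of_real_diff[symmetric] of_real_eq_iff .
  \<comment> \<open>The half-angle identity turns the translation part of
    \<open>sym_transform\<close> into \<open>\<alpha> * (1 - cis (2 * \<eta>))\<close>.\<close>
  have half: "(cis \<eta>)\<^sup>2 = cis (2 * \<eta>)" "\<i> * (cis \<eta> * sin \<eta>) * 2 = cis (2 * \<eta>) - 1"
    by (simp_all add: complex_eq_iff cs cs' power2_eq_square algebra_simps cc)
  have "Complex y1 y2 = (cis \<eta>)\<^sup>2 * X + - \<alpha> * (\<i> * (cis \<eta> * sin \<eta>) * 2)"
    using assms(1) unfolding y by simp
  then have y12: "Complex y1 y2 = cis (2 * \<eta>) * X + \<alpha> * (1 - cis (2 * \<eta>))"
    unfolding half by (simp only: minus_mult_commute minus_diff_eq)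
  then have y1_y2: "y1 = Re (cis (2 * \<eta>) * X + \<alpha> * (1 - cis (2 * \<eta>)))" "y2 = Im (cis (2 * \<eta>) * X + \<alpha> * (1 - cis (2 * \<eta>)))"
    by (simp_all only: complex.sel flip: y12)
  have X: "X = Complex x1 x2"
    using assms(2) x by simp
  have "- Re (cnj (- \<alpha> * sin \<eta>) * cis \<eta> * X)
      = Im (cnj (\<alpha> * (1 - cis (2 * \<eta>))) * (cis (2 * \<eta>) * X)) / 2"
  proof -
    have "cnj (1 - cis (2 * \<eta>)) * cis (2 * \<eta>) = 2 * \<i> * sin \<eta> * cis \<eta>"
      using half(2) by (simp add: left_diff_distrib right_diff_distrib cis_cnj cis_mult mult_ac)
    then have "cnj (\<alpha> * (1 - cis (2 * \<eta>))) * (cis (2 * \<eta>) * X) = 2 * \<i> * (sin \<eta> * (cnj \<alpha> * cis \<eta> * X))"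
      by (simp add: mult_ac)
    then show ?thesis
      by (simp add: algebra_simps)
  qed
  moreover have "(cmod \<alpha>)\<^sup>2 * sin \<eta> * cos \<eta> = (cmod \<alpha>)\<^sup>2 / 2 * sin (2 * \<eta>)"
    by (simp add: cs)
  ultimately show ?thesis
    unfolding x y y3 iso_act_helical prod.inject X[symmetric] y1_y2 by (intro conjI refl) linarith
qed

text \<open>The frame at \<open>z + t\<close> is \<open>S exp (t D)\<close> times the unitary factor
  at \<open>z\<close>, hence \<open>M\<close> times the whole frame at \<open>z\<close>; as
  \<open>M\<close> is diagonal at \<open>\<lambda> = 1\<close>, \<open>sym_transform\<close>
  applies.\<close>

lemma invariant_underI:
  fixes S :: "complex \<Rightarrow> cmat" and \<alpha> :: complex and l cc :: real
  assumes S: "su11_jet S r0 r1 r2 u0 u1 u2"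
    and M: "\<And>t::real. \<exists>M m1 m2 n2. (\<forall>w\<in>circle. S w ** pot_exp a b c (of_real t) w = M w ** S w) \<and>
       su11_jet M (cis (t * l)) m1 m2 0 (- \<alpha> * sin (t * l)) n2 \<and>
       \<i> * (m2 * cnj (cis (t * l)) + m1 * cnj m1 - (- \<alpha> * sin (t * l)) * cnj (- \<alpha> * sin (t * l)))
       = of_real (cc * (2 * (t * l)) - (cmod \<alpha>)\<^sup>2 * sin (t * l) * cos (t * l))"
  shows "invariant_under (deg1_pot a b c) S (\<lambda>t. helical \<alpha> cc (2 * l * t))"
  unfolding invariant_under_def
proof (intro allI impI)
  fix z :: complex and t :: real and x y
  assume "surface_point (deg1_pot a b c) S z x" "surface_point (deg1_pot a b c) S (z + of_real t) y"
  then obtain F V F' V' where F: "iwasawa (pot_exp a b c z) F V"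
    and x: "hatf (\<lambda>w. S w ** F w) 1 = fst x *\<^sub>R E1 + fst (snd x) *\<^sub>R E2 + snd (snd x) *\<^sub>R E3"
    and F': "iwasawa (pot_exp a b c (z + of_real t)) F' V'"
    and y: "hatf (\<lambda>w. S w ** F' w) 1 = fst y *\<^sub>R E1 + fst (snd y) *\<^sub>R E2 + snd (snd y) *\<^sub>R E3"
    unfolding surface_point_def by blast
  obtain M m1 m2 n2 where M: "\<And>w. w \<in> circle \<Longrightarrow> S w ** pot_exp a b c (of_real t) w = M w ** S w"
    and Mj: "su11_jet M (cis (t * l)) m1 m2 0 (- \<alpha> * sin (t * l)) n2"
    and Mz: "\<i> * (m2 * cnj (cis (t * l)) + m1 * cnj m1 - (- \<alpha> * sin (t * l)) * cnj (- \<alpha> * sin (t * l)))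
       = of_real (cc * (2 * (t * l)) - (cmod \<alpha>)\<^sup>2 * sin (t * l) * cos (t * l))"
    using M[of t] by blast
  obtain p0 p1 p2 q0 q1 q2 where "su11_jet F p0 p1 p2 q0 q1 q2"
    using iwasawa_su11_jet[OF F] .
  from su11_jet_mult[OF S this, of "\<lambda>w. S w ** F w", OF refl]
  obtain g0 g1 g2 h0 h1 h2 where G: "su11_jet (\<lambda>w. S w ** F w) g0 g1 g2 h0 h1 h2"
    by blast
  have "S w ** F' w = M w ** (S w ** F w)" if "w \<in> circle" for w
    using iwasawa_translate[OF F F' that] M[OF that] by (simp add: matrix_mul_assoc)
  from sym_transform[OF Mj G this]
  obtain P0 P1 P2 Q0 Q1 Q2 where G': "su11_jet (\<lambda>w. S w ** F' w) P0 P1 P2 Q0 Q1 Q2"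
    "sym_x P0 P1 Q0 Q1 = (cis (t * l))\<^sup>2 * sym_x g0 g1 h0 h1 + 2 * \<i> * (cis (t * l) * (- \<alpha> * sin (t * l)))"
    "sym_z P0 P1 P2 Q0 Q1 Q2 = sym_z g0 g1 g2 h0 h1 h2
      - of_real (Re (cnj (- \<alpha> * sin (t * l)) * cis (t * l) * sym_x g0 g1 h0 h1))
      + \<i> * (m2 * cnj (cis (t * l)) + m1 * cnj m1 - (- \<alpha> * sin (t * l)) * cnj (- \<alpha> * sin (t * l)))"
    by blast
  have "y = iso_act (helical \<alpha> cc (2 * (t * l))) x"
    using x y G'(2,3) unfolding hatf_eq_iff[OF G] hatf_eq_iff[OF G'(1)] Mz
    by (intro iso_act_helical_eqI[where X = "sym_x g0 g1 h0 h1"]) simp_all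
  then show "y = iso_act (helical \<alpha> cc (2 * l * t)) x"
    by (simp add: mult_ac)
qed

text \<open>Apart from the drift \<open>cc * s\<close>, the change of height is periodic in
  \<open>s\<close>: the modulus of \<open>1 - cis s\<close> is at most 2 and rotation preserves the
  modulus.\<close>

lemma iso_act_helical_vertical_bound:
  "\<bar>snd (snd (iso_act (helical \<alpha> cc s) x)) - cc * s - snd (snd x)\<bar>
     \<le> (cmod \<alpha>)\<^sup>2 / 2 + cmod \<alpha> * cmod (Complex (fst x) (fst (snd x)))"
proof -
  obtain x1 x2 x3 where x: "x = (x1, x2, x3)" by (cases x)
  let ?p = "\<alpha> * (1 - cis s)" and ?q = "cis s * Complex x1 x2"
  have "\<bar>Im (cnj ?p * ?q)\<bar> \<le> cmod ?p * cmod ?q"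
    by (metis abs_Im_le_cmod norm_mult complex_mod_cnj)
  also have "\<dots> \<le> cmod \<alpha> * 2 * cmod (Complex x1 x2)"
    using norm_triangle_ineq4[of 1 "cis s"]
    by (auto simp: norm_mult intro!: mult_right_mono mult_left_mono)
  finally have 1: "\<bar>Im (cnj ?p * ?q) / 2\<bar> \<le> cmod \<alpha> * cmod (Complex x1 x2)"
    by simp
  have "\<bar>(cmod \<alpha>)\<^sup>2 / 2 * sin s\<bar> \<le> (cmod \<alpha>)\<^sup>2 / 2 * 1"
    unfolding abs_mult by (intro mult_mono) auto
  then show ?thesis
    using 1 unfolding x iso_act_helical fst_conv snd_conv by linarith
qed

text \<open>Both motions describe the height along the real axis from one base point; it is bounded
  by the second and has drift \<open>cc * \<omega> * t\<close> by the first.\<close>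

lemma pitch_zero_unique:
  fixes c cc \<omega> \<omega>' :: real
  assumes S: "su11_jet S m0 m1 m2 n0 n1 n2"
    and "invariant_under (deg1_pot a b c) S (\<lambda>t. helical \<alpha> cc (\<omega> * t))"
    and "invariant_under (deg1_pot a b c) S (\<lambda>t. helical \<alpha>' 0 (\<omega>' * t))"
  shows "cc * \<omega> = 0"
proof (rule ccontr)
  assume "cc * \<omega> \<noteq> 0"
  have axis: "\<exists>x. surface_point (deg1_pot a b c) S (of_real t) x" for t
    by (rule surface_point_real_axis[OF S, where a = a and b = b and c = c and t = t]) (rule exI)
  obtain x where x: "surface_point (deg1_pot a b c) S (of_real 0) x"
    using axis ..
  define B where "B \<alpha> = (cmod \<alpha>)\<^sup>2 / 2 + cmod \<alpha> * cmod (Complex (fst x) (fst (snd x)))" for \<alpha>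
  have le: "\<bar>cc * (\<omega> * t)\<bar> \<le> B \<alpha> + B \<alpha>'" for t
  proof -
    obtain y where "surface_point (deg1_pot a b c) S (of_real t) y"
      using axis ..
    then have "surface_point (deg1_pot a b c) S (of_real 0 + of_real t) y"
      by simp
    then have "y = iso_act (helical \<alpha> cc (\<omega> * t)) x" "y = iso_act (helical \<alpha>' 0 (\<omega>' * t)) x"
      using assms(2,3) x unfolding invariant_under_def by blast+
    then show ?thesis
      using iso_act_helical_vertical_bound[of \<alpha> cc "\<omega> * t" x]
        iso_act_helical_vertical_bound[of \<alpha>' 0 "\<omega>' * t" x] unfolding B_def by simp
  qed
  \<comment> \<open>The parameter is chosen so that the drift exceeds the bound by one.\<close>
  have "cc * (\<omega> * ((B \<alpha> + B \<alpha>' + 1) / (cc * \<omega>))) = B \<alpha> + B \<alpha>' + 1"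
    using \<open>cc * \<omega> \<noteq> 0\<close> by simp
  with le[of "(B \<alpha> + B \<alpha>' + 1) / (cc * \<omega>)"] show False
    by linarith
qed

text \<open>The columns \<open>(x, cnj y)\<close> and \<open>(y, cnj x)\<close> are the eigenvectors
  of \<open>D(1)\<close> and \<open>S\<close> is the loop built from them. The intertwiner is
  \<open>exp (t S D S^-1)\<close>, to which \<open>traceless_exp_jet\<close> applies;
  \<open>g1\<close> is the angular derivative of the upper off-diagonal entry of
  \<open>S D S^-1\<close>.\<close>

lemma diagonalized_potential_invariant:
  fixes b x y :: complex and l :: real
  defines "g1 \<equiv> - 4 * cnj x * y + \<i> * (cnj b - 1) * (cnj x)\<^sup>2 - \<i> * (3 + b) * y\<^sup>2"
  assumes l: "l > 0" and l_sq: "l\<^sup>2 = 3 - 2 * Re b - (cmod b)\<^sup>2"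
    and eigen: "(1 + b) * y = \<i> * (2 - of_real l) * cnj x" "(1 + b) * x = \<i> * (2 + of_real l) * cnj y"
    and norm: "x * cnj x - y * cnj y = 1"
    and S: "\<And>w. w \<in> circle \<Longrightarrow> S w = mat2 (cnj x) (- (w * y)) (- cnj (w * y)) x"
  shows "\<exists>r0 r1 r2 u0 u1 u2. su11_jet S r0 r1 r2 u0 u1 u2"
    and "invariant_under (deg1_pot 1 b 2) S
      (\<lambda>t. helical (- g1 / l) (- 2 * (Re b * l\<^sup>2 - (Im b)\<^sup>2) / l ^ 4) (2 * l * t))"
proof -
  \<comment> \<open>Multiplying the eigenvector equations crosswise fixes the ratio of the squared
    moduli of \<open>x\<close> and \<open>y\<close>; \<open>norm\<close> then fixes both.\<close>
  have xx: "x * cnj x * l = of_real (2 + l) / 2" and yy: "y * cnj y * l = of_real (2 - l) / 2"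
  proof -
    have "(2 + of_real l) * (y * cnj y) = (2 - of_real l) * (x * cnj x)"
    proof -
      have "\<i> * ((2 + of_real l) * (y * cnj y)) = (1 + b) * x * y"
        unfolding eigen(2) by simp
      also have "\<dots> = (1 + b) * y * x"
        by simp
      also have "\<dots> = \<i> * ((2 - of_real l) * (x * cnj x))"
        unfolding eigen(1) by simp
      finally show ?thesis
        by (simp only: mult_cancel_left) simp
    qed
    moreover have y: "y * cnj y = x * cnj x - 1"
      using norm by (simp add: algebra_simps)
    ultimately have "2 * (x * cnj x * l) = 2 + of_real l"
      by (simp add: algebra_simps)
    then show "x * cnj x * l = of_real (2 + l) / 2"
      by (simp add: field_simps)
    then show "y * cnj y * l = of_real (2 - l) / 2"
      unfolding y left_diff_distrib by (simp add: field_simps)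
  qed
  have eigen': "(1 + cnj b) * cnj y = - \<i> * (2 - of_real l) * x" "(1 + cnj b) * cnj x = - \<i> * (2 + of_real l) * y"
    using arg_cong[OF eigen(1), of cnj] arg_cong[OF eigen(2), of cnj] by simp_all

  define \<beta> where "\<beta> w = cnj w + w * cnj b" for w
  define u where "u w = w * y" for w
  \<comment> \<open>\<open>\<i> * e w\<close> and \<open>g w\<close> form the first row of
    \<open>S D S^-1\<close>, whose determinant is \<open>Q w\<close>.\<close>
  define e where "e w = 2 * (x * cnj x + u w * cnj (u w)) - \<i> * (\<beta> w * (cnj x * cnj (u w))) + \<i> * (u w * (cnj (\<beta> w) * x))" for w
  define g where "g w = 4 * \<i> * cnj x * u w + (cnj x)\<^sup>2 * \<beta> w - u w * (u w * cnj (\<beta> w))" for w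
  define Q where "Q w = 4 - \<beta> w * cnj (\<beta> w)" for w
  have u_norm: "x * cnj x - u w * cnj (u w) = 1" if "w \<in> circle" for w
  proof -
    have "w * cnj w = 1"
      using that by (auto simp: circle_cis cis_cnj cis_mult)
    have "u w * cnj (u w) = (w * cnj w) * (y * cnj y)"
      by (simp add: u_def)
    with \<open>w * cnj w = 1\<close> norm show ?thesis by simp
  qed
  have cis_circle: "cis s \<in> circle" for s
    by (simp add: circle_cis)
  have det: "(e (cis s))\<^sup>2 - g (cis s) * cnj (g (cis s)) = Q (cis s)" for s
  proof -
    have "(e w)\<^sup>2 - g w * cnj (g w) = (x * cnj x - u w * cnj (u w))\<^sup>2 * (4 - \<beta> w * cnj (\<beta> w))" for w
      unfolding e_def g_def by (simp add: power2_eq_square algebra_simps)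
    then show ?thesis
      by (simp add: u_norm[OF cis_circle] Q_def)
  qed
  have e_real: "cnj (e w) = e w" for w
    by (simp add: e_def algebra_simps)

  have \<beta>j: "jet2 (\<lambda>s. \<beta> (cis s)) (1 + cnj b) (\<i> * (cnj b - 1)) (- 1 - cnj b)"
    using jet2_pot_beta[of 1 b] by (simp add: \<beta>_def cis_cnj)
  have uj: "jet2 (\<lambda>s. u (cis s)) (y * 1) (y * \<i>) (y * - 1)"
    using jet2_cmult[OF jet2_cis, of y] by (simp add: u_def mult.commute)
  have "\<exists>e0 e1 e2. jet2 (\<lambda>s. e (cis s)) e0 e1 e2"
    unfolding e_def
    by (rule exI, rule exI, rule exI)
       (rule jet2_add jet2_diff jet2_cmult jet2_mult \<beta>j uj jet2_const jet2_cnj)+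
  then obtain e0 e1 e2 where ej: "jet2 (\<lambda>s. e (cis s)) e0 e1 e2"
    by blast
  have "e0 = of_real l"
  proof -
    have "e0 = e 1"
      using ej by (simp add: jet2_def)
    also have "\<dots> = 2 * (x * cnj x + y * cnj y) - \<i> * (((1 + cnj b) * cnj y) * cnj x) + \<i> * (((1 + b) * y) * x)"
      by (simp add: e_def u_def \<beta>_def mult_ac)
    also have "\<dots> = 2 * (y * cnj y) - 2 * (x * cnj x) + 2 * (x * cnj x * l)"
      unfolding eigen(1) eigen'(1) by (simp add: algebra_simps)
    also have "\<dots> = 2 * (x * cnj x * l) - 2 * (x * cnj x - y * cnj y)"
      by simp
    also have "\<dots> = of_real l"
      unfolding xx norm by (simp add: add_divide_distrib)
    finally show ?thesis .
  qed
  \<comment> \<open>The value of \<open>g\<close> at \<open>\<lambda> = 1\<close> is zero because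
    \<open>S\<close> diagonalizes \<open>D(1)\<close>.\<close>
  have "\<exists>g2. jet2 (\<lambda>s. g (cis s)) 0 g1 g2"
  proof -
    have "4 * \<i> * cnj x * (y * 1) + (cnj x)\<^sup>2 * (1 + cnj b) - y * 1 * (y * 1 * cnj (1 + cnj b)) = 0"
    proof -
      have "4 * \<i> * cnj x * (y * 1) + (cnj x)\<^sup>2 * (1 + cnj b) - y * 1 * (y * 1 * cnj (1 + cnj b))
          = 4 * \<i> * cnj x * y + cnj x * ((1 + cnj b) * cnj x) - y * ((1 + b) * y)"
        by (simp add: power2_eq_square mult_ac)
      also have "\<dots> = 0"
        unfolding eigen(1) eigen'(2) by (simp add: algebra_simps)
      finally show ?thesis .
    qed
    moreover have "4 * \<i> * cnj x * (y * \<i>) + (cnj x)\<^sup>2 * (\<i> * (cnj b - 1))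
       - (y * 1 * (y * 1 * cnj (\<i> * (cnj b - 1)) + y * \<i> * cnj (1 + cnj b)) + y * \<i> * (y * 1 * cnj (1 + cnj b))) = g1"
      by (simp add: g1_def power2_eq_square algebra_simps)
    ultimately show ?thesis
      using jet2_diff[OF jet2_add[OF jet2_cmult[OF uj] jet2_cmult[OF \<beta>j]] jet2_mult[OF uj jet2_mult[OF uj jet2_cnj[OF \<beta>j]]],
         of "4 * \<i> * cnj x" "(cnj x)\<^sup>2"]
      unfolding g_def by auto
  qed
  then obtain g2 where gj: "jet2 (\<lambda>s. g (cis s)) 0 g1 g2"
    by blast
  \<comment> \<open>The derivatives of \<open>det D\<close> along the circle, the only data of the
    potential that enter the pitch.\<close>
  have Qj: "jet2 (\<lambda>s. Q (cis s)) ((of_real l)\<^sup>2) (of_real (- 4 * Im b)) (of_real (8 * Re b))"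
  proof -
    have "4 - (1 + cnj b) * cnj (1 + cnj b) = (of_real l)\<^sup>2"
      unfolding of_real_power[symmetric] l_sq cmod_power2 by (simp add: complex_eq_iff power2_eq_square algebra_simps)
    moreover have "0 - ((1 + cnj b) * cnj (\<i> * (cnj b - 1)) + \<i> * (cnj b - 1) * cnj (1 + cnj b)) = of_real (- 4 * Im b)"
      by (simp add: complex_eq_iff algebra_simps)
    moreover have "0 - ((1 + cnj b) * cnj (- 1 - cnj b) + 2 * (\<i> * (cnj b - 1) * cnj (\<i> * (cnj b - 1)))
        + (- 1 - cnj b) * cnj (1 + cnj b)) = of_real (8 * Re b)"
      by (simp add: complex_eq_iff algebra_simps)
    ultimately show ?thesis
      using jet2_diff[OF jet2_const[of 4] jet2_mult[OF \<beta>j jet2_cnj[OF \<beta>j]]] unfolding Q_def by (simp only:)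
  qed

  have "su11_jet S (cnj x) 0 0 (- (y * 1)) (- (y * \<i>)) (- (y * - 1))"
    unfolding su11_jet_def
  proof (intro exI conjI always_eventually allI)
    show "S (cis s) = mat2 (cnj x) (- u (cis s)) (cnj (- u (cis s))) (cnj (cnj x))" for s
      by (simp add: S[OF cis_circle] u_def)
    show "cnj x * cnj (cnj x) - (- u (cis s)) * cnj (- u (cis s)) = 1" for s
      using u_norm[OF cis_circle] by (simp add: mult.commute)
  qed (rule jet2_const, rule jet2_minus[OF uj])
  note Sj = this
  then show "\<exists>r0 r1 r2 u0 u1 u2. su11_jet S r0 r1 r2 u0 u1 u2"
    by blast
  show "invariant_under (deg1_pot 1 b 2) S
      (\<lambda>t. helical (- g1 / l) (- 2 * (Re b * l\<^sup>2 - (Im b)\<^sup>2) / l ^ 4) (2 * l * t))"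
  proof (rule invariant_underI[OF Sj])
    fix t :: real
    define X where "X w = ch ((of_real t)\<^sup>2 * (- Q w))" for w
    define Y where "Y w = t * sh ((of_real t)\<^sup>2 * (- Q w))" for w
    define m where "m w = X w + \<i> * e w * Y w" for w
    define M where "M w = mat2 (m w) (g w * Y w) (cnj (g w * Y w)) (cnj (m w))" for w
    have M_cis: "M (cis s) = mat2 (ch ((of_real t)\<^sup>2 * (- Q (cis s))) + \<i> * e (cis s) * (t * sh ((of_real t)\<^sup>2 * (- Q (cis s)))))
         (g (cis s) * (t * sh ((of_real t)\<^sup>2 * (- Q (cis s)))))
         (cnj (g (cis s) * (t * sh ((of_real t)\<^sup>2 * (- Q (cis s))))))
         (cnj (ch ((of_real t)\<^sup>2 * (- Q (cis s))) + \<i> * e (cis s) * (t * sh ((of_real t)\<^sup>2 * (- Q (cis s))))))" for s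
      by (simp only: M_def m_def X_def Y_def)
    obtain m1 m2 n2 where
      Mj: "su11_jet M (cis (t * l)) m1 m2 0 (g1 * sin (t * l) / l) n2" and
      Mz: "\<i> * (m2 * cnj (cis (t * l)) + m1 * cnj m1 - (g1 * sin (t * l) / l) * cnj (g1 * sin (t * l) / l))
      = of_real (- (t * ((8 * Re b / 2 - (- 4 * Im b / (2 * l))\<^sup>2) / l)) - (cmod g1)\<^sup>2 / l\<^sup>2 * sin (t * l) * cos (t * l))"
      using traceless_exp_jet[OF l ej[unfolded \<open>e0 = of_real l\<close>] gj Qj e_real det M_cis] by blast
    have n1: "- (- g1 / l) * sin (t * l) = g1 * sin (t * l) / l"
      by simp
    \<comment> \<open>The drift is referred to the rotation angle \<open>2 * (t * l)\<close>, which
      gives the pitch.\<close>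
    have z: "- (t * ((8 * Re b / 2 - (- 4 * Im b / (2 * l))\<^sup>2) / l)) - (cmod g1)\<^sup>2 / l\<^sup>2 * sin (t * l) * cos (t * l)
      = (- 2 * (Re b * l\<^sup>2 - (Im b)\<^sup>2) / l ^ 4) * (2 * (t * l)) - (cmod (- g1 / l))\<^sup>2 * sin (t * l) * cos (t * l)"
    proof -
      have "- (t * ((8 * Re b / 2 - (- 4 * Im b / (2 * l))\<^sup>2) / l)) = (- 2 * (Re b * l\<^sup>2 - (Im b)\<^sup>2) / l ^ 4) * (2 * (t * l))"
        using l by (simp add: field_simps power2_eq_square eval_nat_numeral)
      moreover have "(cmod (- g1 / l))\<^sup>2 = (cmod g1)\<^sup>2 / l\<^sup>2"
        by (simp add: norm_divide power_divide)
      ultimately show ?thesis by simp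
    qed
    \<comment> \<open>In the first row the two sides differ by a multiple of the determinant defect
      of \<open>S w\<close>, which is zero; the second row is its conjugate.\<close>
    have intertwine: "S w ** pot_exp 1 b 2 (of_real t) w = M w ** S w" if w_circle: "w \<in> circle" for w
    proof -
      obtain s where w: "w = cis s" using w_circle by (auto simp: circle_cis)
      have \<beta>_w: "1 * cis (-s) + w * cnj b = \<beta> w"
        by (simp add: \<beta>_def w cis_cnj)
      have \<mu>_w: "pot_mu 1 b 2 w = - Q w"
        using pot_mu_cis[of 1 b 2 s] unfolding w[symmetric] \<beta>_w Q_def by simp
      have E: "pot_exp 1 b 2 (of_real t) w = mat2 (X w + \<i> * 2 * Y w) (\<beta> w * Y w) (cnj (\<beta> w * Y w)) (cnj (X w + \<i> * 2 * Y w))"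
        and real: "cnj (X w) = X w" "cnj (Y w) = Y w"
        using pot_exp_real_entries(1,3,4)[of t 1 b 2 s] unfolding w[symmetric] \<beta>_w \<mu>_w X_def Y_def by simp_all
      have 1: "cnj x * (X w + \<i> * 2 * Y w) + - u w * cnj (\<beta> w * Y w) = m w * cnj x + g w * Y w * cnj (- u w)"
      proof -
        have "cnj x * (X w + \<i> * 2 * Y w) + - u w * cnj (\<beta> w * Y w) - (m w * cnj x + g w * Y w * cnj (- u w))
           = Y w * (2 * \<i> * cnj x - u w * cnj (\<beta> w)) * (1 - (x * cnj x - u w * cnj (u w)))"
          unfolding m_def e_def g_def complex_cnj_mult complex_cnj_minus real
          by (simp add: power2_eq_square algebra_simps)
        then show ?thesis
          by (simp add: u_norm[OF w_circle])
      qed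
      have 2: "cnj x * (\<beta> w * Y w) + - u w * cnj (X w + \<i> * 2 * Y w) = m w * (- u w) + g w * Y w * x"
      proof -
        have "cnj x * (\<beta> w * Y w) + - u w * cnj (X w + \<i> * 2 * Y w) - (m w * (- u w) + g w * Y w * x)
           = Y w * (\<beta> w * cnj x + 2 * \<i> * u w) * (1 - (x * cnj x - u w * cnj (u w)))"
          unfolding m_def e_def g_def complex_cnj_mult complex_cnj_add complex_cnj_numeral complex_cnj_i real
          by (simp add: power2_eq_square algebra_simps)
        then show ?thesis
          by (simp add: u_norm[OF w_circle])
      qed
      have 3: "cnj (cnj x * (X w + \<i> * 2 * Y w) + - u w * cnj (\<beta> w * Y w)) = cnj (m w * cnj x + g w * Y w * cnj (- u w))"
        unfolding 1 ..
      have 4: "cnj (cnj x * (\<beta> w * Y w) + - u w * cnj (X w + \<i> * 2 * Y w)) = cnj (m w * (- u w) + g w * Y w * x)"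
        unfolding 2 ..
      have Sw: "S w = mat2 (cnj x) (- u w) (cnj (- u w)) (cnj (cnj x))"
        by (simp add: S[OF w_circle] u_def)
      show ?thesis
        unfolding Sw E M_def mat2_mult mat2_eq_iff
      proof (intro conjI)
        show "cnj x * (X w + \<i> * 2 * Y w) + - u w * cnj (\<beta> w * Y w) = m w * cnj x + g w * Y w * cnj (- u w)"
          by (fact 1)
        show "cnj x * (\<beta> w * Y w) + - u w * cnj (X w + \<i> * 2 * Y w) = m w * - u w + g w * Y w * cnj (cnj x)"
          using 2 by simp
        show "cnj (- u w) * (X w + \<i> * 2 * Y w) + cnj (cnj x) * cnj (\<beta> w * Y w)
            = cnj (g w * Y w) * cnj x + cnj (m w) * cnj (- u w)"
          using 4 by (simp add: add.commute)
        show "cnj (- u w) * (\<beta> w * Y w) + cnj (cnj x) * cnj (X w + \<i> * 2 * Y w)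
            = cnj (g w * Y w) * - u w + cnj (m w) * cnj (cnj x)"
          using 3 by (simp add: add.commute)
      qed
    qed
    show "\<exists>M m1 m2 n2. (\<forall>w\<in>circle. S w ** pot_exp 1 b 2 (of_real t) w = M w ** S w) \<and>
       su11_jet M (cis (t * l)) m1 m2 0 (- (- g1 / l) * sin (t * l)) n2 \<and>
       \<i> * (m2 * cnj (cis (t * l)) + m1 * cnj m1 - (- (- g1 / l) * sin (t * l)) * cnj (- (- g1 / l) * sin (t * l)))
       = of_real ((- 2 * (Re b * l\<^sup>2 - (Im b)\<^sup>2) / l ^ 4) * (2 * (t * l)) - (cmod (- g1 / l))\<^sup>2 * sin (t * l) * cos (t * l))"
      unfolding n1 z[symmetric] using intertwine Mj Mz by blast
  qed
qed

section \<open>Closed forms of axis and pitch\<close>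

lemma axis_value:
  fixes b y z L K :: complex
  assumes "L \<noteq> 0" "K \<noteq> 0" "1 + b \<noteq> 0" and L: "L\<^sup>2 = 3 - b - cnj b - b * cnj b"
    and y: "(1 + b) * y = \<i> * (2 - L) * z" and z: "z\<^sup>2 = (2 + L) / (2 * L) * ((1 + b) / K)"
  shows "- (- 4 * z * y + \<i> * (cnj b - 1) * z\<^sup>2 - \<i> * (3 + b) * y\<^sup>2) / L
    = \<i> * (2 + L) * (- 6 + cnj b + b * (3 + (b + cnj b)) + 4 * L) / (L\<^sup>2 * (1 + b) * K)"
proof -
  define N where "N = - 6 + cnj b + b * (3 + (b + cnj b)) + 4 * L"
  define g where "g = - 4 * z * y + \<i> * (cnj b - 1) * z\<^sup>2 - \<i> * (3 + b) * y\<^sup>2"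
  \<comment> \<open>Multiplying by the square of \<open>1 + b\<close> lets the eigenvector equation
    eliminate \<open>y\<close>; the relation for \<open>L\<close> then reduces the bracket to
    \<open>-2 * N\<close>.\<close>
  have "g * (1 + b)\<^sup>2 = - 4 * z * ((1 + b) * y) * (1 + b) + \<i> * (cnj b - 1) * z\<^sup>2 * (1 + b)\<^sup>2
      - \<i> * (3 + b) * ((1 + b) * y)\<^sup>2"
    by (simp add: g_def power2_eq_square algebra_simps)
  also have "\<dots> = \<i> * z\<^sup>2 * (- 4 * (2 - L) * (1 + b) + (cnj b - 1) * (1 + b)\<^sup>2 + (3 + b) * (4 - 4 * L + L\<^sup>2))"
    unfolding y by (simp add: power2_eq_square algebra_simps)
  also have "\<dots> = - 2 * \<i> * z\<^sup>2 * N"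
    unfolding L N_def by (simp add: power2_eq_square algebra_simps)
  also have "\<dots> = - \<i> * (2 + L) * N / (L * K) * (1 + b)"
    unfolding z using assms(1,2) by (simp add: field_simps)
  finally have "(g * (1 + b)) * (1 + b) = (- \<i> * (2 + L) * N / (L * K)) * (1 + b)"
    by (simp only: power2_eq_square mult.assoc)
  then have "g * (1 + b) = - \<i> * (2 + L) * N / (L * K)"
    using mult_right_cancel[OF assms(3)] by blast
  then have "g = - \<i> * (2 + L) * N / (L * K) / (1 + b)"
    by (rule eq_divide_imp[OF assms(3)])
  then show ?thesis
    unfolding g_def[symmetric] N_def[symmetric] using assms(1-3) by (simp add: power2_eq_square)
qed

lemma det_deg1_pot_1: "det (deg1_pot a b c 1) = of_real (c\<^sup>2 - (cmod (a + cnj b))\<^sup>2)"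
proof -
  have "(a + cnj b) * (b + cnj a) = of_real ((cmod (a + cnj b))\<^sup>2)"
    unfolding complex_norm_square by (simp add: add.commute)
  moreover have "\<i> * of_real c * (- \<i> * of_real c) = complex_of_real (c\<^sup>2)"
    by (simp add: complex_eq_iff power2_eq_square)
  ultimately show ?thesis
    unfolding deg1_pot_def det_mat2 by simp
qed

lemma eigenvector_frame_helicoid:
  fixes b :: complex
  assumes b: "cmod (1 + b) < 2" "b \<noteq> -1"
  shows
     "let D = deg1_pot 1 b 2;
          l = sqrt (3 - 2 * Re b - (cmod b)^2);
          \<alpha> = \<i> * (2 + l) * (-6 + cnj b + b * (3 + 2 * Re b) + 4 * l)
                / (l^2 * (1 + b) * sqrt (4 - l^2));
          P3 = 3 * Re b - (Re b)^2 - (cmod b)^2 * Re b - (cmod b)^2;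
          cc = -2 * P3 / l^4
      in Im (det (D 1)) = 0 \<and> Re (det (D 1)) > 0 \<and> det (D 1) = of_real (l^2) \<and> 0 < l \<and> l < 2 \<and>
         (\<exists>P. SU11 P \<and>
              D 1 *v column 1 P = (\<i> * of_real l) *s column 1 P \<and>
              D 1 *v column 2 P = (- \<i> * of_real l) *s column 2 P \<and>
              (let S = (\<lambda>w. matrix_inv (mat2 (P$1$1) (w * P$1$2) (P$2$1 / w) (P$2$2)))
               in invariant_under D S (\<lambda>t. helical \<alpha> cc (2 * l * t)) \<and>
                  ((\<exists>\<alpha>' \<omega>. \<omega> \<noteq> 0 \<and> invariant_under D S (\<lambda>t. helical \<alpha>' 0 (\<omega> * t)))
                     \<longleftrightarrow> P3 = 0)))"
proof -
  define D where "D = deg1_pot 1 b 2"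
  define l where "l = sqrt (3 - 2 * Re b - (cmod b)\<^sup>2)"
  define \<alpha> where "\<alpha> = \<i> * (2 + l) * (-6 + cnj b + b * (3 + 2 * Re b) + 4 * l)
                / (l^2 * (1 + b) * sqrt (4 - l^2))"
  define P3 where "P3 = 3 * Re b - (Re b)^2 - (cmod b)^2 * Re b - (cmod b)^2"
  define cc where "cc = -2 * P3 / l^4"
  \<comment> \<open>Since \<open>l\<^sup>2 = 4 - k\<^sup>2\<close>, the bounds on \<open>l\<close>
    amount to \<open>0 < k < 2\<close>.\<close>
  define k where "k = cmod (1 + b)"
  have k_sq: "k\<^sup>2 = 1 + 2 * Re b + (cmod b)\<^sup>2"
    unfolding k_def cmod_power2 by (simp add: power2_eq_square algebra_simps)
  have "1 + b \<noteq> 0"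
    using b(2) by (simp add: add_eq_0_iff)
  then have k: "0 < k" "k < 2"
    using b by (simp_all add: k_def)
  then have k2: "0 < k\<^sup>2" "k\<^sup>2 < 2\<^sup>2"
    by (simp, intro power_strict_mono) auto
  then have l_sq: "l\<^sup>2 = 3 - 2 * Re b - (cmod b)\<^sup>2"
    using k_sq by (simp add: l_def)
  have l: "0 < l"
    using k2 k_sq by (simp add: l_def)
  have lk: "4 - l\<^sup>2 = k\<^sup>2"
    using k_sq l_sq by simp
  have l2: "l < 2"
  proof (rule power2_less_imp_less)
    show "l\<^sup>2 < 2\<^sup>2"
      using lk k2(1) unfolding power2_eq_square by linarith
  qed simp
  have det: "det (D 1) = of_real (l\<^sup>2)"
  proof -
    have "cmod (1 + cnj b) = k"
      unfolding k_def by (metis complex_cnj_add complex_cnj_one complex_mod_cnj)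
    moreover have "l\<^sup>2 = 2\<^sup>2 - k\<^sup>2"
      using lk by simp
    ultimately show ?thesis
      unfolding D_def det_deg1_pot_1 by (simp only:)
  qed

  \<comment> \<open>The SU(1,1) eigenvectors are determined up to opposite phases, which rotate the
    axis about the origin. This phase gives the stated \<open>\<alpha>\<close>.\<close>
  define v where "v = csqrt ((1 + b) / k)"
  have v_sq: "v\<^sup>2 = (1 + b) / k"
    by (simp add: v_def)
  have "(cmod v)\<^sup>2 = 1\<^sup>2"
    unfolding norm_power[symmetric] v_sq using k by (simp add: norm_divide k_def)
  then have "v * cnj v = 1"
    unfolding complex_norm_square[symmetric] by simp
  \<comment> \<open>The modulus of \<open>x\<close> forced by the eigenvector equations and
    \<open>x * cnj x - y * cnj y = 1\<close>.\<close>
  define \<rho> where "\<rho> = sqrt ((2 + l) / (2 * l))"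
  have \<rho>: "\<rho>\<^sup>2 = (2 + l) / (2 * l)"
    using l by (simp add: \<rho>_def)
  define x where "x = \<rho> * cnj v"
  define y where "y = \<i> * (2 - of_real l) * cnj x / (1 + b)"
  have bb: "(1 + b) * (1 + cnj b) = (2 - of_real l) * (2 + of_real l)"
  proof -
    have "(1 + b) * (1 + cnj b) = of_real (k\<^sup>2)"
      unfolding k_def complex_norm_square by simp
    also have "\<dots> = (2 - of_real l) * (2 + of_real l)"
      unfolding lk[symmetric] by (simp add: power2_eq_square algebra_simps)
    finally show ?thesis .
  qed
  have "1 + cnj b \<noteq> 0"
    using \<open>1 + b \<noteq> 0\<close> by (metis complex_cnj_add complex_cnj_one complex_cnj_zero_iff)
  have xx: "x * cnj x = of_real ((2 + l) / (2 * l))"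
    using \<open>v * cnj v = 1\<close> unfolding \<rho>[symmetric] by (simp add: x_def power2_eq_square mult_ac)
  have eigen1: "(1 + b) * y = \<i> * (2 - of_real l) * cnj x"
    using \<open>1 + b \<noteq> 0\<close> by (simp add: y_def)
  have eigen2: "(1 + b) * x = \<i> * (2 + of_real l) * cnj y"
  proof -
    have "(1 + cnj b) * cnj y = - \<i> * (2 - of_real l) * x"
      using arg_cong[OF eigen1, of cnj] by simp
    then have "(1 + cnj b) * (\<i> * (2 + of_real l) * cnj y) = (2 - of_real l) * (2 + of_real l) * x"
      by (metis (no_types, lifting) i_times_eq_iff mult.assoc mult.left_commute mult_minus_left)
    also have "\<dots> = (1 + cnj b) * ((1 + b) * x)"
      unfolding bb[symmetric] by simp
    finally show ?thesis
      using \<open>1 + cnj b \<noteq> 0\<close> by simp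
  qed
  have norm: "x * cnj x - y * cnj y = 1"
  proof -
    have "(1 + b) * (1 + cnj b) * (y * cnj y) = ((1 + b) * y) * cnj ((1 + b) * y)"
      by simp
    also have "\<dots> = (2 - of_real l) * (2 - of_real l) * (x * cnj x)"
      unfolding eigen1 by (simp add: algebra_simps)
    finally have "(2 - of_real l) * ((2 + of_real l) * (y * cnj y)) = (2 - of_real l) * ((2 - of_real l) * (x * cnj x))"
      unfolding bb by simp
    moreover have "2 - complex_of_real l = of_real (2 - l)" "2 - l \<noteq> 0" "2 + complex_of_real l = of_real (2 + l)" "2 + l \<noteq> 0"
      using l l2 by simp_all
    ultimately have "of_real (2 + l) * (y * cnj y) = of_real (2 - l) * complex_of_real ((2 + l) / (2 * l))"
      unfolding xx by (simp only: mult_cancel_left of_real_eq_0_iff simp_thms)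
    also have "\<dots> = of_real (2 + l) * of_real ((2 - l) / (2 * l))"
      by simp
    finally have "y * cnj y = of_real ((2 - l) / (2 * l))"
      using \<open>2 + l \<noteq> 0\<close> by (simp only: mult_cancel_left of_real_eq_0_iff simp_thms)
    then have "x * cnj x - y * cnj y = of_real ((2 + l) / (2 * l) - (2 - l) / (2 * l))"
      unfolding xx by simp
    also have "(2 + l) / (2 * l) - (2 - l) / (2 * l) = 1"
      using l by (simp add: field_simps)
    finally show ?thesis by simp
  qed

  define P where "P = mat2 x y (cnj y) (cnj x)"
  \<comment> \<open>Conjugating \<open>P\<close> by the half powers of \<open>\<lambda>\<close>
    leaves only the integer powers written here; on the circle \<open>1 / w = cnj w\<close>, so the
    result has SU(1,1) form.\<close>
  define S where "S = (\<lambda>w. matrix_inv (mat2 (P$1$1) (w * P$1$2) (P$2$1 / w) (P$2$2)))"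
  have "y * cnj y - x * cnj x = - 1"
    unfolding norm[symmetric] by simp
  then have "SU11 P"
    using norm unfolding SU11_def P_def ctrans_mat2 sigma3_def mat2_mult det_mat2 mat2_eq_iff
    by (simp add: mult.commute)
  have D1: "D 1 = mat2 (2 * \<i>) (1 + cnj b) (1 + b) (- (2 * \<i>))"
    by (simp add: D_def deg1_pot_def mat2_eq_iff)
  have eigen': "(1 + cnj b) * cnj y = - \<i> * (2 - of_real l) * x" "(1 + cnj b) * cnj x = - \<i> * (2 + of_real l) * y"
    using arg_cong[OF eigen1, of cnj] arg_cong[OF eigen2, of cnj] by simp_all
  have col1: "D 1 *v column 1 P = (\<i> * of_real l) *s column 1 P"
    using eigen2 eigen'(1)
    by (simp add: D1 P_def vec_eq_iff matrix_vector_mult_def column_def sum_2 forall_2 algebra_simps)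
  have col2: "D 1 *v column 2 P = (- \<i> * of_real l) *s column 2 P"
    using eigen1 eigen'(2)
    by (simp add: D1 P_def vec_eq_iff matrix_vector_mult_def column_def sum_2 forall_2 algebra_simps)
  have S: "S w = mat2 (cnj x) (- (w * y)) (- cnj (w * y)) x" if "w \<in> circle" for w
  proof -
    have "w \<noteq> 0"
      using that by (auto simp: circle_def)
    have w: "cnj w = 1 / w"
      using inverse_cnj_circle[OF that] by (metis div_by_1 divide_divide_eq_right mult_1)
    have "S w = mat2 (cnj x) (- (w * y)) (- (cnj y / w)) x"
      unfolding S_def P_def mat2_nth by (rule matrix_inv_mat2) (use norm \<open>w \<noteq> 0\<close> in simp)
    then show ?thesis
      by (simp add: w)
  qed
  note inv = diagonalized_potential_invariant[OF l l_sq eigen1 eigen2 norm S]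
  have "- (- 4 * cnj x * y + \<i> * (cnj b - 1) * (cnj x)\<^sup>2 - \<i> * (3 + b) * y\<^sup>2) / l = \<alpha>"
  proof -
    have "(complex_of_real l)\<^sup>2 = 3 - b - cnj b - b * cnj b"
      unfolding of_real_power[symmetric] l_sq cmod_power2
      by (simp add: complex_eq_iff power2_eq_square)
    moreover have "(cnj x)\<^sup>2 = (2 + of_real l) / (2 * of_real l) * ((1 + b) / k)"
    proof -
      have "(cnj x)\<^sup>2 = of_real (\<rho>\<^sup>2) * v\<^sup>2"
        by (simp add: x_def power_mult_distrib)
      then show ?thesis
        unfolding \<rho> v_sq by simp
    qed
    moreover have "sqrt (4 - l\<^sup>2) = k" "complex_of_real (2 * Re b) = b + cnj b"
      using k by (simp_all add: lk complex_add_cnj)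
    ultimately show ?thesis
      unfolding \<alpha>_def using axis_value[of "of_real l" "of_real k" b y "cnj x"] eigen1 l k \<open>1 + b \<noteq> 0\<close>
      by simp
  qed
  moreover have "- 2 * (Re b * l\<^sup>2 - (Im b)\<^sup>2) / l ^ 4 = cc"
  proof -
    have "Re b * l\<^sup>2 - (Im b)\<^sup>2 = P3"
      unfolding l_sq P3_def cmod_power2 by (simp add: power2_eq_square algebra_simps)
    then show ?thesis by (simp add: cc_def)
  qed
  ultimately have inv_\<alpha>: "invariant_under D S (\<lambda>t. helical \<alpha> cc (2 * l * t))"
    using inv(2) by (simp add: D_def)
  \<comment> \<open>The competing rotation may have any axis and speed; uniqueness of the pitch
    still forces \<open>cc * (2 * l) = 0\<close>.\<close>
  have "(\<exists>\<alpha>' \<omega>. \<omega> \<noteq> 0 \<and> invariant_under D S (\<lambda>t. helical \<alpha>' 0 (\<omega> * t))) \<longleftrightarrow> P3 = 0"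
  proof
    assume "\<exists>\<alpha>' \<omega>. \<omega> \<noteq> 0 \<and> invariant_under D S (\<lambda>t. helical \<alpha>' 0 (\<omega> * t))"
    then obtain \<alpha>' \<omega> where inv0: "invariant_under D S (\<lambda>t. helical \<alpha>' 0 (\<omega> * t))"
      by blast
    obtain r0 r1 r2 u0 u1 u2 where "su11_jet S r0 r1 r2 u0 u1 u2"
      using inv(1) by blast
    from pitch_zero_unique[OF this inv_\<alpha>[unfolded D_def] inv0[unfolded D_def]]
    show "P3 = 0"
      using l by (simp add: cc_def)
  next
    assume "P3 = 0"
    then have "invariant_under D S (\<lambda>t. helical \<alpha> 0 (2 * l * t))"
      using inv_\<alpha> by (simp add: cc_def)
    moreover have "2 * l \<noteq> 0" using l by simp
    ultimately show "\<exists>\<alpha>' \<omega>. \<omega> \<noteq> 0 \<and> invariant_under D S (\<lambda>t. helical \<alpha>' 0 (\<omega> * t))"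
      by blast
  qed
  with \<open>SU11 P\<close> col1 col2 inv_\<alpha> det l l2 show ?thesis
    unfolding Let_def D_def[symmetric] l_def[symmetric] \<alpha>_def[symmetric] P3_def[symmetric] cc_def[symmetric]
    by (auto intro!: exI[of _ P] simp: S_def)
qed

theorem mainTheorem10:
  shows
  "(\<forall>b::complex. cmod (1 + b) < 2 \<and> b \<noteq> -1 \<longrightarrow>
     (let D = deg1_pot 1 b 2;
          l = sqrt (3 - 2 * Re b - (cmod b)^2);
          \<alpha> = \<i> * (2 + l) * (-6 + cnj b + b * (3 + 2 * Re b) + 4 * l)
                / (l^2 * (1 + b) * sqrt (4 - l^2));
          P3 = 3 * Re b - (Re b)^2 - (cmod b)^2 * Re b - (cmod b)^2;
          cc = -2 * P3 / l^4
      in Im (det (D 1)) = 0 \<and> Re (det (D 1)) > 0 \<and> det (D 1) = of_real (l^2) \<and> 0 < l \<and> l < 2 \<and>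
         (\<exists>P. SU11 P \<and>
              D 1 *v column 1 P = (\<i> * of_real l) *s column 1 P \<and>
              D 1 *v column 2 P = (- \<i> * of_real l) *s column 2 P \<and>
              (let S = (\<lambda>w. matrix_inv (mat2 (P$1$1) (w * P$1$2) (P$2$1 / w) (P$2$2)))
               in invariant_under D S (\<lambda>t. helical \<alpha> cc (2 * l * t)) \<and>
                  ((\<exists>\<alpha>' \<omega>. \<omega> \<noteq> 0 \<and> invariant_under D S (\<lambda>t. helical \<alpha>' 0 (\<omega> * t)))
                     \<longleftrightarrow> P3 = 0)))))
   \<and>
   (\<forall>(a::complex) (b::complex) (c::real) S.
      a \<noteq> 0 \<and> loop_SU11 S \<and> C2_loop S \<and>
      (\<exists>\<alpha> cc \<omega>. \<omega> \<noteq> 0 \<and> invariant_under (deg1_pot a b c) S (\<lambda>t. helical \<alpha> cc (\<omega> * t)))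
      \<longrightarrow> Im (det (deg1_pot a b c 1)) = 0 \<and> Re (det (deg1_pot a b c 1)) > 0)"
proof (intro conjI allI impI, goal_cases)
  case (1 b)
  then show ?case
    using eigenvector_frame_helicoid by blast
next
  case (2 a b c S)
  then show ?case
    by (simp add: det_deg1_pot_1)
next
  case (3 a b c S)
  then obtain \<alpha> cc \<omega> where "a \<noteq> 0" "\<omega> \<noteq> 0" "loop_SU11 S" "C2_loop S"
    and inv: "invariant_under (deg1_pot a b c) S (\<lambda>t. helical \<alpha> cc (\<omega> * t))"
    by blast
  obtain m0 m1 m2 n0 n1 n2 where "su11_jet S m0 m1 m2 n0 n1 n2"
    by (rule C2_loop_su11_jet[OF \<open>loop_SU11 S\<close> \<open>C2_loop S\<close>])
  from helicoidal_det_positive[OF \<open>a \<noteq> 0\<close> this \<open>\<omega> \<noteq> 0\<close> inv] show ?case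
    by (simp add: det_deg1_pot_1)
qed

end
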